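(* Let $\alpha,\beta,\gamma\ge 0$ with $\alpha+\beta+\gamma=1$ and each of $\alpha,\beta,\gamma$ strictly smaller than $1$, and assume $\delta_{\rm in}>0$ and $\delta_{\rm out}>0$. Let $$\alpha_{\rm in}=1+\frac{1+\delta_{\rm in}(\alpha+\gamma)}{\alpha+\beta},\qquad \alpha_{\rm out}=1+\frac{1+\delta_{\rm out}(\alpha+\gamma)}{\gamma+\beta},$$ $$c_1=\frac1{\alpha_{\rm in}-1},\qquad c_2=\frac1{\alpha_{\rm out}-1},\qquad a=\frac{c_2}{c_1}.$$ For $j=1,2$ let $(X_j,Y_j)$ be a pair of nonnegative integer-valued random variables with joint generating function $E(x^{X_j}y^{Y_j})=\varphi_j(x,y)$, $0\le x,y\le1$, where $$\varphi_1(x,y)=c_1^{-1}\int_1^\infty z^{-(1+1/c_1)}\bigl(x+(1-x)z\bigr)^{-(\delta_{\rm in}+1)}\bigl(y+(1-y)z^a\bigr)^{-\delta_{\rm out}}\,dz,$$ $$\varphi_2(x,y)=c_1^{-1}\int_1^\infty z^{-(1+1/c_1)}\bigl(x+(1-x)z\bigr)^{-\delta_{\rm in}}\bigl(y+(1-y)z^a\bigr)^{-(\delta_{\rm out}+1)}\,dz.$$ Then for each $j=1,2$ there is a Radon measure $V_j\in M_+([0,\infty]^2\setminus\{\boldsymbol 0\})$ such that, as $h\to\infty$, $$hP\Bigl[\bigl(h^{-1/(\alpha_{\rm in}-1)}X_j,\ h^{-1/(\alpha_{\rm out}-1)}Y_j\bigr)\in\cdot\,\Bigr]\to V_j(\cdot)$$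 vaguely in $M_+([0,\infty]^2\setminus\{\boldsymbol 0\})$. Furthermore, $V_1$ and $V_2$ concentrate on $(0,\infty)^2$ and have Lebesgue densities $f_1,f_2$ given by $$f_1(x,y)=c_1^{-1}\bigl(\Gamma(\delta_{\rm in}+1)\Gamma(\delta_{\rm out})\bigr)^{-1}x^{\delta_{\rm in}}y^{\delta_{\rm out}-1}\int_0^\infty z^{-(2+1/c_1+\delta_{\rm in}+a\delta_{\rm out})}e^{-(x/z+y/z^a)}\,dz,$$ $$f_2(x,y)=c_1^{-1}\bigl(\Gamma(\delta_{\rm in})\Gamma(\delta_{\rm out}+1)\bigr)^{-1}x^{\delta_{\rm in}-1}y^{\delta_{\rm out}}\int_0^\infty z^{-(1+a+1/c_1+\delta_{\rm in}+a\delta_{\rm out})}e^{-(x/z+y/z^a)}\,dz.$$ Finally, let $(p_{ij})_{i,j\ge0}$ be the limiting joint distribution of in-degree and out-degree in the directed preferential attachment model with parameters $\alpha,\beta,\gamma,\delta_{\rm in},\delta_{\rm out}$ (described in the context), and let $(I,O)$ be a random vector with joint mass function $P[I=i,O=j]=p_{ij}$. Then, as $h\to\infty$, $$hP\Bigl[\bigl(h^{-1/(\alpha_{\rm in}-1)}I,\ h^{-1/(\alpha_{\rm out}-1)}O\bigr)\in\cdot\,\Bigr]\to\frac{\gamma}{\alpha+\gamma}V_1(\cdot)+\frac{\alpha}{\alpha+\gamma}V_2(\cdot)$$ vaguely in $M_+([0,\infty]^2\setminus\{\boldsymbol 0\})$.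
   Context: Vague convergence. $M_+([0,\infty]^2\setminus\{\boldsymbol 0\})$ is the set of Radon measures on $[0,\infty]^2\setminus\{(0,0)\}$ (the compactified quadrant with the origin removed, so sets bounded away from the origin are relatively compact); $\mu_h\to\mu$ vaguely if $\int f\,d\mu_h\to\int f\,d\mu$ for every continuous compactly supported $f\ge0$ on $[0,\infty]^2\setminus\{(0,0)\}$. Preferential attachment model. Start with a finite directed graph $G(n_0)$ with at least one node and $n_0$ edges. For $n>n_0$, $G(n)$ has $n$ edges and a random number $N(n)$ of nodes, and is obtained from $G(n-1)$ as follows, where $D_{\rm in}(u),D_{\rm out}(u)$ are the in- and out-degree of node $u$ in $G(n-1)$: - With probability $\alpha$, append a new node $v$ and an edge $v\mapsto w$ to an existing node $w$ of $G(n-1)$, chosen with probability $\frac{D_{\rm in}(w)+\delta_{\rm in}}{n-1+\delta_{\rm in}N(n-1)}$. - With probability $\beta$, append only an edge $v\mapsto w$ between existing nodes $v,w$ of $G(n-1)$, chosen independently with probabilities $\frac{D_{\rm out}(v)+\delta_{\rm out}}{n-1+\delta_{\rm out}N(n-1)}$ for $v$ and $\frac{D_{\rm in}(w)+\delta_{\rm in}}{n-1+\delta_{\rm in}N(n-1)}$ for $w$. - With probability $\gamma$, append a new node $w$ and an edge $v\mapsto w$ from an existing node $v$ of $G(n-1)$, chosen with probability $\frac{D_{\rm out}(v)+\delta_{\rm out}}{n-1+\delta_{\rm out}N(n-1)}$. Let $N_{ij}(n)$ be the number of nodes of $G(n)$ with in-degree $i$ and out-degree $j$. It is known (Bollobás,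 Borgs, Chayes, Riordan 2003) that for all $i,j\ge0$ the limit $\lim_{n\to\infty}N_{ij}(n)/n=f_{ij}$ exists a.s. and is nonrandom; also $N(n)/n\to1-\beta$ a.s. The limiting joint degree distribution is $$p_{ij}=\lim_{n\to\infty}\frac{N_{ij}(n)}{N(n)}=\frac{f_{ij}}{1-\beta}\quad\text{a.s.},\qquad i,j=0,1,2,\dots$$ Known facts from earlier work (Samorodnitsky, Resnick, Towsley, Davis, Willis, Wan 2014): the functions $\varphi_1,\varphi_2$ in the claim are joint generating functions of pairs of nonnegative integer-valued random variables, and the joint generating function of $(p_{ij})$ is $$\sum_{i,j\ge0}x^iy^jp_{ij}=\frac{\gamma}{\alpha+\gamma}\,x\,\varphi_1(x,y)+\frac{\alpha}{\alpha+\gamma}\,y\,\varphi_2(x,y),\qquad 0\le x,y\le1.$$ *)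

theory Defs
  imports "HOL-Probability.Probability" "Graph_Theory.Digraph"
begin

section \<open>Radon measures and vague convergence\<close>

definition punctured_quadrant :: "(ennreal \<times> ennreal) set" where
  "punctured_quadrant = UNIV - {(0, 0)}"

text \<open>
  A Radon measure on \<^term>\<open>E\<close> is a Borel measure that is finite on compact sets.  On
  \<^const>\<open>punctured_quadrant\<close>, which is locally compact with countable base, regularity is
  automatic.
\<close>

definition radon_measure_on :: "'a::topological_space set \<Rightarrow> 'a measure \<Rightarrow> bool" where
  "radon_measure_on E \<mu> \<longleftrightarrow>
     sets \<mu> = sets (restrict_space borel E) \<and>
     (\<forall>K. compact K \<and> K \<subseteq> E \<longrightarrow> emeasure \<mu> K < \<infinity>)"

definition vague_convergence ::
    "'a::topological_space set \<Rightarrow> ('i \<Rightarrow> 'a measure) \<Rightarrow> 'a measure \<Rightarrow> 'i filter \<Rightarrow> bool" where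
  "vague_convergence E \<mu> \<nu> F \<longleftrightarrow>
     (\<forall>f :: 'a \<Rightarrow> real.
        continuous_on E f \<and> (\<forall>x\<in>E. 0 \<le> f x) \<and>
        (\<exists>K. compact K \<and> K \<subseteq> E \<and> (\<forall>x\<in>E - K. f x = 0)) \<longrightarrow>
        ((\<lambda>h. \<integral>\<^sup>+x. ennreal (f x) \<partial>\<mu> h) \<longlongrightarrow> (\<integral>\<^sup>+x. ennreal (f x) \<partial>\<nu>)) F)"

text \<open>Meaningful for measures on the same \<open>\<sigma>\<close>-algebra.\<close>

definition add_measure :: "'a measure \<Rightarrow> 'a measure \<Rightarrow> 'a measure" where
  "add_measure \<mu> \<nu> = measure_of (space \<mu>) (sets \<mu>) (\<lambda>A. emeasure \<mu> A + emeasure \<nu> A)"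

text \<open>
  The measure \<open>h P[(h\<^sup>-\<^sup>s X, h\<^sup>-\<^sup>t Y) \<in> \<cdot>]\<close>, restricted to the punctured quadrant: the law of
  the rescaled vector may charge the origin.
\<close>

definition scaled_law ::
    "'w measure \<Rightarrow> ('w \<Rightarrow> nat) \<Rightarrow> ('w \<Rightarrow> nat) \<Rightarrow> real \<Rightarrow> real \<Rightarrow> real
      \<Rightarrow> (ennreal \<times> ennreal) measure" where
  "scaled_law M X Y s t h =
     scale_measure (ennreal h)
       (restrict_space
          (distr M borel (\<lambda>\<omega>. (ennreal (h powr (- s) * real (X \<omega>)),
                               ennreal (h powr (- t) * real (Y \<omega>)))))
          punctured_quadrant)"

definition concentrated_on :: "'a measure \<Rightarrow> 'a set \<Rightarrow> bool" where
  "concentrated_on \<mu> A \<longleftrightarrow> A \<in> sets \<mu> \<and> emeasure \<mu> (space \<mu> - A) = 0"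

text \<open>
  For \<^term>\<open>\<mu>\<close> concentrated on the open quadrant, \<^const>\<open>enn2real\<close> in each coordinate is, up to
  a null set, the identification of that quadrant with \<^term>\<open>{0<..} \<times> {0<..} :: (real \<times> real) set\<close>.
\<close>

definition has_quadrant_density ::
    "(ennreal \<times> ennreal) measure \<Rightarrow> (real \<Rightarrow> real \<Rightarrow> real) \<Rightarrow> bool" where
  "has_quadrant_density \<mu> f \<longleftrightarrow>
     concentrated_on \<mu> ({0<..<\<infinity>} \<times> {0<..<\<infinity>}) \<and>
     distributed \<mu> lborel (\<lambda>(x, y). (enn2real x, enn2real y))
       (\<lambda>(x, y). ennreal (f x y) * indicator ({0<..} \<times> {0<..}) (x, y))"


section \<open>Generating functions and limit densities\<close>

definition phi1 :: "real \<Rightarrow> real \<Rightarrow> real \<Rightarrow> real \<Rightarrow> real \<Rightarrow> real \<Rightarrow> real" where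
  "phi1 c\<^sub>1 a \<delta>\<^sub>i\<^sub>n \<delta>\<^sub>o\<^sub>u\<^sub>t x y =
     inverse c\<^sub>1 * (LBINT z:{1<..}. z powr (- (1 + 1 / c\<^sub>1))
        * (x + (1 - x) * z) powr (- (\<delta>\<^sub>i\<^sub>n + 1))
        * (y + (1 - y) * z powr a) powr (- \<delta>\<^sub>o\<^sub>u\<^sub>t))"

definition phi2 :: "real \<Rightarrow> real \<Rightarrow> real \<Rightarrow> real \<Rightarrow> real \<Rightarrow> real \<Rightarrow> real" where
  "phi2 c\<^sub>1 a \<delta>\<^sub>i\<^sub>n \<delta>\<^sub>o\<^sub>u\<^sub>t x y =
     inverse c\<^sub>1 * (LBINT z:{1<..}. z powr (- (1 + 1 / c\<^sub>1))
        * (x + (1 - x) * z) powr (- \<delta>\<^sub>i\<^sub>n)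
        * (y + (1 - y) * z powr a) powr (- (\<delta>\<^sub>o\<^sub>u\<^sub>t + 1)))"

text \<open>At the boundary \<open>x = 0\<close> or \<open>y = 0\<close> the usual convention \<open>0\<^sup>0 = 1\<close> is in force.\<close>

definition has_joint_pgf ::
    "'w measure \<Rightarrow> ('w \<Rightarrow> nat) \<Rightarrow> ('w \<Rightarrow> nat) \<Rightarrow> (real \<Rightarrow> real \<Rightarrow> real) \<Rightarrow> bool" where
  "has_joint_pgf M X Y \<phi> \<longleftrightarrow>
     (\<forall>x\<in>{0..1}. \<forall>y\<in>{0..1}. (LINT \<omega>|M. x ^ X \<omega> * y ^ Y \<omega>) = \<phi> x y)"

definition density1 :: "real \<Rightarrow> real \<Rightarrow> real \<Rightarrow> real \<Rightarrow> real \<Rightarrow> real \<Rightarrow> real" where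
  "density1 c\<^sub>1 a \<delta>\<^sub>i\<^sub>n \<delta>\<^sub>o\<^sub>u\<^sub>t x y =
     inverse c\<^sub>1 * inverse (Gamma (\<delta>\<^sub>i\<^sub>n + 1) * Gamma \<delta>\<^sub>o\<^sub>u\<^sub>t)
       * x powr \<delta>\<^sub>i\<^sub>n * y powr (\<delta>\<^sub>o\<^sub>u\<^sub>t - 1)
       * (LBINT z:{0<..}. z powr (- (2 + 1 / c\<^sub>1 + \<delta>\<^sub>i\<^sub>n + a * \<delta>\<^sub>o\<^sub>u\<^sub>t))
            * exp (- (x / z + y / z powr a)))"

definition density2 :: "real \<Rightarrow> real \<Rightarrow> real \<Rightarrow> real \<Rightarrow> real \<Rightarrow> real \<Rightarrow> real" where
  "density2 c\<^sub>1 a \<delta>\<^sub>i\<^sub>n \<delta>\<^sub>o\<^sub>u\<^sub>t x y =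
     inverse c\<^sub>1 * inverse (Gamma \<delta>\<^sub>i\<^sub>n * Gamma (\<delta>\<^sub>o\<^sub>u\<^sub>t + 1))
       * x powr (\<delta>\<^sub>i\<^sub>n - 1) * y powr \<delta>\<^sub>o\<^sub>u\<^sub>t
       * (LBINT z:{0<..}. z powr (- (1 + a + 1 / c\<^sub>1 + \<delta>\<^sub>i\<^sub>n + a * \<delta>\<^sub>o\<^sub>u\<^sub>t))
            * exp (- (x / z + y / z powr a)))"


section \<open>Directed preferential attachment\<close>

text \<open>
  Loops and parallel arcs are allowed.  Nodes and arcs are labelled by natural numbers; the choice
  of fresh labels is immaterial for the degree counts.
\<close>

type_synonym pa_graph = "(nat, nat) pre_digraph"

definition new_node :: "pa_graph \<Rightarrow> nat" where
  "new_node G = (LEAST v. v \<notin> verts G)"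

definition add_edge :: "nat \<Rightarrow> nat \<Rightarrow> pa_graph \<Rightarrow> pa_graph" where
  "add_edge v w G =
     (let e = (LEAST e. e \<notin> arcs G)
      in \<lparr>verts = verts G \<union> {v, w}, arcs = insert e (arcs G),
          tail = (tail G)(e := v), head = (head G)(e := w)\<rparr>)"

definition in_choice :: "real \<Rightarrow> pa_graph \<Rightarrow> nat \<Rightarrow> real" where
  "in_choice \<delta> G w =
     (real (in_degree G w) + \<delta>) / (real (card (arcs G)) + \<delta> * real (card (verts G)))"

definition out_choice :: "real \<Rightarrow> pa_graph \<Rightarrow> nat \<Rightarrow> real" where
  "out_choice \<delta> G v =
     (real (out_degree G v) + \<delta>) / (real (card (arcs G)) + \<delta> * real (card (verts G)))"

definition pa_transition ::
    "real \<Rightarrow> real \<Rightarrow> real \<Rightarrow> real \<Rightarrow> real \<Rightarrow> pa_graph \<Rightarrow> pa_graph \<Rightarrow> real" where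
  "pa_transition \<alpha> \<beta> \<gamma> \<delta>\<^sub>i\<^sub>n \<delta>\<^sub>o\<^sub>u\<^sub>t G G' =
     \<alpha> * (\<Sum>w\<in>verts G. in_choice \<delta>\<^sub>i\<^sub>n G w * of_bool (G' = add_edge (new_node G) w G))
   + \<beta> * (\<Sum>v\<in>verts G. \<Sum>w\<in>verts G.
            out_choice \<delta>\<^sub>o\<^sub>u\<^sub>t G v * in_choice \<delta>\<^sub>i\<^sub>n G w * of_bool (G' = add_edge v w G))
   + \<gamma> * (\<Sum>v\<in>verts G. out_choice \<delta>\<^sub>o\<^sub>u\<^sub>t G v * of_bool (G' = add_edge v (new_node G) G))"

text \<open>
  \<open>\<G> n\<close> is the graph with \<open>n\<close> edges, for \<open>n \<ge> n\<^sub>0\<close>; it starts in the deterministic graph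
  \<open>G\<^sub>0\<close> and is a Markov chain with the above one-step probabilities.
\<close>

definition pref_attachment ::
    "real \<Rightarrow> real \<Rightarrow> real \<Rightarrow> real \<Rightarrow> real \<Rightarrow> nat \<Rightarrow> pa_graph
      \<Rightarrow> 'w measure \<Rightarrow> (nat \<Rightarrow> 'w \<Rightarrow> pa_graph) \<Rightarrow> bool" where
  "pref_attachment \<alpha> \<beta> \<gamma> \<delta>\<^sub>i\<^sub>n \<delta>\<^sub>o\<^sub>u\<^sub>t n\<^sub>0 G\<^sub>0 M \<G> \<longleftrightarrow>
     prob_space M \<and>
     (\<forall>n. \<G> n \<in> measurable M (count_space UNIV)) \<and>
     fin_digraph G\<^sub>0 \<and> verts G\<^sub>0 \<noteq> {} \<and> card (arcs G\<^sub>0) = n\<^sub>0 \<and>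
     (AE \<omega> in M. \<G> n\<^sub>0 \<omega> = G\<^sub>0) \<and>
     (\<forall>n\<ge>n\<^sub>0. \<forall>g.
        measure M {\<omega> \<in> space M. \<forall>k\<in>{n\<^sub>0..Suc n}. \<G> k \<omega> = g k} =
        measure M {\<omega> \<in> space M. \<forall>k\<in>{n\<^sub>0..n}. \<G> k \<omega> = g k}
          * pa_transition \<alpha> \<beta> \<gamma> \<delta>\<^sub>i\<^sub>n \<delta>\<^sub>o\<^sub>u\<^sub>t (g n) (g (Suc n)))"

definition degree_count :: "pa_graph \<Rightarrow> nat \<Rightarrow> nat \<Rightarrow> nat" where
  "degree_count G i j = card {v \<in> verts G. in_degree G v = i \<and> out_degree G v = j}"

definition limiting_degree_distribution ::
    "'w measure \<Rightarrow> (nat \<Rightarrow> 'w \<Rightarrow> pa_graph) \<Rightarrow> (nat \<Rightarrow> nat \<Rightarrow> real) \<Rightarrow> bool" where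
  "limiting_degree_distribution M \<G> p \<longleftrightarrow>
     (\<forall>i j. AE \<omega> in M.
        (\<lambda>n. real (degree_count (\<G> n \<omega>) i j) / real (card (verts (\<G> n \<omega>)))) \<longlonglongrightarrow> p i j)"

definition has_joint_pmf ::
    "'w measure \<Rightarrow> ('w \<Rightarrow> nat) \<Rightarrow> ('w \<Rightarrow> nat) \<Rightarrow> (nat \<Rightarrow> nat \<Rightarrow> real) \<Rightarrow> bool" where
  "has_joint_pmf M I J p \<longleftrightarrow>
     (\<forall>i j. measure M {\<omega> \<in> space M. I \<omega> = i \<and> J \<omega> = j} = p i j)"

end

theory Submission
  imports Defs
begin

text \<open>
  Write \<open>c = c\<^sub>1\<close>.  The function \<open>(x + (1 - x) z)\<^bsup>-r\<^esup>\<close> is the generating function of the negative binomial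
  law with shape \<open>r\<close> and success probability \<open>1 / z\<close>, so \<open>\<phi>\<^sub>1\<close> and \<open>\<phi>\<^sub>2\<close> are the generating functions of
  mixtures: draw \<open>Z\<close> from the Pareto law with density \<open>c\<^sup>-\<^sup>1 z\<^bsup>-1-1/c\<^esup>\<close> on \<open>z > 1\<close> and, given \<open>Z\<close>, draw two
  independent negative binomial variables with parameters \<open>Z\<close> and \<open>Z\<^bsup>a\<^esup>\<close>.  This law is \<open>yule_pmf\<close>.

  A negative binomial variable with parameter \<open>z\<close>, divided by \<open>z\<close>, converges to a gamma variable.  The
  substitution \<open>z = h\<^bsup>c\<^esup> w\<close> turns \<open>h\<close> times the Pareto density on \<open>z > 1\<close> into the same power on
  \<open>w > h\<^bsup>-c\<^esup>\<close>, so the rescaled laws should converge to the gamma mixture in which \<open>w\<close> runs over all of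
  \<open>(0, \<infinity>)\<close> (\<open>limit_measure\<close>); integrating out \<open>w\<close> gives the stated densities
  (\<open>limit_density_eq_mixture\<close>).  Two facts make this rigorous in \<open>yule_vague_limit\<close>.  For fixed
  \<open>w\<close> the conditional laws converge weakly on the compact square \<open>[0, \<infinity>]\<^sup>2\<close>, because by
  Stone-Weierstrass it suffices to test against \<open>exp (- m x - n y)\<close>
  (\<open>weak_convergence_by_exp_monoms\<close>), where the generating function is explicit.  For small \<open>w\<close> an
  exponential Markov inequality (\<open>negbin_tail\<close>) bounds the probability of leaving a neighbourhood of
  the origin by a multiple of \<open>exp (- \<epsilon> / (4 w)) + exp (- \<epsilon> / (4 w\<^bsup>a\<^esup>))\<close>, which is integrable
  against \<open>w\<^bsup>-1-1/c\<^esup>\<close>; dominated convergence applies.  The Stone-Weierstrass argument also shows that a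
  generating function determines the integrals of all continuous functions, so that the pairs
  \<open>(X\<^sub>j, Y\<^sub>j)\<close> may be replaced by the explicit mixtures (\<open>vague_convergence_by_pgf\<close>).

  For the graph it remains to identify \<open>p\<close>.  The expected number of nodes with degrees \<open>(i, j)\<close> has
  increments that converge, since \<open>N\<^sub>i\<^sub>j(n) / N(n)\<close> converges almost surely and boundedly and
  \<open>N(n) / n\<close> converges in mean to \<open>\<alpha> + \<gamma>\<close>; the limit of the increments must be the limit of
  \<open>E N\<^sub>i\<^sub>j(n) / n\<close>.  This is a linear recursion for \<open>p\<close> (\<open>degree_recursion\<close>) with exactly one
  solution.  The mixture \<open>\<gamma>/(\<alpha>+\<gamma>)\<close> times the law of \<open>(X\<^sub>1 + 1, Y\<^sub>1)\<close> plus \<open>\<alpha>/(\<alpha>+\<gamma>)\<close> times the law of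
  \<open>(X\<^sub>2, Y\<^sub>2 + 1)\<close> solves the same recursion: this is integration by parts in \<open>z\<close>
  (\<open>yule_pmf_recursion\<close>).  The added ones disappear in the scaling limit.
\<close>


section \<open>Negative binomial laws and their Pareto mixture\<close>

text \<open>
  The law of the number of failures before the \<open>r\<close>-th success, for real \<open>r > 0\<close> and success
  probability \<open>1 / z\<close>.  Parametrised by \<open>z\<close>, its mean \<open>r (z - 1)\<close> grows linearly.
\<close>

definition negbin_mass :: "real \<Rightarrow> real \<Rightarrow> nat \<Rightarrow> real" where
  "negbin_mass r z i = pochhammer r i / fact i * z powr (- r) * (1 - 1 / z) ^ i"

text \<open>
  Newton's binomial series with exponent \<open>-r\<close>.  Arguments \<open>x > 1\<close> are admitted because the tail
  bound for these laws evaluates the generating function slightly beyond 1.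
\<close>

lemma negbin_mass_sums:
  assumes "1 \<le> z" "0 \<le> x" "x * (1 - 1 / z) < 1"
  shows "(\<lambda>i. negbin_mass r z i * x ^ i) sums (x + (1 - x) * z) powr (- r)"
proof -
  have "0 \<le> x * (1 - 1 / z)" using assms by simp
  then have "\<bar>- (x * (1 - 1 / z))\<bar> < 1" using assms by linarith
  from gen_binomial_real[OF this, of "-r"]
  have "(\<lambda>i. (- r gchoose i) * (- (x * (1 - 1 / z))) ^ i) sums (1 - x * (1 - 1 / z)) powr (- r)"
    by simp
  then have "(\<lambda>i. z powr (- r) * ((- r gchoose i) * (- (x * (1 - 1 / z))) ^ i))
      sums (z powr (- r) * (1 - x * (1 - 1 / z)) powr (- r))"
    by (rule sums_mult)
  moreover have "z powr (- r) * ((- r gchoose i) * (- (x * (1 - 1 / z))) ^ i) = negbin_mass r z i * x ^ i" for i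
  proof -
    have "(- (x * (1 - 1 / z))) ^ i = (- 1) ^ i * (x * (1 - 1 / z)) ^ i"
      by (metis mult_minus1 power_mult_distrib)
    moreover have "(- 1) ^ i * ((- 1) ^ i :: real) = 1"
      by (metis power_minus_mult left_minus_one_mult_self mult.right_neutral)
    ultimately show ?thesis
      unfolding negbin_mass_def gbinomial_pochhammer by (simp add: power_mult_distrib)
  qed
  moreover have "z powr (- r) * (1 - x * (1 - 1 / z)) powr (- r) = (x + (1 - x) * z) powr (- r)"
  proof -
    have "z * (1 - x * (1 - 1 / z)) = x + (1 - x) * z" using assms by (simp add: field_simps)
    then show ?thesis using assms by (metis powr_mult)
  qed
  ultimately show ?thesis by simp
qed

lemma negbin_mass_nonneg: "0 < r \<Longrightarrow> 1 \<le> z \<Longrightarrow> 0 \<le> negbin_mass r z i"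
  unfolding negbin_mass_def by (simp add: pochhammer_nonneg)

definition negbin :: "real \<Rightarrow> real \<Rightarrow> nat pmf" where
  "negbin r z = embed_pmf (negbin_mass r z)"

lemma pmf_negbin:
  assumes "0 < r" "1 \<le> z"
  shows "pmf (negbin r z) i = negbin_mass r z i"
  unfolding negbin_def
proof (rule pmf_embed_pmf)
  have "(\<lambda>i. negbin_mass r z i * 1 ^ i) sums (1 + (1 - 1) * z) powr (- r)"
    using assms by (intro negbin_mass_sums) auto
  then have "(\<Sum>i. ennreal (negbin_mass r z i)) = ennreal 1"
    using assms negbin_mass_nonneg by (intro suminf_ennreal_eq) auto
  then show "(\<integral>\<^sup>+ i. ennreal (negbin_mass r z i) \<partial>count_space UNIV) = 1"
    by (simp add: nn_integral_count_space_nat)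
qed (use assms negbin_mass_nonneg in auto)

lemma negbin_mass_le_1: "1 \<le> z \<Longrightarrow> 0 < q \<Longrightarrow> negbin_mass q z i \<le> 1"
  by (metis pmf_negbin pmf_le_1)

lemma nn_integral_negbin:
  assumes "0 < r" "1 \<le> z"
  shows "(\<integral>\<^sup>+ i. g i \<partial>negbin r z) = (\<Sum>i. ennreal (negbin_mass r z i) * g i)"
  using assms by (simp add: nn_integral_measure_pmf pmf_negbin nn_integral_count_space_nat)

lemma negbin_pgf:
  assumes "0 < r" "1 \<le> z" "0 \<le> x" "x * (1 - 1 / z) < 1"
  shows "(\<integral>\<^sup>+ i. ennreal (x ^ i) \<partial>negbin r z) = ennreal ((x + (1 - x) * z) powr (- r))"
proof -
  have "(\<Sum>i. ennreal (negbin_mass r z i * x ^ i)) = ennreal ((x + (1 - x) * z) powr (- r))"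
    using assms negbin_mass_nonneg by (intro suminf_ennreal_eq negbin_mass_sums) auto
  then show ?thesis
    using assms negbin_mass_nonneg by (simp add: nn_integral_negbin ennreal_mult)
qed

lemma negbin_pgf_unit:
  assumes "0 < r" "1 \<le> z" "0 \<le> x" "x \<le> 1"
  shows "(\<integral>\<^sup>+ i. ennreal (x ^ i) \<partial>negbin r z) = ennreal ((x + (1 - x) * z) powr (- r))"
proof (rule negbin_pgf[OF assms(1-3)])
  have "x * (1 - 1 / z) \<le> 1 * (1 - 1 / z)" using assms by (intro mult_right_mono) auto
  also have "\<dots> < 1" using assms by simp
  finally show "x * (1 - 1 / z) < 1" .
qed

lemma measurable_negbin_mass[measurable]: "(\<lambda>z. negbin_mass r z i) \<in> borel_measurable borel"
  unfolding negbin_mass_def by measurable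

lemma nn_integral_count_space_nat_prod:
  fixes g :: "nat \<times> nat \<Rightarrow> ennreal"
  shows "(\<integral>\<^sup>+ p. g p \<partial>count_space UNIV) = (\<Sum>i. \<Sum>j. g (i, j))"
proof -
  have "(\<integral>\<^sup>+ p. g p \<partial>count_space (UNIV :: (nat \<times> nat) set)) 
     = (\<integral>\<^sup>+ i. \<integral>\<^sup>+ j. g (i, j) \<partial>count_space UNIV \<partial>count_space UNIV)"
    by (simp add: nn_integral_fst_count_space)
  then show ?thesis by (simp add: nn_integral_count_space_nat)
qed

text \<open>
  A probability density on \<open>z > 1\<close>; on all of \<open>z > 0\<close> it has infinite mass near 0 and is the density
  of the mixing variable in the scaling limit.
\<close>

definition pareto_density :: "real \<Rightarrow> real \<Rightarrow> real" where
  "pareto_density c z = inverse c * z powr (- (1 + 1 / c))"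

lemma measurable_pareto_density[measurable]: "pareto_density c \<in> borel_measurable borel"
  unfolding pareto_density_def by measurable

lemma pareto_density_nonneg: "0 < c \<Longrightarrow> 0 \<le> pareto_density c z"
  by (simp add: pareto_density_def)

lemma nn_integral_pareto_density:
  assumes "0 < c" "0 < b"
  shows "(\<integral>\<^sup>+ z\<in>{b<..}. ennreal (pareto_density c z) \<partial>lborel) = ennreal (b powr (- 1 / c))"
proof -
  have "(\<integral>\<^sup>+ z\<in>{b<..}. ennreal (pareto_density c z) \<partial>lborel)
      = (\<integral>\<^sup>+ z. ennreal (pareto_density c z) * indicator {b..} z \<partial>lborel)"
    by (rule nn_integral_cong_AE, rule AE_mp[OF AE_lborel_singleton[of b]]) (auto split: split_indicator)
  also have "\<dots> = ennreal (0 - (- (b powr (- 1 / c))))"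
  proof (rule nn_integral_FTC_atLeast)
    show "((\<lambda>z. - (z powr (- 1 / c))) has_real_derivative pareto_density c z) (at z)" if "b \<le> z" for z
      using that assms unfolding pareto_density_def
      by (auto intro!: derivative_eq_intros arg_cong[of _ _ "\<lambda>u. z powr u"] simp: field_simps)
    have "((\<lambda>z. z powr (- 1 / c)) \<longlongrightarrow> 0) at_top"
      using assms by (intro tendsto_neg_powr filterlim_ident) simp
    then show "((\<lambda>z. - (z powr (- 1 / c))) \<longlongrightarrow> 0) at_top"
      by (auto intro: tendsto_eq_intros)
  qed (use assms in \<open>auto simp: pareto_density_nonneg\<close>)
  finally show ?thesis by simp
qed

abbreviation (input) yule_kernel :: "real \<Rightarrow> real \<Rightarrow> real \<Rightarrow> real \<Rightarrow> nat \<Rightarrow> nat \<Rightarrow> real \<Rightarrow> real" where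
  "yule_kernel c a r s i j z \<equiv> pareto_density c z * (negbin_mass r z i * negbin_mass s (z powr a) j)"

text \<open>
  For integers \<open>r\<close> and \<open>s\<close> these are the numbers of descendants in two independent Yule processes that start
  with \<open>r\<close> and \<open>s\<close> individuals and have rates 1 and \<open>a\<close>, observed at an independent exponential time.
\<close>

definition yule_pmf :: "real \<Rightarrow> real \<Rightarrow> real \<Rightarrow> real \<Rightarrow> (nat \<times> nat) pmf" where
  "yule_pmf c a r s = embed_pmf (\<lambda>(i, j). LBINT z:{1<..}. yule_kernel c a r s i j z)"

context
  fixes c a r s :: real
  assumes pos: "0 < c" "0 < a" "0 < r" "0 < s"
begin

lemma set_integrable_yule:
  "set_integrable lborel {1<..} (\<lambda>z. yule_kernel c a r s i j z)"
proof -
  have "integrable lborel (\<lambda>z. pareto_density c z * indicator {1<..} z)"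
  proof (rule integrableI_nonneg)
    show "(\<integral>\<^sup>+ z. ennreal (pareto_density c z * indicator {1<..} z) \<partial>lborel) < \<infinity>"
      using nn_integral_pareto_density[of c 1] pos
      by (simp add: ennreal_mult' ennreal_indicator pareto_density_nonneg ennreal_mult)
  qed (use pos in \<open>auto simp: pareto_density_nonneg\<close>)
  then show ?thesis unfolding set_integrable_def
  proof (rule Bochner_Integration.integrable_bound)
    show "AE z in lborel. norm (indicat_real {1<..} z *\<^sub>R (yule_kernel c a r s i j z))
       \<le> norm (pareto_density c z * indicator {1<..} z)"
    proof (rule AE_I2)
      fix z :: real
      show "norm (indicat_real {1<..} z *\<^sub>R (yule_kernel c a r s i j z))
       \<le> norm (pareto_density c z * indicator {1<..} z)"
      proof (cases "1 < z")
        case True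
        then have z: "1 \<le> z" "1 \<le> z powr a" using pos by (auto simp: ge_one_powr_ge_zero)
        have "negbin_mass r z i * negbin_mass s (z powr a) j \<le> 1 * 1"
          using z pos by (intro mult_mono negbin_mass_le_1 negbin_mass_nonneg) auto
        then show ?thesis using True z pos
          by (simp add: abs_mult pareto_density_nonneg negbin_mass_nonneg mult_left_le)
      qed simp
    qed
  qed measurable
qed

lemma ennreal_yule:
  "ennreal (LBINT z:{1<..}. yule_kernel c a r s i j z)
   = (\<integral>\<^sup>+ z\<in>{1<..}. ennreal (pareto_density c z) * (ennreal (negbin_mass r z i) * ennreal (negbin_mass s (z powr a) j)) \<partial>lborel)"
proof -
  have nn: "0 \<le> indicator {1<..} z *\<^sub>R (yule_kernel c a r s i j z)" for z
  proof (cases "1 < z")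
    case True
    then have z: "1 \<le> z" "1 \<le> z powr a" using pos by (auto simp: ge_one_powr_ge_zero)
    then show ?thesis using pos by (simp add: pareto_density_nonneg negbin_mass_nonneg)
  qed simp
  have "ennreal (LBINT z:{1<..}. yule_kernel c a r s i j z)
    = (\<integral>\<^sup>+ z. ennreal (indicator {1<..} z *\<^sub>R (yule_kernel c a r s i j z)) \<partial>lborel)"
    unfolding set_lebesgue_integral_def
    using set_integrable_yule nn unfolding set_integrable_def
    by (intro nn_integral_eq_integral[symmetric]) auto
  also have "\<dots> = (\<integral>\<^sup>+ z\<in>{1<..}. ennreal (pareto_density c z) * (ennreal (negbin_mass r z i) * ennreal (negbin_mass s (z powr a) j)) \<partial>lborel)"
  proof (intro nn_integral_cong)
    fix z :: real
    show "ennreal (indicator {1<..} z *\<^sub>R (yule_kernel c a r s i j z))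
      = ennreal (pareto_density c z) * (ennreal (negbin_mass r z i) * ennreal (negbin_mass s (z powr a) j)) * indicator {1<..} z"
    proof (cases "1 < z")
      case True
      then have z: "1 \<le> z" "1 \<le> z powr a" using pos by (auto simp: ge_one_powr_ge_zero)
      then show ?thesis using True pos by (simp add: pareto_density_nonneg negbin_mass_nonneg ennreal_mult)
    qed simp
  qed
  finally show ?thesis .
qed

lemma nn_integral_pair_negbin:
  assumes "1 \<le> z"
  shows "(\<integral>\<^sup>+ p. g p \<partial>pair_pmf (negbin r z) (negbin s (z powr a)))
    = (\<Sum>i. \<Sum>j. ennreal (negbin_mass r z i) * ennreal (negbin_mass s (z powr a) j) * g (i, j))"
proof -
  have "1 \<le> z powr a" using assms pos by (simp add: ge_one_powr_ge_zero)
  then show ?thesis using assms pos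
    by (simp add: nn_integral_pair_pmf' nn_integral_negbin mult.assoc)
qed

text \<open>
  Tonelli's theorem, carried out before the masses are known to sum to 1: the case \<open>g = 1\<close> proves that.
\<close>

lemma mixture_as_series:
  "(\<Sum>i. \<Sum>j. ennreal (LBINT z:{1<..}. yule_kernel c a r s i j z) * g (i, j))
   = (\<integral>\<^sup>+ z\<in>{1<..}. ennreal (pareto_density c z)
        * (\<integral>\<^sup>+ p. g p \<partial>pair_pmf (negbin r z) (negbin s (z powr a))) \<partial>lborel)"
proof -
  have "(\<Sum>i. \<Sum>j. ennreal (LBINT z:{1<..}. yule_kernel c a r s i j z) * g (i, j))
    = (\<Sum>i. \<Sum>j. \<integral>\<^sup>+ z\<in>{1<..}. ennreal (pareto_density c z) *
          (ennreal (negbin_mass r z i) * ennreal (negbin_mass s (z powr a) j) * g (i, j)) \<partial>lborel)"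
    unfolding ennreal_yule
    by (intro suminf_cong, subst nn_integral_multc[symmetric]) (auto simp: ac_simps)
  also have "\<dots> = (\<integral>\<^sup>+ z. (\<Sum>i. \<Sum>j. ennreal (pareto_density c z) *
          (ennreal (negbin_mass r z i) * ennreal (negbin_mass s (z powr a) j) * g (i, j)) * indicator {1<..} z) \<partial>lborel)"
    by (subst nn_integral_suminf, simp, subst nn_integral_suminf, simp_all del: ennreal_suminf_cmult ennreal_suminf_multc)
  also have "\<dots> = (\<integral>\<^sup>+ z\<in>{1<..}. ennreal (pareto_density c z)
        * (\<integral>\<^sup>+ p. g p \<partial>pair_pmf (negbin r z) (negbin s (z powr a))) \<partial>lborel)"
  proof (intro nn_integral_cong)
    fix z :: real
    show "(\<Sum>i. \<Sum>j. ennreal (pareto_density c z) *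
          (ennreal (negbin_mass r z i) * ennreal (negbin_mass s (z powr a) j) * g (i, j)) * indicator {1<..} z)
      = ennreal (pareto_density c z)
        * (\<integral>\<^sup>+ p. g p \<partial>pair_pmf (negbin r z) (negbin s (z powr a))) * indicator {1<..} z"
      by (cases "1 < z") (simp_all add: nn_integral_pair_negbin ennreal_suminf_cmult)
  qed
  finally show ?thesis .
qed

lemma pmf_yule:
  "pmf (yule_pmf c a r s) (i, j) = (LBINT z:{1<..}. yule_kernel c a r s i j z)"
proof -
  have "(\<Sum>i. \<Sum>j. ennreal (LBINT z:{1<..}. yule_kernel c a r s i j z) * 1) = 1"
    using mixture_as_series[of "\<lambda>_. 1"] nn_integral_pareto_density[of c 1] pos
    by simp
  then have 1: "(\<integral>\<^sup>+ p. ennreal ((\<lambda>(i, j). LBINT z:{1<..}. yule_kernel c a r s i j z) p) \<partial>count_space UNIV) = 1"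
    by (simp add: nn_integral_count_space_nat_prod)
  have 2: "0 \<le> (LBINT z:{1<..}. yule_kernel c a r s i j z)" for i j
    unfolding set_lebesgue_integral_def
  proof (rule Bochner_Integration.integral_nonneg)
    fix z :: real
    show "0 \<le> indicator {1<..} z *\<^sub>R (yule_kernel c a r s i j z)"
    proof (cases "1 < z")
      case True
      then have z: "1 \<le> z" "1 \<le> z powr a" using pos by (auto simp: ge_one_powr_ge_zero)
      then show ?thesis using pos by (simp add: pareto_density_nonneg negbin_mass_nonneg)
    qed simp
  qed
  show ?thesis unfolding yule_pmf_def
    using 2 by (subst pmf_embed_pmf[OF _ 1]) auto
qed

lemma nn_integral_yule:
  "(\<integral>\<^sup>+ p. g p \<partial>yule_pmf c a r s)
   = (\<integral>\<^sup>+ z\<in>{1<..}. ennreal (pareto_density c z)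
        * (\<integral>\<^sup>+ p. g p \<partial>pair_pmf (negbin r z) (negbin s (z powr a))) \<partial>lborel)"
  by (simp add: nn_integral_measure_pmf nn_integral_count_space_nat_prod pmf_yule mixture_as_series)

end


section \<open>Exponential monomials on the compactified quadrant\<close>

text \<open>
  The change of variable that makes \<open>[0, \<infinity>]\<close> the interval \<open>[0, 1]\<close> and Laplace transforms moments.
\<close>

definition expneg :: "ennreal \<Rightarrow> real" where
  "expneg x = (if x = \<top> then 0 else exp (- enn2real x))"

lemma expneg_ennreal: "0 \<le> x \<Longrightarrow> expneg (ennreal x) = exp (- x)"
  by (simp add: expneg_def)

lemma expneg_nonneg: "0 \<le> expneg x" and expneg_le_1: "expneg x \<le> 1"
  by (auto simp: expneg_def)

lemma expneg_inject: "expneg x = expneg y \<longleftrightarrow> x = y"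
  by (cases x; cases y) (auto simp: expneg_def)

lemma continuous_expneg: "continuous_on A expneg"
proof -
  have "isCont expneg x" for x
  proof (cases x)
    case (real r)
    have "\<forall>\<^sub>F y in at x. y < \<top>"
      using real by (intro order_tendstoD(2)[OF tendsto_ident_at]) auto
    then have "\<forall>\<^sub>F y in at x. exp (- enn2real y) = expneg y"
      by eventually_elim (auto simp: expneg_def)
    moreover have "((\<lambda>y. exp (- enn2real y)) \<longlongrightarrow> exp (- r)) (at x)"
      using real by (intro tendsto_intros) (auto intro: tendsto_ident_at)
    ultimately have "(expneg \<longlongrightarrow> exp (- r)) (at x)"
      using tendsto_cong by force
    then show ?thesis using real by (simp add: isCont_def expneg_ennreal)
  next
    case top
    have "(expneg \<longlongrightarrow> 0) (at \<top>)"
    proof (rule order_tendstoI)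
      fix b :: real assume "b < 0"
      then show "\<forall>\<^sub>F y in at \<top>. b < expneg y"
        by (intro always_eventually allI less_le_trans[OF _ expneg_nonneg])
    next
      fix b :: real assume b: "0 < b"
      \<comment> \<open>chosen so that \<open>exp (- K) < b\<close>\<close>
      define K where "K = max 0 (1 - ln b)"
      have "exp (- K) \<le> exp (ln b - 1)" by (simp add: K_def)
      also have "\<dots> < exp (ln b)" by simp
      also have "\<dots> = b" using b by simp
      finally have K: "exp (- K) < b" .
      have "\<forall>\<^sub>F y in at \<top>. ennreal K < y"
        by (intro order_tendstoD(1)[OF tendsto_ident_at]) auto
      then show "\<forall>\<^sub>F y in at \<top>. expneg y < b"
      proof eventually_elim
        case (elim y)
        then show ?case
        proof (cases y)
          case (real s)
          have "0 \<le> K" by (simp add: K_def)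
          then have "K < s" using real elim by (simp add: ennreal_less_iff)
          then show ?thesis using real K by (simp add: expneg_ennreal) (smt (verit) exp_less_cancel_iff)
        qed (use b in \<open>auto simp: expneg_def\<close>)
      qed
    qed
    then show ?thesis using top by (simp add: isCont_def expneg_def)
  qed
  then show ?thesis by (simp add: continuous_at_imp_continuous_on)
qed

abbreviation exp_monom :: "nat \<Rightarrow> nat \<Rightarrow> ennreal \<times> ennreal \<Rightarrow> real" where
  "exp_monom m n \<equiv> \<lambda>p. expneg (fst p) ^ m * expneg (snd p) ^ n"

text \<open>
  The polynomials in \<open>exp (- x)\<close> and \<open>exp (- y)\<close>, generated as linear combinations of monomials so that
  statements about linear functionals need to be checked on monomials only.
\<close>

inductive_set exp_polys :: "(ennreal \<times> ennreal \<Rightarrow> real) set" where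
  monom: "exp_monom m n \<in> exp_polys"
| scale: "f \<in> exp_polys \<Longrightarrow> (\<lambda>p. c * f p) \<in> exp_polys"
| add: "f \<in> exp_polys \<Longrightarrow> g \<in> exp_polys \<Longrightarrow> (\<lambda>p. f p + g p) \<in> exp_polys"

lemma exp_polys_mult_monom:
  "f \<in> exp_polys \<Longrightarrow> (\<lambda>p. exp_monom m n p * f p) \<in> exp_polys"
proof (induction rule: exp_polys.induct)
  case (monom m' n')
  have "(\<lambda>p. exp_monom m n p * exp_monom m' n' p) = exp_monom (m + m') (n + n')"
    by (simp add: fun_eq_iff power_add)
  then show ?case by (simp only: exp_polys.monom)
next
  case (scale f c)
  have "(\<lambda>p. exp_monom m n p * (c * f p)) = (\<lambda>p. c * (exp_monom m n p * f p))"
    by (rule ext) (rule mult.left_commute)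
  then show ?case by (simp only: exp_polys.scale[OF scale.IH])
next
  case (add f g)
  show ?case unfolding distrib_left using exp_polys.add[OF add.IH] .
qed

lemma exp_polys_mult:
  "f \<in> exp_polys \<Longrightarrow> g \<in> exp_polys \<Longrightarrow> (\<lambda>p. f p * g p) \<in> exp_polys"
proof (induction rule: exp_polys.induct)
  case (monom m n)
  then show ?case by (rule exp_polys_mult_monom)
next
  case (scale f c)
  then show ?case unfolding mult.assoc using exp_polys.scale[OF scale.IH] by simp
next
  case (add f f')
  then show ?case unfolding distrib_right using exp_polys.add[OF add.IH] by simp
qed

lemma exp_polys_continuous: "f \<in> exp_polys \<Longrightarrow> continuous_on UNIV f"
proof (induction rule: exp_polys.induct)
  case (monom m n)
  show ?case
    by (intro continuous_intros continuous_on_compose2[OF continuous_expneg]) auto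
qed (auto intro!: continuous_intros)

lemma compact_UNIV_ennreal_prod: "compact (UNIV :: (ennreal \<times> ennreal) set)"
  using compact_Times[OF compact_UNIV compact_UNIV] by simp

text \<open>
  Stone-Weierstrass on the compact space \<open>[0, \<infinity>]\<^sup>2\<close>: the exponential is injective on \<open>[0, \<infinity>]\<close>, so the
  polynomials separate points.
\<close>

lemma exp_polys_dense:
  fixes f :: "ennreal \<times> ennreal \<Rightarrow> real"
  assumes "continuous_on UNIV f" "0 < e"
  obtains g where "g \<in> exp_polys" "\<And>p. \<bar>f p - g p\<bar> < e"
proof -
  have "\<exists>g. g \<in> exp_polys \<and> (\<forall>p\<in>UNIV. \<bar>f p - g p\<bar> < e)"
  proof (rule Stone_Weierstrass_HOL[where P = "\<lambda>g. g \<in> exp_polys" and S = UNIV and f = f])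
    show "(\<lambda>_. c) \<in> exp_polys" for c
      using exp_polys.scale[OF exp_polys.monom[of 0 0], of c] by simp
    fix x y :: "ennreal \<times> ennreal" assume xy: "x \<in> UNIV \<and> y \<in> UNIV \<and> x \<noteq> y"
    show "\<exists>f. f \<in> exp_polys \<and> f x \<noteq> f y"
    proof (cases "fst x = fst y")
      case True
      then have "snd x \<noteq> snd y" using xy by (simp add: prod_eq_iff)
      then show ?thesis
        by (intro exI[of _ "exp_monom 0 1"] conjI exp_polys.monom) (simp add: expneg_inject)
    next
      case False
      then show ?thesis
        by (intro exI[of _ "exp_monom 1 0"] conjI exp_polys.monom) (simp add: expneg_inject)
    qed
  next
    show "(\<lambda>x. f x + g x) \<in> exp_polys" "(\<lambda>x. f x * g x) \<in> exp_polys"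
      if "f \<in> exp_polys \<and> g \<in> exp_polys" for f g
      using that exp_polys.add[of f g] exp_polys_mult[of f g] by blast+
  qed (use assms compact_UNIV_ennreal_prod exp_polys_continuous in blast)+
  then show ?thesis using that by auto
qed

lemma integrable_continuous_ennreal_prod:
  fixes f :: "ennreal \<times> ennreal \<Rightarrow> real"
  assumes "prob_space M" "sets M = sets borel" "continuous_on UNIV f"
  shows "integrable M f"
proof -
  interpret prob_space M by fact
  have "compact (f ` UNIV)" by (intro compact_continuous_image assms compact_UNIV_ennreal_prod)
  then have "bounded (range f)" by (rule compact_imp_bounded)
  then obtain B where "\<And>x. \<bar>f x\<bar> \<le> B" by (auto simp: bounded_real)
  moreover have "f \<in> borel_measurable M"
    using borel_measurable_continuous_onI[OF assms(3)] assms(2) by (simp cong: measurable_cong_sets)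
  ultimately show ?thesis by (intro integrable_const_bound[of _ B]) auto
qed

lemma nn_integral_continuous_ennreal_prod:
  fixes f :: "ennreal \<times> ennreal \<Rightarrow> real"
  assumes "prob_space M" "sets M = sets borel" "continuous_on UNIV f" "\<And>p. 0 \<le> f p"
  shows "(\<integral>\<^sup>+ p. ennreal (f p) \<partial>M) = ennreal (LINT p|M. f p)"
  using assms by (intro nn_integral_eq_integral integrable_continuous_ennreal_prod) auto

text \<open>
  A continuity theorem for Laplace transforms.  On the compact space \<open>[0, \<infinity>]\<^sup>2\<close> tightness is automatic,
  and by density of \<open>exp_polys\<close> integer arguments of the transform suffice.
\<close>

proposition weak_convergence_by_exp_monoms:
  fixes P :: "'i \<Rightarrow> (ennreal \<times> ennreal) measure" and f :: "ennreal \<times> ennreal \<Rightarrow> real"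
  assumes P: "\<And>i. prob_space (P i)" "\<And>i. sets (P i) = sets borel"
    and Q: "prob_space Q" "sets Q = sets borel"
    and lim: "\<And>m n. ((\<lambda>i. \<integral>\<^sup>+ p. ennreal (exp_monom m n p) \<partial>P i) \<longlongrightarrow> (\<integral>\<^sup>+ p. ennreal (exp_monom m n p) \<partial>Q)) F"
    and f: "continuous_on UNIV f" "\<And>p. 0 \<le> f p"
  shows "((\<lambda>i. \<integral>\<^sup>+ p. ennreal (f p) \<partial>P i) \<longlongrightarrow> (\<integral>\<^sup>+ p. ennreal (f p) \<partial>Q)) F"
proof -
  have poly: "((\<lambda>i. LINT p|P i. g p) \<longlongrightarrow> (LINT p|Q. g p)) F" if "g \<in> exp_polys" for g
    using that
  proof (induction rule: exp_polys.induct)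
    case (monom m n)
    have c: "continuous_on UNIV (exp_monom m n)" by (intro exp_polys_continuous exp_polys.monom)
    have nn: "0 \<le> exp_monom m n p" for p by (simp add: expneg_nonneg)
    show ?case using lim[of m n]
      unfolding nn_integral_continuous_ennreal_prod[OF P c nn] nn_integral_continuous_ennreal_prod[OF Q c nn]
      by (rule tendsto_ennrealD) (simp_all add: expneg_nonneg)
  next
    case (scale g c)
    then show ?case by (auto intro!: tendsto_intros)
  next
    case (add g h)
    have "(LINT p|M. g p + h p) = (LINT p|M. g p) + (LINT p|M. h p)"
      if "prob_space M" "sets M = sets borel" for M
      using that add.hyps
      by (intro Bochner_Integration.integral_add integrable_continuous_ennreal_prod exp_polys_continuous)
    then show ?case using P Q add.IH by (auto intro!: tendsto_intros)
  qed
  have "((\<lambda>i. LINT p|P i. f p) \<longlongrightarrow> (LINT p|Q. f p)) F"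
  proof (rule tendstoI)
    fix e :: real assume e: "0 < e"
    then obtain g where g: "g \<in> exp_polys" "\<And>p. \<bar>f p - g p\<bar> < e / 3"
      using exp_polys_dense[OF f(1), of "e / 3"] by auto
    have close: "\<bar>(LINT p|M. f p) - (LINT p|M. g p)\<bar> \<le> e / 3"
      if M: "prob_space M" "sets M = sets borel" for M
    proof -
      interpret prob_space M by fact
      have int: "integrable M f" "integrable M g"
        using M f g exp_polys_continuous by (auto intro: integrable_continuous_ennreal_prod)
      have "\<bar>(LINT p|M. f p) - (LINT p|M. g p)\<bar> = \<bar>LINT p|M. f p - g p\<bar>"
        using int by simp
      also have "\<dots> \<le> (LINT p|M. \<bar>f p - g p\<bar>)" by (rule integral_abs_bound)
      also have "\<dots> \<le> (LINT p|M. e / 3)"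
        using int g(2) by (intro integral_mono) (auto intro: less_imp_le)
      finally show ?thesis by (simp add: prob_space)
    qed
    have "\<forall>\<^sub>F i in F. dist (LINT p|P i. g p) (LINT p|Q. g p) < e / 3"
      using e by (intro tendstoD[OF poly[OF g(1)]]) simp
    then show "\<forall>\<^sub>F i in F. dist (LINT p|P i. f p) (LINT p|Q. f p) < e"
    proof eventually_elim
      case (elim i)
      then show ?case using close[OF P, of i] close[OF Q] unfolding dist_real_def by linarith
    qed
  qed
  then show ?thesis
    unfolding nn_integral_continuous_ennreal_prod[OF P f] nn_integral_continuous_ennreal_prod[OF Q f]
    by (rule tendsto_ennrealI)
qed

text \<open>
  The uniqueness theorem is the continuity theorem for a constant net.
\<close>

corollary nn_integral_eq_by_exp_monoms:
  fixes f :: "ennreal \<times> ennreal \<Rightarrow> real"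
  assumes P: "prob_space P" "sets P = sets borel"
    and Q: "prob_space Q" "sets Q = sets borel"
    and eq: "\<And>m n. (\<integral>\<^sup>+ p. ennreal (exp_monom m n p) \<partial>P) = (\<integral>\<^sup>+ p. ennreal (exp_monom m n p) \<partial>Q)"
    and f: "continuous_on UNIV f" "\<And>p. 0 \<le> f p"
  shows "(\<integral>\<^sup>+ p. ennreal (f p) \<partial>P) = (\<integral>\<^sup>+ p. ennreal (f p) \<partial>Q)"
proof -
  have "((\<lambda>_. \<integral>\<^sup>+ p. ennreal (f p) \<partial>P) \<longlongrightarrow> (\<integral>\<^sup>+ p. ennreal (f p) \<partial>Q)) (at_top :: nat filter)"
    by (rule weak_convergence_by_exp_monoms[OF P Q _ f]) (simp add: eq)
  then show ?thesis by (simp add: tendsto_const_iff)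
qed


section \<open>Gamma laws and the limit measure\<close>

definition gamma_density :: "real \<Rightarrow> real \<Rightarrow> real \<Rightarrow> real" where
  "gamma_density r w x = x powr (r - 1) * w powr (- r) * exp (- x / w) / Gamma r"

lemma measurable_gamma_density[measurable (raw)]:
  assumes [measurable]: "f \<in> borel_measurable M" "g \<in> borel_measurable M"
  shows "(\<lambda>x. gamma_density r (f x) (g x)) \<in> borel_measurable M"
  unfolding gamma_density_def by measurable

lemma gamma_density_nonneg: "0 < r \<Longrightarrow> 0 \<le> gamma_density r w x"
  by (simp add: gamma_density_def)

lemma gamma_integral_scaled:
  assumes "0 < r" "0 < b"
  shows "(\<integral>\<^sup>+ x\<in>{0<..}. ennreal (x powr (r - 1) * exp (- b * x)) \<partial>lborel) = ennreal (Gamma r * b powr (- r))"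
proof -
  have "(\<integral>\<^sup>+ x\<in>{0<..}. ennreal (x powr (r - 1) * exp (- b * x)) \<partial>lborel)
    = ennreal (1 / b) * (\<integral>\<^sup>+ t. ennreal ((t / b) powr (r - 1) * exp (- t)) * indicator {0<..} t \<partial>lborel)"
    using assms
    by (subst nn_integral_real_affine[where c = "1 / b" and t = 0])
       (auto intro!: arg_cong2[where f = "(*)"] nn_integral_cong split: split_indicator simp: zero_less_divide_iff)
  also have "\<dots> = ennreal (1 / b) * (\<integral>\<^sup>+ t. ennreal (b powr (1 - r)) * ennreal (indicator {0..} t * t powr (r - 1) / exp t) \<partial>lborel)"
  proof (rule arg_cong2[where f = "(*)", OF refl], rule nn_integral_cong_AE,
      rule AE_mp[OF AE_lborel_singleton[of 0]], rule AE_I2, rule impI)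
    fix t :: real assume "t \<noteq> 0"
    have b: "b powr (1 - r) = inverse (b powr (r - 1))" by (metis minus_diff_eq powr_minus)
    have "(t / b) powr (r - 1) = b powr (1 - r) * t powr (r - 1)" if "0 < t"
    proof -
      have "(t / b) powr (r - 1) = t powr (r - 1) / b powr (r - 1)"
        using that assms by (simp add: powr_divide)
      then show ?thesis unfolding b by (simp add: divide_inverse)
    qed
    then show "ennreal ((t / b) powr (r - 1) * exp (- t)) * indicator {0<..} t =
       ennreal (b powr (1 - r)) * ennreal (indicator {0..} t * t powr (r - 1) / exp t)"
      using \<open>t \<noteq> 0\<close> assms
      by (auto split: split_indicator simp: exp_minus field_simps simp flip: ennreal_mult)
  qed
  also have "\<dots> = ennreal (1 / b) * (ennreal (b powr (1 - r)) * ennreal (Gamma r))"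
    using assms by (simp add: nn_integral_cmult Gamma_conv_nn_integral_real)
  also have "\<dots> = ennreal (Gamma r * b powr (- r))"
  proof -
    have "1 / b * b powr (1 - r) = b powr (- r)" using assms
      by (simp add: powr_diff powr_minus divide_simps)
    then show ?thesis using assms by (simp add: ac_simps flip: ennreal_mult mult.assoc)
  qed
  finally show ?thesis .
qed

text \<open>
  These transforms are the limits of the negative binomial generating functions.
\<close>

lemma gamma_density_laplace:
  assumes "0 < r" "0 < w" "0 \<le> m"
  shows "(\<integral>\<^sup>+ x\<in>{0<..}. ennreal (gamma_density r w x) * ennreal (exp (- m * x)) \<partial>lborel) = ennreal ((1 + m * w) powr (- r))"
proof -
  have b: "0 < 1 / w + m" using assms by (simp add: add_pos_nonneg)
  have G: "0 < Gamma r" using assms by simp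
  have "(\<integral>\<^sup>+ x\<in>{0<..}. ennreal (gamma_density r w x) * ennreal (exp (- m * x)) \<partial>lborel)
    = (\<integral>\<^sup>+ x. ennreal (w powr (- r) / Gamma r) * (ennreal (x powr (r - 1) * exp (- (1 / w + m) * x)) * indicator {0<..} x) \<partial>lborel)"
    using G by (intro nn_integral_cong)
      (auto simp: gamma_density_def algebra_simps exp_add[symmetric] simp flip: ennreal_mult split: split_indicator)
  also have "\<dots> = ennreal (w powr (- r) / Gamma r) * ennreal (Gamma r * (1 / w + m) powr (- r))"
    using gamma_integral_scaled[OF assms(1) b] by (simp add: nn_integral_cmult)
  also have "\<dots> = ennreal (w powr (- r) * (1 / w + m) powr (- r))"
    using G by (simp flip: ennreal_mult)
  also have "w powr (- r) * (1 / w + m) powr (- r) = (w * (1 / w + m)) powr (- r)"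
    using assms b by (simp add: powr_mult)
  also have "w * (1 / w + m) = 1 + m * w" using assms by (simp add: field_simps)
  finally show ?thesis .
qed

definition quadrant_embedding :: "real \<times> real \<Rightarrow> ennreal \<times> ennreal" where
  "quadrant_embedding p = (ennreal (fst p), ennreal (snd p))"

lemma measurable_quadrant_embedding[measurable]: "quadrant_embedding \<in> borel \<rightarrow>\<^sub>M borel"
  unfolding quadrant_embedding_def borel_prod[symmetric] by measurable

text \<open>
  Independent gamma variables with shapes \<open>r\<close>, \<open>s\<close> and scales \<open>w\<close>, \<open>v\<close>, viewed in \<open>[0, \<infinity>]\<^sup>2\<close>.
\<close>

definition gamma_pair :: "real \<Rightarrow> real \<Rightarrow> real \<Rightarrow> real \<Rightarrow> (ennreal \<times> ennreal) measure" where
  "gamma_pair r s w v = distr (density lborel (\<lambda>p. ennreal (gamma_density r w (fst p)) * ennreal (gamma_density s v (snd p))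
       * indicator ({0<..} \<times> {0<..}) p)) borel quadrant_embedding"

lemma measurable_gamma_pair_density:
  "(\<lambda>p. ennreal (gamma_density r w (fst p)) * ennreal (gamma_density s v (snd p))
       * indicator ({0<..} \<times> {0<..}) p) \<in> borel_measurable borel"
  unfolding borel_prod[symmetric] by measurable

lemma sets_gamma_pair[simp]: "sets (gamma_pair r s w v) = sets borel"
  by (simp add: gamma_pair_def)

lemma nn_integral_gamma_pair:
  assumes [measurable]: "g \<in> borel_measurable borel"
  shows "(\<integral>\<^sup>+ p. g p \<partial>gamma_pair r s w v) =
    (\<integral>\<^sup>+ p\<in>{0<..} \<times> {0<..}. ennreal (gamma_density r w (fst p)) * ennreal (gamma_density s v (snd p)) * g (quadrant_embedding p) \<partial>lborel)"
proof -
  note measurable_gamma_pair_density[measurable]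
  have "(\<integral>\<^sup>+ p. g p \<partial>gamma_pair r s w v) = (\<integral>\<^sup>+ p. ennreal (gamma_density r w (fst p)) * ennreal (gamma_density s v (snd p))
       * indicator ({0<..} \<times> {0<..}) p * g (quadrant_embedding p) \<partial>lborel)"
    unfolding gamma_pair_def
    by (subst nn_integral_distr, simp, simp, subst nn_integral_density) (simp_all add: measurable_gamma_pair_density)
  then show ?thesis by (simp add: ac_simps)
qed

lemma nn_integral_gamma_pair_exp_monom:
  assumes "0 < r" "0 < s" "0 < w" "0 < v"
  shows "(\<integral>\<^sup>+ p. ennreal (exp_monom m n p) \<partial>gamma_pair r s w v)
    = ennreal ((1 + real m * w) powr (- r)) * ennreal ((1 + real n * v) powr (- s))"
proof -
  have [measurable]: "exp_monom m n \<in> borel_measurable borel"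
    by (rule borel_measurable_continuous_onI[OF exp_polys_continuous[OF exp_polys.monom]])
  have "(\<integral>\<^sup>+ p. ennreal (exp_monom m n p) \<partial>gamma_pair r s w v)
   = (\<integral>\<^sup>+ p\<in>{0<..} \<times> {0<..}. ennreal (gamma_density r w (fst p)) * ennreal (gamma_density s v (snd p)) * ennreal (exp_monom m n (quadrant_embedding p)) \<partial>lborel)"
    by (rule nn_integral_gamma_pair) measurable
  also have "\<dots> = (\<integral>\<^sup>+ p. (ennreal (gamma_density r w (fst p)) * ennreal (exp (- real m * fst p)) * indicator {0<..} (fst p)) *
      (ennreal (gamma_density s v (snd p)) * ennreal (exp (- real n * snd p)) * indicator {0<..} (snd p)) \<partial>lborel)"
  proof (intro nn_integral_cong)
    fix p :: "real \<times> real"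
    show "ennreal (gamma_density r w (fst p)) * ennreal (gamma_density s v (snd p)) * ennreal (exp_monom m n (quadrant_embedding p)) * indicator ({0<..} \<times> {0<..}) p
     = (ennreal (gamma_density r w (fst p)) * ennreal (exp (- real m * fst p)) * indicator {0<..} (fst p)) *
      (ennreal (gamma_density s v (snd p)) * ennreal (exp (- real n * snd p)) * indicator {0<..} (snd p))"
      by (cases p) (auto simp: quadrant_embedding_def expneg_ennreal exp_of_nat_mult[symmetric] ennreal_mult mult_ac split: split_indicator)
  qed
  also have "\<dots> = (\<integral>\<^sup>+ x. \<integral>\<^sup>+ y. (ennreal (gamma_density r w x) * ennreal (exp (- real m * x)) * indicator {0<..} x) *
      (ennreal (gamma_density s v y) * ennreal (exp (- real n * y)) * indicator {0<..} y) \<partial>lborel \<partial>lborel)"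
    unfolding lborel_prod[symmetric]
    by (subst lborel.nn_integral_fst[symmetric]) simp_all
  also have "\<dots> = ennreal ((1 + real m * w) powr (- r)) * ennreal ((1 + real n * v) powr (- s))"
    using assms gamma_density_laplace[of r w "real m"] gamma_density_laplace[of s v "real n"]
    by (simp add: nn_integral_cmult nn_integral_multc)
  finally show ?thesis .
qed

lemma prob_space_gamma_pair:
  assumes "0 < r" "0 < s" "0 < w" "0 < v"
  shows "prob_space (gamma_pair r s w v)"
proof (rule prob_spaceI)
  have "space (gamma_pair r s w v) = UNIV" using sets_eq_imp_space_eq[OF sets_gamma_pair] by simp
  then have "emeasure (gamma_pair r s w v) (space (gamma_pair r s w v)) = (\<integral>\<^sup>+ p. ennreal (exp_monom 0 0 p) \<partial>gamma_pair r s w v)"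
    by (simp add: nn_integral_const)
  then show "emeasure (gamma_pair r s w v) (space (gamma_pair r s w v)) = 1"
    using nn_integral_gamma_pair_exp_monom[OF assms, of 0 0] by simp
qed

text \<open>
  At infinity the power is integrable because \<open>k > 1\<close>; near 0 the exponential beats any power.  The
  same estimate gives finiteness of the limit density and of the dominating function of the main limit.
\<close>

lemma nn_integral_powr_exp_finite:
  assumes "1 < k" "0 < a" "0 < b"
  shows "(\<integral>\<^sup>+ z\<in>{0<..}. ennreal (z powr (- k) * exp (- (b / z powr a))) \<partial>lborel) < \<infinity>"
proof -
  \<comment> \<open>the power \<open>(z\<^bsup>a\<^esup>)\<^bsup>N\<^esup>\<close> must absorb \<open>z\<^bsup>-k\<^esup>\<close>\<close>
  define N :: nat where "N = nat \<lceil>k / a\<rceil>"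
  have N: "k \<le> a * real N" "0 < N"
  proof -
    have "k / a \<le> real N" unfolding N_def using assms by (meson real_nat_ceiling_ge)
    then show "k \<le> a * real N" using assms by (simp add: field_simps)
    then show "0 < N" using assms by (cases "N = 0") auto
  qed
  define C where "C = (real N / b) ^ N"
  \<comment> \<open>the index for which \<open>z\<^bsup>-k\<^esup>\<close> is a multiple of a Pareto density\<close>
  define c where "c = 1 / (k - 1)"
  have c: "0 < c" "1 + 1 / c = k" using assms by (auto simp: c_def)
  have near_0: "z powr (- k) * exp (- (b / z powr a)) \<le> C" if z: "0 < z" "z \<le> 1" for z
  proof -
    define t where "t = b / z powr a"
    have t: "0 < t" using assms z by (simp add: t_def)
    have "(t / real N) ^ N \<le> (1 + t / real N) ^ N" using t by (intro power_mono) auto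
    also have "\<dots> \<le> exp t" using t N by (intro exp_ge_one_plus_x_over_n_power_n) auto
    finally have "exp (- t) \<le> (real N / t) ^ N"
      using t N by (simp add: exp_minus field_simps)
    also have "(real N / t) ^ N = C * z powr (a * real N)"
      using z by (simp add: t_def C_def power_divide power_mult_distrib powr_powr[symmetric] powr_realpow)
    finally have "z powr (- k) * exp (- t) \<le> z powr (- k) * (C * z powr (a * real N))"
      by (intro mult_left_mono) auto
    also have "\<dots> = C * z powr (a * real N - k)" using z by (simp add: powr_diff powr_minus field_simps)
    also have "\<dots> \<le> C * 1" using z N assms by (intro mult_left_mono powr_le1) (auto simp: C_def)
    finally show ?thesis by (simp add: t_def)
  qed
  have "(\<integral>\<^sup>+ z\<in>{0<..}. ennreal (z powr (- k) * exp (- (b / z powr a))) \<partial>lborel)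
    \<le> (\<integral>\<^sup>+ z. ennreal C * indicator {0..1} z + ennreal c * (ennreal (pareto_density c z) * indicator {1<..} z) \<partial>lborel)"
  proof (intro nn_integral_mono)
    fix z :: real
    have "ennreal (z powr (- k) * exp (- (b / z powr a))) \<le> ennreal c * ennreal (pareto_density c z)" if "1 < z"
    proof -
      have "z powr (- k) * exp (- (b / z powr a)) \<le> z powr (- k) * 1" using assms that by (intro mult_left_mono) auto
      also have "\<dots> = c * pareto_density c z" using c by (simp add: pareto_density_def)
      finally show ?thesis using c by (simp add: pareto_density_nonneg flip: ennreal_mult)
    qed
    then show "ennreal (z powr (- k) * exp (- (b / z powr a))) * indicator {0<..} z
      \<le> ennreal C * indicator {0..1} z + ennreal c * (ennreal (pareto_density c z) * indicator {1<..} z)"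
      using near_0[of z] by (auto split: split_indicator intro: ennreal_leI)
  qed
  also have "\<dots> = ennreal C + ennreal c"
    using c nn_integral_pareto_density[of c 1]
    by (simp add: nn_integral_add nn_integral_cmult)
  also have "\<dots> < \<infinity>" by simp
  finally show ?thesis .
qed

text \<open>
  The two densities of the theorem are the cases \<open>(r, s) = (\<delta>\<^sub>i\<^sub>n + 1, \<delta>\<^sub>o\<^sub>u\<^sub>t)\<close> and
  \<open>(\<delta>\<^sub>i\<^sub>n, \<delta>\<^sub>o\<^sub>u\<^sub>t + 1)\<close>.
\<close>

definition limit_density :: "real \<Rightarrow> real \<Rightarrow> real \<Rightarrow> real \<Rightarrow> real \<Rightarrow> real \<Rightarrow> real" where
  "limit_density c a r s x y =
     inverse c * inverse (Gamma r * Gamma s) * x powr (r - 1) * y powr (s - 1)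
       * (LBINT z:{0<..}. z powr (- (1 + 1 / c + r + a * s)) * exp (- (x / z + y / z powr a)))"

text \<open>
  The powers of \<open>z\<close> in the density are those of the Pareto density, \<open>z\<^bsup>-1-1/c\<^esup>\<close>, and of the two scale
  factors, \<open>z\<^bsup>-r\<^esup>\<close> and \<open>(z\<^bsup>a\<^esup>)\<^bsup>-s\<^esup>\<close>.  Finiteness of the integral has to be shown as well, because the
  Bochner integral of a function that is not integrable is 0.
\<close>

lemma limit_density_eq_mixture:
  assumes "0 < c" "0 < a" "0 < r" "0 < s" "0 < x" "0 < y"
  shows "ennreal (limit_density c a r s x y) = (\<integral>\<^sup>+ w\<in>{0<..}. ennreal (pareto_density c w)
      * (ennreal (gamma_density r w x) * ennreal (gamma_density s (w powr a) y)) \<partial>lborel)"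
proof -
  define k where "k = 1 + 1 / c + r + a * s"
  define C where "C = inverse c * inverse (Gamma r * Gamma s) * x powr (r - 1) * y powr (s - 1)"
  have C: "0 \<le> C" using assms by (simp add: C_def)
  have k: "1 < k" unfolding k_def using assms by (simp add: add_pos_pos)
  have eq: "ennreal (pareto_density c w) * (ennreal (gamma_density r w x) * ennreal (gamma_density s (w powr a) y))
     = ennreal C * ennreal (w powr (- k) * exp (- (x / w + y / w powr a)))" if "0 < w" for w
  proof -
    have "w powr (- k) = w powr (- (1 + 1 / c)) * w powr (- r) * (w powr a) powr (- s)"
      by (simp add: k_def powr_powr powr_add[symmetric])
    then have "pareto_density c w * (gamma_density r w x * gamma_density s (w powr a) y)
      = C * (w powr (- k) * exp (- (x / w + y / w powr a)))"
      by (simp add: pareto_density_def gamma_density_def C_def exp_add[symmetric] divide_inverse mult_ac)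
    then show ?thesis using assms C
      by (simp add: pareto_density_nonneg gamma_density_nonneg flip: ennreal_mult)
  qed
  have fin: "(\<integral>\<^sup>+ w. ennreal (indicator {0<..} w *\<^sub>R (w powr (- k) * exp (- (x / w + y / w powr a)))) \<partial>lborel) < \<infinity>"
  proof -
    have "(\<integral>\<^sup>+ w. ennreal (indicator {0<..} w *\<^sub>R (w powr (- k) * exp (- (x / w + y / w powr a)))) \<partial>lborel)
      \<le> (\<integral>\<^sup>+ z\<in>{0<..}. ennreal (z powr (- k) * exp (- (x / z powr 1))) \<partial>lborel)"
      using assms by (intro nn_integral_mono) (auto split: split_indicator intro!: ennreal_leI)
    also have "\<dots> < \<infinity>" using k assms by (intro nn_integral_powr_exp_finite) auto
    finally show ?thesis .
  qed
  have "(\<integral>\<^sup>+ w\<in>{0<..}. ennreal (pareto_density c w)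
      * (ennreal (gamma_density r w x) * ennreal (gamma_density s (w powr a) y)) \<partial>lborel)
    = (\<integral>\<^sup>+ w. ennreal C * ennreal (indicator {0<..} w *\<^sub>R (w powr (- k) * exp (- (x / w + y / w powr a)))) \<partial>lborel)"
    using eq by (intro nn_integral_cong) (auto split: split_indicator)
  also have "\<dots> = ennreal C * (\<integral>\<^sup>+ w. ennreal (indicator {0<..} w *\<^sub>R (w powr (- k) * exp (- (x / w + y / w powr a)))) \<partial>lborel)"
    by (rule nn_integral_cmult) simp
  also have "(\<integral>\<^sup>+ w. ennreal (indicator {0<..} w *\<^sub>R (w powr (- k) * exp (- (x / w + y / w powr a)))) \<partial>lborel)
    = ennreal (LBINT z:{0<..}. z powr (- k) * exp (- (x / z + y / z powr a)))"
    unfolding set_lebesgue_integral_def using fin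
    by (intro nn_integral_eq_integral integrableI_nonneg) auto
  also have "ennreal C * \<dots> = ennreal (limit_density c a r s x y)"
    unfolding limit_density_def C_def[symmetric] k_def[symmetric] using C
    by (simp add: ennreal_mult')
  finally show ?thesis ..
qed

definition limit_measure :: "real \<Rightarrow> real \<Rightarrow> real \<Rightarrow> real \<Rightarrow> (ennreal \<times> ennreal) measure" where
  "limit_measure c a r s = restrict_space (distr (density lborel
      (\<lambda>p. ennreal (limit_density c a r s (fst p) (snd p)) * indicator ({0<..} \<times> {0<..}) p))
      borel quadrant_embedding) punctured_quadrant"

lemma measurable_limit_density:
  "(\<lambda>p. ennreal (limit_density c a r s (fst p) (snd p)) * indicator ({0<..} \<times> {0<..}) p) \<in> borel_measurable borel"
  unfolding limit_density_def set_lebesgue_integral_def borel_prod[symmetric] by measurable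

lemma open_punctured_quadrant: "open punctured_quadrant"
  unfolding punctured_quadrant_def by (simp add: open_Diff)

lemma punctured_quadrant_borel[measurable]: "punctured_quadrant \<in> sets borel"
  using open_punctured_quadrant by (rule borel_open)

lemma quadrant_embedding_in_punctured: "0 < fst p \<Longrightarrow> quadrant_embedding p \<in> punctured_quadrant"
  by (simp add: quadrant_embedding_def punctured_quadrant_def)

lemma nn_integral_limit_measure_density:
  assumes [measurable]: "g \<in> borel_measurable borel"
  shows "(\<integral>\<^sup>+ p. g p \<partial>limit_measure c a r s)
    = (\<integral>\<^sup>+ p\<in>{0<..} \<times> {0<..}. ennreal (limit_density c a r s (fst p) (snd p)) * g (quadrant_embedding p) \<partial>lborel)"
proof -
  note measurable_limit_density[measurable]
  have "(\<integral>\<^sup>+ p. g p \<partial>limit_measure c a r s) =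
    (\<integral>\<^sup>+ p. ennreal (limit_density c a r s (fst p) (snd p)) * indicator ({0<..} \<times> {0<..}) p
      * (g (quadrant_embedding p) * indicator punctured_quadrant (quadrant_embedding p)) \<partial>lborel)"
    unfolding limit_measure_def
    by (subst nn_integral_restrict_space, simp, subst nn_integral_distr, simp, simp, subst nn_integral_density)
       (simp_all add: measurable_limit_density)
  also have "\<dots> = (\<integral>\<^sup>+ p\<in>{0<..} \<times> {0<..}. ennreal (limit_density c a r s (fst p) (snd p)) * g (quadrant_embedding p) \<partial>lborel)"
    using quadrant_embedding_in_punctured
    by (intro nn_integral_cong) (auto split: split_indicator)
  finally show ?thesis .
qed

text \<open>
  Disintegration along the scale \<open>w\<close>; this is the form in which the measure arises as a limit.
\<close>

lemma nn_integral_limit_measure: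
  assumes "0 < c" "0 < a" "0 < r" "0 < s" and [measurable]: "g \<in> borel_measurable borel"
  shows "(\<integral>\<^sup>+ p. g p \<partial>limit_measure c a r s) = (\<integral>\<^sup>+ w\<in>{0<..}. ennreal (pareto_density c w)
      * (\<integral>\<^sup>+ p. g p \<partial>gamma_pair r s w (w powr a)) \<partial>lborel)"
proof -
  let ?K = "\<lambda>p w. ennreal (gamma_density r w (fst p)) * ennreal (gamma_density s (w powr a) (snd p))"
  have [measurable]: "quadrant_embedding \<in> borel_measurable (lborel \<Otimes>\<^sub>M lborel)"
    unfolding lborel_prod by measurable
  have "(\<integral>\<^sup>+ p. g p \<partial>limit_measure c a r s)
    = (\<integral>\<^sup>+ p. (\<integral>\<^sup>+ w. ennreal (pareto_density c w) * indicator {0<..} w * 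
        (?K p w * g (quadrant_embedding p) * indicator ({0<..} \<times> {0<..}) p) \<partial>lborel) \<partial>lborel)"
    unfolding nn_integral_limit_measure_density[OF assms(5)]
  proof (intro nn_integral_cong)
    fix p :: "real \<times> real"
    show "ennreal (limit_density c a r s (fst p) (snd p)) * g (quadrant_embedding p) * indicator ({0<..} \<times> {0<..}) p
      = (\<integral>\<^sup>+ w. ennreal (pareto_density c w) * indicator {0<..} w * 
        (?K p w * g (quadrant_embedding p) * indicator ({0<..} \<times> {0<..}) p) \<partial>lborel)"
    proof (cases "p \<in> {0<..} \<times> {0<..}")
      case True
      then have p: "0 < fst p" "0 < snd p" by auto
      show ?thesis
        unfolding limit_density_eq_mixture[OF assms(1-4) p]
        using True by (subst nn_integral_multc[symmetric]) (auto intro!: nn_integral_cong simp: ac_simps)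
    qed simp
  qed
  also have "\<dots> = (\<integral>\<^sup>+ w. (\<integral>\<^sup>+ p. ennreal (pareto_density c w) * indicator {0<..} w * 
        (?K p w * g (quadrant_embedding p) * indicator ({0<..} \<times> {0<..}) p) \<partial>lborel) \<partial>lborel)"
    unfolding lborel_prod[symmetric]
    by (rule pair_sigma_finite.Fubini') (simp_all add: pair_sigma_finite.intro lborel_pair.sigma_finite_measure_axioms lborel.sigma_finite_measure_axioms split_beta)
  also have "\<dots> = (\<integral>\<^sup>+ w\<in>{0<..}. ennreal (pareto_density c w)
      * (\<integral>\<^sup>+ p. g p \<partial>gamma_pair r s w (w powr a)) \<partial>lborel)"
  proof (intro nn_integral_cong)
    fix w :: real
    have "(\<lambda>p. ?K p w * g (quadrant_embedding p) * indicator ({0<..} \<times> {0<..}) p) \<in> borel_measurable lborel"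
      unfolding lborel_prod[symmetric] by measurable
    then show "(\<integral>\<^sup>+ p. ennreal (pareto_density c w) * indicator {0<..} w * 
        (?K p w * g (quadrant_embedding p) * indicator ({0<..} \<times> {0<..}) p) \<partial>lborel)
       = ennreal (pareto_density c w) * (\<integral>\<^sup>+ p. g p \<partial>gamma_pair r s w (w powr a)) * indicator {0<..} w"
      unfolding nn_integral_gamma_pair[OF assms(5)]
      by (subst nn_integral_cmult) (simp_all add: ac_simps)
  qed
  finally show ?thesis .
qed

lemma has_quadrant_density_limit_measure:
  "has_quadrant_density (limit_measure c a r s) (limit_density c a r s)"
proof -
  let ?V = "limit_measure c a r s"
  have sets: "sets ?V = sets (restrict_space borel punctured_quadrant)"
    unfolding limit_measure_def by (rule sets_restrict_space_cong) simp
  have space: "space ?V = punctured_quadrant"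
    unfolding limit_measure_def by (simp add: space_restrict_space)
  let ?A = "{0<..<\<infinity>} \<times> {0<..<\<infinity>} :: (ennreal \<times> ennreal) set"
  have "open ?A" by (intro open_Times) auto
  then have A[measurable]: "?A \<in> sets borel" by (rule borel_open)
  have "?A \<subseteq> punctured_quadrant" by (auto simp: punctured_quadrant_def)
  then have A': "?A \<in> sets ?V" unfolding sets using A by (simp add: sets_restrict_space_iff)
  have emb: "quadrant_embedding p \<in> ?A" if "p \<in> {0<..} \<times> {0<..}" for p
    using that by (auto simp: quadrant_embedding_def ennreal_less_top)
  have conc: "emeasure ?V (space ?V - ?A) = 0"
  proof -
    have "emeasure ?V (space ?V - ?A) = (\<integral>\<^sup>+ p. indicator (punctured_quadrant - ?A) p \<partial>?V)"
      using sets.compl_sets[OF A'] unfolding space by (rule nn_integral_indicator[symmetric])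
    also have "\<dots> = (\<integral>\<^sup>+ p\<in>{0<..} \<times> {0<..}. ennreal (limit_density c a r s (fst p) (snd p))
        * indicator (punctured_quadrant - ?A) (quadrant_embedding p) \<partial>lborel)"
      using A by (intro nn_integral_limit_measure_density borel_measurable_indicator sets.Diff) simp_all
    also have "\<dots> = (\<integral>\<^sup>+ p. 0 \<partial>(lborel :: (real \<times> real) measure))"
      using emb by (intro nn_integral_cong) (auto split: split_indicator)
    also have "\<dots> = 0" by simp
    finally show ?thesis .
  qed
  let ?pr = "\<lambda>(x, y). (enn2real x, enn2real y)"
  have pr[measurable]: "?pr \<in> borel \<rightarrow>\<^sub>M lborel"
    unfolding lborel_prod[symmetric] borel_prod[symmetric] by measurable
  have pr_V: "?pr \<in> ?V \<rightarrow>\<^sub>M lborel"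
    using measurable_restrict_space1[OF pr, of punctured_quadrant] sets by (simp cong: measurable_cong_sets)
  have dens: "(\<lambda>(x, y). ennreal (limit_density c a r s x y) * indicator ({0<..} \<times> {0<..}) (x, y))
     = (\<lambda>p. ennreal (limit_density c a r s (fst p) (snd p)) * indicator ({0<..} \<times> {0<..}) p)"
    by (simp add: fun_eq_iff)
  have "distr ?V lborel ?pr = density lborel (\<lambda>p. ennreal (limit_density c a r s (fst p) (snd p)) * indicator ({0<..} \<times> {0<..}) p)"
  proof (rule measure_eqI)
    fix B assume "B \<in> sets (distr ?V lborel ?pr)"
    then have B[measurable]: "B \<in> sets borel" by simp
    have [measurable]: "?pr \<in> borel \<rightarrow>\<^sub>M borel" using pr by simp
    have "emeasure (distr ?V lborel ?pr) B = (\<integral>\<^sup>+ p. indicator B (?pr p) \<partial>?V)"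
    proof -
      have "emeasure (distr ?V lborel ?pr) B = (\<integral>\<^sup>+ q. indicator B q \<partial>distr ?V lborel ?pr)"
        by (rule nn_integral_indicator[symmetric]) simp
      also have "\<dots> = (\<integral>\<^sup>+ p. indicator B (?pr p) \<partial>?V)"
        by (rule nn_integral_distr[OF pr_V]) simp
      finally show ?thesis .
    qed
    also have "\<dots> = (\<integral>\<^sup>+ p\<in>{0<..} \<times> {0<..}. ennreal (limit_density c a r s (fst p) (snd p)) * indicator B (?pr (quadrant_embedding p)) \<partial>lborel)"
      by (rule nn_integral_limit_measure_density) measurable
    also have "\<dots> = (\<integral>\<^sup>+ p. ennreal (limit_density c a r s (fst p) (snd p)) * indicator ({0<..} \<times> {0<..}) p * indicator B p \<partial>lborel)"
      by (intro nn_integral_cong) (auto simp: quadrant_embedding_def split: split_indicator)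
    also have "\<dots> = emeasure (density lborel (\<lambda>p. ennreal (limit_density c a r s (fst p) (snd p)) * indicator ({0<..} \<times> {0<..}) p)) B"
      using measurable_limit_density B by (subst emeasure_density) auto
    finally show "emeasure (distr ?V lborel ?pr) B = emeasure (density lborel (\<lambda>p. ennreal (limit_density c a r s (fst p) (snd p)) * indicator ({0<..} \<times> {0<..}) p)) B" .
  qed simp
  then show ?thesis
    unfolding has_quadrant_density_def concentrated_on_def distributed_def dens
    using A' conc pr_V measurable_limit_density by simp
qed


section \<open>Negative binomial laws at large scale\<close>

text \<open>
  Markov's inequality for \<open>x\<^bsup>i\<^esup>\<close> with \<open>x = exp (1 / (4 z))\<close>.  This \<open>x\<close> is at most \<open>1 + 1 / (2 z)\<close>, which
  keeps the base \<open>x + (1 - x) z\<close> of the generating function at least \<open>1/2\<close>, uniformly in \<open>z\<close>.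
\<close>

lemma negbin_tail:
  assumes "0 < r" "1 \<le> z"
  shows "(\<integral>\<^sup>+ i. indicator {i. b \<le> real (i + e)} i \<partial>negbin r z)
    \<le> ennreal (2 powr r * exp (real e / 4) * exp (- (b / (4 * z))))"
proof -
  define x where "x = exp (1 / (4 * z))"
  have x_pos: "0 < x" by (simp add: x_def)
  have x_le: "x \<le> 1 + 1 / (2 * z)"
  proof -
    have "1 / (4 * z) \<le> 1" using assms by (simp add: field_simps)
    then have "x \<le> 1 + 1 / (4 * z) + (1 / (4 * z))\<^sup>2"
      unfolding x_def using assms by (intro exp_bound) auto
    also have "(1 / (4 * z))\<^sup>2 \<le> 1 / (4 * z)"
      unfolding power2_eq_square using assms \<open>1 / (4 * z) \<le> 1\<close> by (intro mult_left_le) auto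
    finally show ?thesis by simp
  qed
  have "x * (1 - 1 / z) \<le> (1 + 1 / (2 * z)) * (1 - 1 / z)"
    using assms x_le by (intro mult_right_mono) auto
  also have "\<dots> < 1"
  proof -
    have "(1 + 1 / (2 * z)) * (1 - 1 / z) = 1 - 1 / (2 * z) - 1 / (2 * z) * (1 / z)"
      using assms by (simp add: field_simps)
    moreover have "0 < 1 / (2 * z)" "0 \<le> 1 / (2 * z) * (1 / z)" using assms by auto
    ultimately show ?thesis by linarith
  qed
  finally have conv: "x * (1 - 1 / z) < 1" .
  have base: "1 / 2 \<le> x + (1 - x) * z"
  proof -
    have "(x - 1) * z \<le> 1 / (2 * z) * z" using assms x_le by (intro mult_right_mono) auto
    also have "\<dots> = 1 / 2" using assms by simp
    finally have "(x - 1) * z \<le> 1 / 2" .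
    moreover have "1 \<le> x" using assms by (simp add: x_def)
    ultimately show ?thesis by (simp add: algebra_simps)
  qed
  have pow: "(x + (1 - x) * z) powr (- r) \<le> 2 powr r"
  proof -
    have "(x + (1 - x) * z) powr (- r) \<le> (1 / 2) powr (- r)"
      using base assms by (intro powr_mono2') auto
    also have "\<dots> = 2 powr r" by (simp add: powr_divide powr_minus)
    finally show ?thesis .
  qed
  have "(\<integral>\<^sup>+ i. indicator {i. b \<le> real (i + e)} i \<partial>negbin r z)
    \<le> (\<integral>\<^sup>+ i. ennreal (exp (real e / 4) * exp (- (b / (4 * z)))) * ennreal (x ^ i) \<partial>negbin r z)"
  proof (intro nn_integral_mono)
    fix i :: nat
    have "1 \<le> exp (real e / 4) * exp (- (b / (4 * z))) * x ^ i" if "b \<le> real (i + e)"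
    proof -
      have "b / (4 * z) \<le> real (i + e) / (4 * z)" using that assms by (intro divide_right_mono) auto
      also have "\<dots> = real i * (1 / (4 * z)) + real e / (4 * z)" by (simp add: add_divide_distrib)
      also have "real e / (4 * z) \<le> real e / (4 * 1)" using assms by (intro divide_left_mono) auto
      finally have "0 \<le> real e / 4 + (- (b / (4 * z))) + real i * (1 / (4 * z))" by simp
      then have "1 \<le> exp (real e / 4 + (- (b / (4 * z))) + real i * (1 / (4 * z)))" by simp
      then show ?thesis unfolding exp_add exp_of_nat_mult x_def .
    qed
    then show "indicator {i. b \<le> real (i + e)} i
      \<le> ennreal (exp (real e / 4) * exp (- (b / (4 * z)))) * ennreal (x ^ i)"
      using x_pos by (auto split: split_indicator simp flip: ennreal_mult ennreal_1 intro!: ennreal_leI)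
  qed
  also have "\<dots> = ennreal (exp (real e / 4) * exp (- (b / (4 * z))) * (x + (1 - x) * z) powr (- r))"
    using negbin_pgf[OF assms _ conv] x_pos by (simp add: nn_integral_cmult ennreal_mult)
  also have "\<dots> \<le> ennreal (exp (real e / 4) * exp (- (b / (4 * z))) * 2 powr r)"
    using pow by (intro ennreal_leI mult_left_mono) auto
  finally show ?thesis by (simp add: mult_ac)
qed

text \<open>
  The shifts \<open>d\<close> and \<open>e\<close> account for the one edge with which a node of the graph is born.
\<close>

definition scaled_lattice :: "real \<Rightarrow> real \<Rightarrow> nat \<Rightarrow> nat \<Rightarrow> real \<Rightarrow> nat \<times> nat \<Rightarrow> ennreal \<times> ennreal" where
  "scaled_lattice t t' d e h p =
     (ennreal (h powr (- t) * real (fst p + d)), ennreal (h powr (- t') * real (snd p + e)))"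

lemma exp_monom_scaled_lattice:
  "exp_monom m n (scaled_lattice t t' d e h (i, j)) =
     exp (- (real m * h powr (- t))) ^ d * exp (- (real n * h powr (- t'))) ^ e
      * (exp (- (real m * h powr (- t))) ^ i * exp (- (real n * h powr (- t'))) ^ j)"
  unfolding scaled_lattice_def fst_conv snd_conv
  by (subst (1 2) expneg_ennreal, simp, simp)
     (simp add: exp_of_nat_mult[symmetric] exp_add[symmetric] algebra_simps)

lemma pair_negbin_pgf:
  assumes "0 < r" "0 < s" "1 \<le> z" "1 \<le> v" "0 \<le> x" "x \<le> 1" "0 \<le> y" "y \<le> 1"
  shows "(\<integral>\<^sup>+ p. ennreal (x ^ fst p * y ^ snd p) \<partial>pair_pmf (negbin r z) (negbin s v))
    = ennreal ((x + (1 - x) * z) powr (- r) * (y + (1 - y) * v) powr (- s))"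
  using assms
  by (simp add: nn_integral_pair_pmf' ennreal_mult nn_integral_cmult nn_integral_multc negbin_pgf_unit)

text \<open>
  With \<open>x = exp (- m h\<^bsup>-t\<^esup>)\<close> and \<open>z = h\<^bsup>t\<^esup> w\<close>, the base \<open>x + (1 - x) z\<close> of the generating function tends
  to the base \<open>1 + m w\<close> of the gamma transform; the limit is a derivative at 0.
\<close>

lemma shrinking_exp_limit:
  fixes h :: "'i \<Rightarrow> real" and t m w :: real
  assumes "filterlim h at_top F" "0 < t"
  shows "((\<lambda>n. exp (- (m * h n powr (- t)))) \<longlongrightarrow> 1) F"
    and "((\<lambda>n. exp (- (m * h n powr (- t))) + (1 - exp (- (m * h n powr (- t)))) * (h n powr t * w)) \<longlongrightarrow> 1 + m * w) F"
proof -
  have h0: "((\<lambda>n. h n powr (- t)) \<longlongrightarrow> 0) F"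
    using assms by (intro tendsto_neg_powr) auto
  then have "((\<lambda>n. exp (- (m * h n powr (- t)))) \<longlongrightarrow> exp (- (m * 0))) F"
    by (intro tendsto_intros)
  then show lim1: "((\<lambda>n. exp (- (m * h n powr (- t)))) \<longlongrightarrow> 1) F" by simp
  have "((\<lambda>u. (1 - exp (- (m * u))) / u) \<longlongrightarrow> m) (at 0)"
  proof -
    have "((\<lambda>u. - exp (- (m * u))) has_real_derivative m) (at 0)"
      by (auto intro!: derivative_eq_intros)
    then show ?thesis unfolding DERIV_def by simp
  qed
  moreover have "filterlim (\<lambda>n. h n powr (- t)) (at 0) F"
  proof -
    have "\<forall>\<^sub>F n in F. 0 < h n" using assms(1) by (auto simp: filterlim_at_top_dense)
    then show ?thesis using h0 unfolding filterlim_at by (auto elim: eventually_mono)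
  qed
  ultimately have "((\<lambda>n. (1 - exp (- (m * h n powr (- t)))) / h n powr (- t)) \<longlongrightarrow> m) F"
    by (rule filterlim_compose)
  then have "((\<lambda>n. exp (- (m * h n powr (- t))) + (1 - exp (- (m * h n powr (- t)))) / h n powr (- t) * w) \<longlongrightarrow> 1 + m * w) F"
    using lim1 by (intro tendsto_intros)
  then show "((\<lambda>n. exp (- (m * h n powr (- t))) + (1 - exp (- (m * h n powr (- t)))) * (h n powr t * w)) \<longlongrightarrow> 1 + m * w) F"
    by (simp add: powr_minus divide_inverse mult.assoc)
qed

lemma pair_negbin_converges_to_gamma:
  fixes f :: "ennreal \<times> ennreal \<Rightarrow> real" and h :: "'i \<Rightarrow> real"
  assumes pos: "0 < r" "0 < s" "0 < t" "0 < t'" "0 < w" "0 < v"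
    and h: "filterlim h at_top F"
    and f: "continuous_on UNIV f" "\<And>p. 0 \<le> f p"
  shows "((\<lambda>n. \<integral>\<^sup>+ p. ennreal (f (scaled_lattice t t' d e (h n) p))
        \<partial>pair_pmf (negbin r (h n powr t * w)) (negbin s (h n powr t' * v)))
     \<longlongrightarrow> (\<integral>\<^sup>+ p. ennreal (f p) \<partial>gamma_pair r s w v)) F"
proof -
  define P where "P n = distr (pair_pmf (negbin r (h n powr t * w)) (negbin s (h n powr t' * v))) borel
      (scaled_lattice t t' d e (h n))" for n
  have P: "prob_space (P n)" "sets (P n) = sets borel" for n
    by (auto simp: P_def intro!: measure_pmf.prob_space_distr)
  have int_P: "(\<integral>\<^sup>+ p. ennreal (g p) \<partial>P n) = (\<integral>\<^sup>+ p. ennreal (g (scaled_lattice t t' d e (h n) p))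
        \<partial>pair_pmf (negbin r (h n powr t * w)) (negbin s (h n powr t' * v)))"
    if "continuous_on UNIV g" for g n
    using borel_measurable_continuous_onI[OF that] unfolding P_def by (simp add: nn_integral_distr)
  have large: "\<forall>\<^sub>F n in F. 1 \<le> h n powr t0 * u" if "0 < t0" "0 < u" for t0 u
  proof -
    have "((\<lambda>n. h n powr (- t0)) \<longlongrightarrow> 0) F" using that h by (intro tendsto_neg_powr) auto
    then have "\<forall>\<^sub>F n in F. h n powr (- t0) < u" by (rule order_tendstoD) (use that in auto)
    moreover have "\<forall>\<^sub>F n in F. 0 < h n" using h by (auto simp: filterlim_at_top_dense)
    ultimately show ?thesis
      by eventually_elim (simp add: powr_minus field_simps)
  qed
  have "((\<lambda>n. \<integral>\<^sup>+ p. ennreal (f p) \<partial>P n) \<longlongrightarrow> (\<integral>\<^sup>+ p. ennreal (f p) \<partial>gamma_pair r s w v)) F"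
  proof (rule weak_convergence_by_exp_monoms[OF P prob_space_gamma_pair _ _ f])
    fix m k :: nat
    let ?x = "\<lambda>n. exp (- (real m * h n powr (- t)))" and ?y = "\<lambda>n. exp (- (real k * h n powr (- t')))"
    have "\<forall>\<^sub>F n in F. ennreal (?x n ^ d * ?y n ^ e * ((?x n + (1 - ?x n) * (h n powr t * w)) powr (- r) *
         (?y n + (1 - ?y n) * (h n powr t' * v)) powr (- s))) = (\<integral>\<^sup>+ p. ennreal (exp_monom m k p) \<partial>P n)"
      using large[OF pos(3,5)] large[OF pos(4,6)]
    proof eventually_elim
      case (elim n)
      have "(\<integral>\<^sup>+ p. ennreal (exp_monom m k p) \<partial>P n)
        = (\<integral>\<^sup>+ p. ennreal (?x n ^ d * ?y n ^ e) * ennreal (?x n ^ fst p * ?y n ^ snd p)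
           \<partial>pair_pmf (negbin r (h n powr t * w)) (negbin s (h n powr t' * v)))"
        unfolding int_P[OF exp_polys_continuous[OF exp_polys.monom]]
      proof (intro nn_integral_cong)
        fix p :: "nat \<times> nat"
        show "ennreal (exp_monom m k (scaled_lattice t t' d e (h n) p))
          = ennreal (?x n ^ d * ?y n ^ e) * ennreal (?x n ^ fst p * ?y n ^ snd p)"
          by (cases p) (simp only: exp_monom_scaled_lattice fst_conv snd_conv ennreal_mult' exp_ge_zero zero_le_power mult_nonneg_nonneg)
      qed
      also have "\<dots> = ennreal (?x n ^ d * ?y n ^ e) * (\<integral>\<^sup>+ p. ennreal (?x n ^ fst p * ?y n ^ snd p)
           \<partial>pair_pmf (negbin r (h n powr t * w)) (negbin s (h n powr t' * v)))"
        by (rule nn_integral_cmult) simp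
      also have "(\<integral>\<^sup>+ p. ennreal (?x n ^ fst p * ?y n ^ snd p)
           \<partial>pair_pmf (negbin r (h n powr t * w)) (negbin s (h n powr t' * v)))
        = ennreal ((?x n + (1 - ?x n) * (h n powr t * w)) powr (- r) *
         (?y n + (1 - ?y n) * (h n powr t' * v)) powr (- s))"
        using pos elim by (intro pair_negbin_pgf) auto
      also have "ennreal (?x n ^ d * ?y n ^ e) * \<dots> = ennreal (?x n ^ d * ?y n ^ e * ((?x n + (1 - ?x n) * (h n powr t * w)) powr (- r) *
         (?y n + (1 - ?y n) * (h n powr t' * v)) powr (- s)))"
        by (rule ennreal_mult'[symmetric]) simp
      finally show ?case by simp
    qed
    moreover have "((\<lambda>n. ennreal (?x n ^ d * ?y n ^ e * ((?x n + (1 - ?x n) * (h n powr t * w)) powr (- r) *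
         (?y n + (1 - ?y n) * (h n powr t' * v)) powr (- s))))
      \<longlongrightarrow> ennreal (1 ^ d * 1 ^ e * ((1 + real m * w) powr (- r) * (1 + real k * v) powr (- s)))) F"
    proof -
      have "0 \<le> real m * w" "0 \<le> real k * v" using pos by auto
      then have "1 + real m * w \<noteq> 0" "1 + real k * v \<noteq> 0" by linarith+
      then show ?thesis
        using shrinking_exp_limit[OF h pos(3), of "real m"] shrinking_exp_limit[OF h pos(4), of "real k"]
        by (intro tendsto_ennrealI tendsto_mult tendsto_power tendsto_powr tendsto_const)
    qed
    ultimately show "((\<lambda>n. \<integral>\<^sup>+ p. ennreal (exp_monom m k p) \<partial>P n) \<longlongrightarrow> (\<integral>\<^sup>+ p. ennreal (exp_monom m k p) \<partial>gamma_pair r s w v)) F"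
      unfolding nn_integral_gamma_pair_exp_monom[OF pos(1,2,5,6)]
      by (auto elim!: Lim_transform_eventually[rotated] simp: ennreal_mult)
  qed (use pos in auto)
  then show ?thesis unfolding int_P[OF f(1)] .
qed


section \<open>The vague limit of the Pareto mixture\<close>

text \<open>
  The bound depends on \<open>h\<close> only through \<open>z / h\<^bsup>t\<^esup>\<close> and \<open>v / h\<^bsup>t'\<^esup>\<close>, hence not at all once
  \<open>z = h\<^bsup>t\<^esup> w\<close> is substituted.
\<close>

lemma pair_negbin_tail_bound:
  fixes f :: "ennreal \<times> ennreal \<Rightarrow> real"
  assumes pos: "0 < r" "0 < s" "1 \<le> z" "1 \<le> v" "0 < h" "0 \<le> B" "0 < \<epsilon>"
    and B: "\<And>p. f p \<le> B"
    and supp: "\<And>p. f p \<noteq> 0 \<Longrightarrow> ennreal \<epsilon> \<le> fst p \<or> ennreal \<epsilon> \<le> snd p"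
  shows "(\<integral>\<^sup>+ p. ennreal (f (scaled_lattice t t' d e h p)) \<partial>pair_pmf (negbin r z) (negbin s v))
    \<le> ennreal (B * (2 powr r * exp (real d / 4)) * exp (- (\<epsilon> * h powr t / (4 * z))))
      + ennreal (B * (2 powr s * exp (real e / 4)) * exp (- (\<epsilon> * h powr t' / (4 * v))))"
proof -
  let ?A = "{i. \<epsilon> * h powr t \<le> real (i + d)}" and ?A' = "{j. \<epsilon> * h powr t' \<le> real (j + e)}"
  have scale: "\<epsilon> * h powr u \<le> y" if "ennreal \<epsilon> \<le> ennreal (h powr (- u) * y)" "0 \<le> y" for u y
  proof -
    have "\<epsilon> \<le> h powr (- u) * y" using that pos by simp
    then show ?thesis using pos by (simp add: powr_minus field_simps)
  qed
  have "(\<integral>\<^sup>+ p. ennreal (f (scaled_lattice t t' d e h p)) \<partial>pair_pmf (negbin r z) (negbin s v))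
    \<le> (\<integral>\<^sup>+ p. ennreal B * indicator ?A (fst p) + ennreal B * indicator ?A' (snd p) \<partial>pair_pmf (negbin r z) (negbin s v))"
  proof (intro nn_integral_mono)
    fix p
    show "ennreal (f (scaled_lattice t t' d e h p)) \<le> ennreal B * indicator ?A (fst p) + ennreal B * indicator ?A' (snd p)"
    proof (cases "f (scaled_lattice t t' d e h p) = 0")
      case False
      then have "ennreal \<epsilon> \<le> fst (scaled_lattice t t' d e h p) \<or> ennreal \<epsilon> \<le> snd (scaled_lattice t t' d e h p)"
        by (rule supp)
      then have "fst p \<in> ?A \<or> snd p \<in> ?A'" unfolding scaled_lattice_def fst_conv snd_conv
        using scale by fastforce
      then have "(1 :: ennreal) \<le> indicator ?A (fst p) + indicator ?A' (snd p)"
        by (auto simp: indicator_def)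
      from mult_left_mono[OF this, of "ennreal B"]
      have "ennreal B \<le> ennreal B * indicator ?A (fst p) + ennreal B * indicator ?A' (snd p)"
        by (simp add: distrib_left)
      moreover have "ennreal (f (scaled_lattice t t' d e h p)) \<le> ennreal B" by (intro ennreal_leI B)
      ultimately show ?thesis by (rule order_trans[rotated])
    qed simp
  qed
  also have "\<dots> = ennreal B * (\<integral>\<^sup>+ i. indicator ?A i \<partial>negbin r z) + ennreal B * (\<integral>\<^sup>+ j. indicator ?A' j \<partial>negbin s v)"
    by (simp add: nn_integral_pair_pmf' nn_integral_add nn_integral_cmult)
  also have "\<dots> \<le> ennreal B * ennreal (2 powr r * exp (real d / 4) * exp (- (\<epsilon> * h powr t / (4 * z))))
      + ennreal B * ennreal (2 powr s * exp (real e / 4) * exp (- (\<epsilon> * h powr t' / (4 * v))))"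
    using pos by (intro add_mono mult_left_mono negbin_tail) auto
  finally show ?thesis using pos by (simp add: ennreal_mult' mult_ac)
qed

text \<open>
  The substitution \<open>z = h\<^bsup>c\<^esup> w\<close>: the Pareto density is homogeneous of degree \<open>-1 - 1/c\<close>, so the Jacobian
  \<open>h\<^bsup>c\<^esup>\<close> and the factor \<open>h\<close> cancel exactly.  The conditional integral appears as a double series, whose
  measurability in \<open>w\<close> is evident.
\<close>

lemma rescaled_yule_mixture:
  assumes pos: "0 < c" "0 < a" "0 < r" "0 < s" "0 < h"
  shows "ennreal h * (\<integral>\<^sup>+ p. g p \<partial>yule_pmf c a r s)
   = (\<integral>\<^sup>+ w\<in>{h powr (- c)<..}. ennreal (pareto_density c w)
        * (\<Sum>i. \<Sum>j. ennreal (negbin_mass r (h powr c * w) i) * ennreal (negbin_mass s ((h powr c * w) powr a) j) * g (i, j)) \<partial>lborel)"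
proof -
  let ?S = "\<lambda>z. \<Sum>i. \<Sum>j. ennreal (negbin_mass r z i) * ennreal (negbin_mass s (z powr a) j) * g (i, j)"
  have hc: "0 < h powr c" using pos by simp
  have "(\<integral>\<^sup>+ p. g p \<partial>yule_pmf c a r s) = (\<integral>\<^sup>+ z\<in>{1<..}. ennreal (pareto_density c z) * ?S z \<partial>lborel)"
    unfolding nn_integral_yule[OF pos(1-4)]
    by (intro nn_integral_cong) (simp add: nn_integral_pair_negbin[OF pos(1-4)] split: split_indicator)
  also have "\<dots> = ennreal (h powr c) * (\<integral>\<^sup>+ w. ennreal (pareto_density c (h powr c * w)) * ?S (h powr c * w) * indicator {1<..} (h powr c * w) \<partial>lborel)"
    using hc by (subst nn_integral_real_affine[where c = "h powr c" and t = 0]) simp_all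
  finally have "ennreal h * (\<integral>\<^sup>+ p. g p \<partial>yule_pmf c a r s)
    = ennreal (h * h powr c) * (\<integral>\<^sup>+ w. ennreal (pareto_density c (h powr c * w)) * ?S (h powr c * w) * indicator {1<..} (h powr c * w) \<partial>lborel)"
    using pos by (simp add: ennreal_mult mult.assoc)
  also have "\<dots> = (\<integral>\<^sup>+ w. ennreal (h * h powr c) * (ennreal (pareto_density c (h powr c * w)) * ?S (h powr c * w) * indicator {1<..} (h powr c * w)) \<partial>lborel)"
    by (rule nn_integral_cmult[symmetric]) measurable
  also have "\<dots> = (\<integral>\<^sup>+ w\<in>{h powr (- c)<..}. ennreal (pareto_density c w) * ?S (h powr c * w) \<partial>lborel)"
  proof (intro nn_integral_cong)
    fix w :: real
    have iff: "1 < h powr c * w \<longleftrightarrow> h powr (- c) < w"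
      using hc by (simp add: powr_minus field_simps)
    show "ennreal (h * h powr c) * (ennreal (pareto_density c (h powr c * w)) * ?S (h powr c * w) * indicator {1<..} (h powr c * w))
      = ennreal (pareto_density c w) * ?S (h powr c * w) * indicator {h powr (- c)<..} w"
    proof (cases "h powr (- c) < w")
      case True
      then have w: "0 < w" by (rule le_less_trans[OF powr_ge_zero])
      have "h * h powr c * pareto_density c (h powr c * w) = pareto_density c w"
      proof -
        have "h * h powr c * (h powr c) powr (- (1 + 1 / c)) = h powr 1 * h powr c * h powr (- c - 1)"
          using pos by (simp add: powr_powr algebra_simps)
        also have "\<dots> = 1" using pos by (simp only: powr_add[symmetric]) simp
        finally show ?thesis using w hc by (simp add: pareto_density_def powr_mult)
      qed
      then have "ennreal (h * h powr c) * ennreal (pareto_density c (h powr c * w)) = ennreal (pareto_density c w)"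
        using pos by (simp add: pareto_density_nonneg flip: ennreal_mult)
      then show ?thesis using True iff by (simp add: mult.assoc[symmetric])
    qed (use iff in simp)
  qed
  finally show ?thesis .
qed

text \<open>
  Dominated convergence in the scale \<open>w\<close>.  The pointwise limits obey the same dominating bound, which
  gives the finiteness of the limit.
\<close>

lemma yule_vague_limit:
  fixes f :: "ennreal \<times> ennreal \<Rightarrow> real"
  assumes pos: "0 < c" "0 < a" "0 < r" "0 < s" "0 < \<epsilon>"
    and f: "continuous_on UNIV f" "\<And>p. 0 \<le> f p"
    and supp: "\<And>p. f p \<noteq> 0 \<Longrightarrow> ennreal \<epsilon> \<le> fst p \<or> ennreal \<epsilon> \<le> snd p"
  shows "((\<lambda>h. ennreal h * (\<integral>\<^sup>+ p. ennreal (f (scaled_lattice c (a * c) d e h p)) \<partial>yule_pmf c a r s))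
      \<longlongrightarrow> (\<integral>\<^sup>+ p. ennreal (f p) \<partial>limit_measure c a r s)) at_top" (is ?lim)
    and "(\<integral>\<^sup>+ p. ennreal (f p) \<partial>limit_measure c a r s) < \<infinity>" (is ?fin)
proof -
  have f_meas[measurable]: "f \<in> borel_measurable borel" by (rule borel_measurable_continuous_onI[OF f(1)])
  have "compact (range f)" by (intro compact_continuous_image f compact_UNIV_ennreal_prod)
  then have "bounded (range f)" by (rule compact_imp_bounded)
  then obtain B where "\<And>p. \<bar>f p\<bar> \<le> B" by (auto simp: bounded_real)
  then have B: "f p \<le> B" for p by (meson abs_le_D1)
  have B0: "0 \<le> B" using B[of undefined] f(2)[of undefined] by linarith
  define C where "C = B * (2 powr r * exp (real d / 4))"
  define C' where "C' = B * (2 powr s * exp (real e / 4))"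
  have C: "0 \<le> C" "0 \<le> C'" using B0 by (auto simp: C_def C'_def)
  define S where "S h w = (\<Sum>i. \<Sum>j. ennreal (negbin_mass r (h powr c * w) i) * ennreal (negbin_mass s ((h powr c * w) powr a) j)
      * ennreal (f (scaled_lattice c (a * c) d e h (i, j))))" for h w :: real
  have S_meas[measurable]: "S h \<in> borel_measurable borel" for h
    unfolding S_def by measurable
  \<comment> \<open>the tail bounds at \<open>z = h\<^bsup>c\<^esup> w\<close>, from which \<open>h\<close> has dropped out\<close>
  define D where "D w = (ennreal C * (ennreal (pareto_density c w) * ennreal (exp (- (\<epsilon> / 4 / w powr 1))))
      + ennreal C' * (ennreal (pareto_density c w) * ennreal (exp (- (\<epsilon> / 4 / w powr a))))) * indicator {0<..} w" for w
  define L where "L w = ennreal (pareto_density c w) * (\<integral>\<^sup>+ p. ennreal (f p) \<partial>gamma_pair r s w (w powr a)) * indicator {0<..} w" for w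
  define U where "U h w = ennreal (pareto_density c w) * S h w * indicator {h powr (- c)<..} w" for h w
  have S_eq: "S h w = (\<integral>\<^sup>+ p. ennreal (f (scaled_lattice c (a * c) d e h p))
       \<partial>pair_pmf (negbin r (h powr c * w)) (negbin s (h powr (a * c) * w powr a)))"
    and ge_1: "1 \<le> h powr c * w" "1 \<le> h powr (a * c) * w powr a"
    if hw: "0 < h" "h powr (- c) < w" for h w
  proof -
    have w: "0 < w" by (rule le_less_trans[OF powr_ge_zero hw(2)])
    have eq: "(h powr c * w) powr a = h powr (a * c) * w powr a"
      using hw w by (simp add: powr_mult powr_powr mult.commute)
    show 1: "1 \<le> h powr c * w" using hw by (simp add: powr_minus field_simps)
    then show "1 \<le> h powr (a * c) * w powr a" unfolding eq[symmetric] using pos by (simp add: ge_one_powr_ge_zero)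
    show "S h w = (\<integral>\<^sup>+ p. ennreal (f (scaled_lattice c (a * c) d e h p))
       \<partial>pair_pmf (negbin r (h powr c * w)) (negbin s (h powr (a * c) * w powr a)))"
      unfolding S_def eq[symmetric] by (rule nn_integral_pair_negbin[OF pos(1-4) 1, symmetric])
  qed
  have U_le: "U h w \<le> D w" if h: "0 < h" for h w
  proof (cases "h powr (- c) < w")
    case True
    have w: "0 < w" by (rule le_less_trans[OF powr_ge_zero True])
    have "S h w \<le> ennreal (C * exp (- (\<epsilon> * h powr c / (4 * (h powr c * w)))))
      + ennreal (C' * exp (- (\<epsilon> * h powr (a * c) / (4 * (h powr (a * c) * w powr a)))))"
      unfolding S_eq[OF h True] C_def C'_def
      by (rule pair_negbin_tail_bound[OF pos(3,4) ge_1[OF h True] h B0 pos(5) B supp])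
    also have "\<epsilon> * h powr c / (4 * (h powr c * w)) = \<epsilon> / 4 / w powr 1" using h w by simp
    also have "\<epsilon> * h powr (a * c) / (4 * (h powr (a * c) * w powr a)) = \<epsilon> / 4 / w powr a" using h w by simp
    finally have "ennreal (pareto_density c w) * S h w \<le> ennreal (pareto_density c w) *
      (ennreal C * ennreal (exp (- (\<epsilon> / 4 / w powr 1))) + ennreal C' * ennreal (exp (- (\<epsilon> / 4 / w powr a))))"
      using C by (intro mult_left_mono) (auto simp: ennreal_mult')
    then show ?thesis using True w by (simp add: U_def D_def distrib_left mult_ac)
  qed (simp add: U_def)
  have D_fin: "(\<integral>\<^sup>+ w. D w \<partial>lborel) < \<infinity>"
  proof -
    have k: "1 < 1 + 1 / c" "0 < \<epsilon> / 4" using pos by auto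
    have fin: "(\<integral>\<^sup>+ w\<in>{0<..}. ennreal (pareto_density c w) * ennreal (exp (- (\<epsilon> / 4 / w powr q))) \<partial>lborel) < \<infinity>" if "0 < q" for q
    proof -
      have "(\<integral>\<^sup>+ w\<in>{0<..}. ennreal (pareto_density c w) * ennreal (exp (- (\<epsilon> / 4 / w powr q))) \<partial>lborel)
        = (\<integral>\<^sup>+ w. ennreal (inverse c) * (ennreal (w powr (- (1 + 1 / c)) * exp (- (\<epsilon> / 4 / w powr q))) * indicator {0<..} w) \<partial>lborel)"
        using pos by (intro nn_integral_cong) (simp add: pareto_density_def mult.assoc[symmetric] flip: ennreal_mult)
      also have "\<dots> < \<infinity>"
        using nn_integral_powr_exp_finite[OF k(1) that k(2)]
        by (subst nn_integral_cmult) (auto simp: ennreal_mult_less_top)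
      finally show ?thesis .
    qed
    have "(\<integral>\<^sup>+ w. D w \<partial>lborel) = ennreal C * (\<integral>\<^sup>+ w\<in>{0<..}. ennreal (pareto_density c w) * ennreal (exp (- (\<epsilon> / 4 / w powr 1))) \<partial>lborel)
       + ennreal C' * (\<integral>\<^sup>+ w\<in>{0<..}. ennreal (pareto_density c w) * ennreal (exp (- (\<epsilon> / 4 / w powr a))) \<partial>lborel)"
      unfolding D_def
      by (simp add: distrib_right mult.assoc nn_integral_add nn_integral_cmult del: powr_one powr_one')
    also have "\<dots> < \<infinity>" using fin[of 1] fin[of a] pos by (simp add: ennreal_mult_less_top del: powr_one powr_one')
    finally show ?thesis .
  qed
  have U_lim: "(\<lambda>n. U (h n) w) \<longlonglongrightarrow> L w" if h: "filterlim h at_top sequentially" for h :: "nat \<Rightarrow> real" and w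
  proof (cases "0 < w")
    case True
    have "\<forall>\<^sub>F n in sequentially. 0 < h n" using h by (auto simp: filterlim_at_top_dense)
    moreover have "\<forall>\<^sub>F n in sequentially. h n powr (- c) < w"
    proof -
      have "(\<lambda>n. h n powr (- c)) \<longlonglongrightarrow> 0" using pos h by (intro tendsto_neg_powr) auto
      then show ?thesis using True by (rule order_tendstoD)
    qed
    ultimately have ev: "\<forall>\<^sub>F n in sequentially. ennreal (pareto_density c w) * (\<integral>\<^sup>+ p. ennreal (f (scaled_lattice c (a * c) d e (h n) p))
       \<partial>pair_pmf (negbin r (h n powr c * w)) (negbin s (h n powr (a * c) * w powr a))) = U (h n) w"
      by eventually_elim (simp add: U_def S_eq)
    have "(\<lambda>n. ennreal (pareto_density c w) * (\<integral>\<^sup>+ p. ennreal (f (scaled_lattice c (a * c) d e (h n) p))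
       \<partial>pair_pmf (negbin r (h n powr c * w)) (negbin s (h n powr (a * c) * w powr a))))
      \<longlonglongrightarrow> ennreal (pareto_density c w) * (\<integral>\<^sup>+ p. ennreal (f p) \<partial>gamma_pair r s w (w powr a))"
      using pos True h f by (intro ennreal_tendsto_cmult pair_negbin_converges_to_gamma) auto
    then have "(\<lambda>n. U (h n) w) \<longlonglongrightarrow> ennreal (pareto_density c w) * (\<integral>\<^sup>+ p. ennreal (f p) \<partial>gamma_pair r s w (w powr a))"
      by (rule Lim_transform_eventually[OF _ ev])
    then show ?thesis using True by (simp add: L_def)
  next
    case False
    have "U (h n) w = 0" for n
      using False powr_ge_zero[of "h n" "- c"] unfolding U_def
      by (auto split: split_indicator) (meson not_less order_trans less_imp_le not_le powr_ge_zero)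
    then show ?thesis using False by (simp add: L_def)
  qed
  have D_meas[measurable]: "D \<in> borel_measurable lborel" unfolding D_def by measurable
  have U_meas[measurable]: "U h \<in> borel_measurable lborel" for h unfolding U_def by measurable
  have L_meas[measurable]: "L \<in> borel_measurable lborel"
    by (rule borel_measurable_LIMSEQ_order[OF U_lim[OF filterlim_real_sequentially]]) measurable
  have V: "(\<integral>\<^sup>+ p. ennreal (f p) \<partial>limit_measure c a r s) = (\<integral>\<^sup>+ w. L w \<partial>lborel)"
    unfolding L_def using pos by (intro nn_integral_limit_measure) auto
  show ?fin
  proof -
    have "L w \<le> D w" for w
    proof (rule LIMSEQ_le_const2[OF U_lim[of "\<lambda>n. real (Suc n)" w]])
      show "filterlim (\<lambda>n. real (Suc n)) at_top sequentially"
        by (rule filterlim_compose[OF filterlim_real_sequentially filterlim_Suc])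
    qed (use U_le in auto)
    then have "(\<integral>\<^sup>+ w. L w \<partial>lborel) \<le> (\<integral>\<^sup>+ w. D w \<partial>lborel)" by (intro nn_integral_mono)
    then show ?thesis unfolding V using D_fin by (rule le_less_trans)
  qed
  show ?lim unfolding V
  proof (rule tendsto_at_topI_sequentially)
    fix h :: "nat \<Rightarrow> real" assume h: "filterlim h at_top sequentially"
    \<comment> \<open>the dominating bound holds for positive scales only\<close>
    define k where "k n = max 1 (h n)" for n
    have k: "filterlim k at_top sequentially"
      using h unfolding k_def by (rule filterlim_at_top_mono) auto
    have k_pos: "0 < k n" for n by (simp add: k_def)
    have "(\<lambda>n. \<integral>\<^sup>+ w. U (k n) w \<partial>lborel) \<longlonglongrightarrow> (\<integral>\<^sup>+ w. L w \<partial>lborel)"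
      using U_le[OF k_pos] U_lim[OF k] D_fin by (intro nn_integral_dominated_convergence[where w = D]) auto
    moreover have "\<forall>\<^sub>F n in sequentially. (\<integral>\<^sup>+ w. U (k n) w \<partial>lborel)
       = ennreal (h n) * (\<integral>\<^sup>+ p. ennreal (f (scaled_lattice c (a * c) d e (h n) p)) \<partial>yule_pmf c a r s)"
    proof -
      have "\<forall>\<^sub>F n in sequentially. 1 < h n" using h by (auto simp: filterlim_at_top_dense)
      then show ?thesis
      proof eventually_elim
        case (elim n)
        then have "k n = h n" "0 < h n" by (auto simp: k_def)
        then show ?case using rescaled_yule_mixture[OF pos(1-4) \<open>0 < h n\<close>]
          by (simp add: U_def S_def)
      qed
    qed
    ultimately show "(\<lambda>n. ennreal (h n) * (\<integral>\<^sup>+ p. ennreal (f (scaled_lattice c (a * c) d e (h n) p)) \<partial>yule_pmf c a r s))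
      \<longlonglongrightarrow> (\<integral>\<^sup>+ w. L w \<partial>lborel)"
      by (rule Lim_transform_eventually)
  qed
qed


section \<open>Vague convergence of laws and of their mixtures\<close>

lemma yule_pgf:
  assumes pos: "0 < c" "0 < a" "0 < r" "0 < s" and xy: "0 \<le> x" "x \<le> 1" "0 \<le> y" "y \<le> 1"
  shows "(\<integral>\<^sup>+ p. ennreal (x ^ fst p * y ^ snd p) \<partial>yule_pmf c a r s)
    = ennreal (inverse c * (LBINT z:{1<..}. z powr (- (1 + 1 / c))
        * (x + (1 - x) * z) powr (- r) * (y + (1 - y) * z powr a) powr (- s)))"
proof -
  let ?k = "\<lambda>z. (x + (1 - x) * z) powr (- r) * (y + (1 - y) * z powr a) powr (- s)"
  have mix: "(\<integral>\<^sup>+ p. ennreal (x ^ fst p * y ^ snd p) \<partial>yule_pmf c a r s)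
    = (\<integral>\<^sup>+ z. ennreal (pareto_density c z * ?k z * indicator {1<..} z) \<partial>lborel)"
    unfolding nn_integral_yule[OF pos]
  proof (intro nn_integral_cong)
    fix z :: real
    show "ennreal (pareto_density c z) * (\<integral>\<^sup>+ p. ennreal (x ^ fst p * y ^ snd p)
          \<partial>pair_pmf (negbin r z) (negbin s (z powr a))) * indicator {1<..} z
      = ennreal (pareto_density c z * ?k z * indicator {1<..} z)"
    proof (cases "1 < z")
      case True
      then have "1 \<le> z powr a" using pos by (simp add: ge_one_powr_ge_zero)
      then have "(\<integral>\<^sup>+ p. ennreal (x ^ fst p * y ^ snd p) \<partial>pair_pmf (negbin r z) (negbin s (z powr a))) = ennreal (?k z)"
        using True pos xy by (intro pair_negbin_pgf) auto
      then show ?thesis using True pos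
        by (simp only: pareto_density_nonneg ennreal_mult'[symmetric]) simp
    qed simp
  qed
  have fin: "(\<integral>\<^sup>+ z. ennreal (pareto_density c z * ?k z * indicator {1<..} z) \<partial>lborel)
     = ennreal (LINT z|lborel. pareto_density c z * ?k z * indicator {1<..} z)"
  proof (rule nn_integral_eq_integral)
    have nn: "0 \<le> pareto_density c z * ?k z * indicator {1<..} z" for z
      using pos by (simp add: pareto_density_nonneg)
    show "AE z in lborel. 0 \<le> pareto_density c z * ?k z * indicator {1<..} z"
      using nn by simp
    show "integrable lborel (\<lambda>z. pareto_density c z * ?k z * indicator {1<..} z)"
    proof (rule integrableI_nonneg)
      have "(\<integral>\<^sup>+ p. ennreal (x ^ fst p * y ^ snd p) \<partial>yule_pmf c a r s) \<le> (\<integral>\<^sup>+ p. 1 \<partial>yule_pmf c a r s)"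
        using xy by (intro nn_integral_mono) (auto simp: mult_le_one power_le_one)
      also have "\<dots> < \<infinity>" by simp
      finally show "(\<integral>\<^sup>+ z. ennreal (pareto_density c z * ?k z * indicator {1<..} z) \<partial>lborel) < \<infinity>"
        unfolding mix .
    qed (use nn in auto)
  qed
  have "(LINT z|lborel. pareto_density c z * ?k z * indicator {1<..} z)
     = inverse c * (LBINT z:{1<..}. z powr (- (1 + 1 / c))
        * (x + (1 - x) * z) powr (- r) * (y + (1 - y) * z powr a) powr (- s))"
    unfolding set_lebesgue_integral_def pareto_density_def
    by (subst integral_mult_right_zero[symmetric]) (simp add: mult_ac)
  then show ?thesis unfolding mix fin by simp
qed

text \<open>
  The continuous function \<open>max x y\<close> attains a positive minimum on \<open>K\<close>.
\<close>

lemma away_from_origin: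
  fixes K :: "(ennreal \<times> ennreal) set"
  assumes "compact K" "K \<subseteq> punctured_quadrant"
  obtains \<epsilon> where "0 < \<epsilon>" "\<And>p. p \<in> K \<Longrightarrow> ennreal \<epsilon> \<le> fst p \<or> ennreal \<epsilon> \<le> snd p"
proof (cases "K = {}")
  case True
  then show ?thesis by (intro that[of 1]) auto
next
  case False
  have "continuous_on K (\<lambda>p. max (fst p) (snd p))" by (intro continuous_intros)
  from continuous_attains_inf[OF assms(1) False this]
  obtain q where q: "q \<in> K" "\<And>p. p \<in> K \<Longrightarrow> max (fst q) (snd q) \<le> max (fst p) (snd p)" by auto
  have "q \<noteq> (0, 0)" using q(1) assms(2) by (auto simp: punctured_quadrant_def)
  then have "0 < max (fst q) (snd q)" by (cases q) (auto simp: max_def zero_less_iff_neq_zero)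
  then obtain u where u: "0 < u" "u < max (fst q) (snd q)" using dense by blast
  then obtain \<epsilon> where \<epsilon>: "u = ennreal \<epsilon>" "0 \<le> \<epsilon>" by (cases u) auto
  have "ennreal \<epsilon> \<le> fst p \<or> ennreal \<epsilon> \<le> snd p" if "p \<in> K" for p
    using q(2)[OF that] u(2) \<epsilon> by (auto simp: max_def split: if_splits)
  then show ?thesis using u \<epsilon> by (intro that[of \<epsilon>]) auto
qed

text \<open>
  Extension by 0 is continuous because the punctured quadrant and the complement of the support
  form an open cover.
\<close>

lemma test_function_extension:
  fixes f :: "ennreal \<times> ennreal \<Rightarrow> real"
  assumes f: "continuous_on punctured_quadrant f" "\<And>x. x \<in> punctured_quadrant \<Longrightarrow> 0 \<le> f x"
    and K: "compact K" "K \<subseteq> punctured_quadrant" "\<And>x. x \<in> punctured_quadrant - K \<Longrightarrow> f x = 0"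
  obtains g \<epsilon> where "continuous_on UNIV g" "\<And>p. 0 \<le> g p" "0 < \<epsilon>"
    "\<And>p. g p \<noteq> 0 \<Longrightarrow> ennreal \<epsilon> \<le> fst p \<or> ennreal \<epsilon> \<le> snd p"
    "\<And>p. p \<in> punctured_quadrant \<Longrightarrow> g p = f p" "g (0, 0) = 0"
proof -
  define g where "g p = (if p \<in> punctured_quadrant then f p else 0)" for p
  have "continuous_on (punctured_quadrant \<union> - K) g"
  proof (rule continuous_on_open_Un[OF open_punctured_quadrant])
    show "open (- K)" using compact_imp_closed[OF K(1)] by auto
    show "continuous_on punctured_quadrant g"
      using f(1) by (rule continuous_on_eq) (simp add: g_def)
    show "continuous_on (- K) g"
      using K by (intro continuous_on_eq[OF continuous_on_const[of _ 0]]) (auto simp: g_def)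
  qed
  moreover have "punctured_quadrant \<union> - K = UNIV" using K(2) by auto
  ultimately have cont: "continuous_on UNIV g" by simp
  obtain \<epsilon> where \<epsilon>: "0 < \<epsilon>" "\<And>p. p \<in> K \<Longrightarrow> ennreal \<epsilon> \<le> fst p \<or> ennreal \<epsilon> \<le> snd p"
    using away_from_origin[OF K(1,2)] by blast
  show ?thesis
  proof (rule that[OF cont _ \<epsilon>(1)])
    show "ennreal \<epsilon> \<le> fst p \<or> ennreal \<epsilon> \<le> snd p" if "g p \<noteq> 0" for p
    proof -
      have "p \<in> K" using that K(3)[of p] by (auto simp: g_def split: if_splits)
      then show ?thesis by (rule \<epsilon>(2))
    qed
  qed (use f in \<open>auto simp: g_def punctured_quadrant_def\<close>)
qed

text \<open>
  A continuous function that dominates the indicator of \<open>K\<close> and vanishes near the origin has a finite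
  integral by \<open>yule_vague_limit\<close>.
\<close>

lemma radon_limit_measure:
  assumes pos: "0 < c" "0 < a" "0 < r" "0 < s"
  shows "radon_measure_on punctured_quadrant (limit_measure c a r s)"
  unfolding radon_measure_on_def
proof (intro conjI allI impI)
  show sets: "sets (limit_measure c a r s) = sets (restrict_space borel punctured_quadrant)"
    unfolding limit_measure_def by (rule sets_restrict_space_cong) simp
  fix K :: "(ennreal \<times> ennreal) set" assume K: "compact K \<and> K \<subseteq> punctured_quadrant"
  obtain \<epsilon> where \<epsilon>: "0 < \<epsilon>" "\<And>p. p \<in> K \<Longrightarrow> ennreal \<epsilon> \<le> fst p \<or> ennreal \<epsilon> \<le> snd p"
    using away_from_origin K by blast
  define \<eta> where "\<eta> = 1 - exp (- \<epsilon>)"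
  have \<eta>: "0 < \<eta>" "\<eta> < 1" using \<epsilon> by (auto simp: \<eta>_def)
  \<comment> \<open>at least 1 where the sum reaches \<open>\<eta>\<close>, hence on \<open>K\<close>, and 0 where it is at most \<open>\<eta> / 2\<close>\<close>
  define g where "g p = max 0 (2 * ((1 - expneg (fst p)) + (1 - expneg (snd p))) / \<eta> - 1)" for p
  have g_cont: "continuous_on UNIV g"
    unfolding g_def by (intro continuous_intros continuous_on_compose2[OF continuous_expneg]) (use \<eta> in auto)
  have far: "expneg x \<le> 1 - \<eta>" if "ennreal \<epsilon> \<le> x" for x
    using that \<epsilon>(1) by (cases x) (auto simp: expneg_def \<eta>_def)
  have g_K: "1 \<le> g p" if "p \<in> K" for p
  proof -
    have "\<eta> \<le> (1 - expneg (fst p)) + (1 - expneg (snd p))"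
      using \<epsilon>(2)[OF that] far[of "fst p"] far[of "snd p"] expneg_le_1[of "fst p"] expneg_le_1[of "snd p"] by linarith
    then show ?thesis using \<eta> by (simp add: g_def le_max_iff_disj field_simps)
  qed
  \<comment> \<open>the level at which \<open>1 - exp (- x)\<close> reaches \<open>\<eta> / 4\<close>\<close>
  define \<epsilon>' where "\<epsilon>' = - ln (1 - \<eta> / 4)"
  have \<epsilon>': "0 < \<epsilon>'" using \<eta> by (simp add: \<epsilon>'_def)
  have near: "\<eta> / 4 \<ge> 1 - expneg x" if "x < ennreal \<epsilon>'" for x
  proof (cases x)
    case (real q)
    then have "q < \<epsilon>'" using that by (simp add: ennreal_less_iff)
    then have "exp (- \<epsilon>') < exp (- q)" by simp
    also have "exp (- \<epsilon>') = 1 - \<eta> / 4" using \<eta> by (simp add: \<epsilon>'_def)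
    finally show ?thesis using real by (simp add: expneg_ennreal)
  qed (use that in auto)
  have supp: "ennreal \<epsilon>' \<le> fst p \<or> ennreal \<epsilon>' \<le> snd p" if "g p \<noteq> 0" for p
  proof (rule ccontr)
    assume "\<not> ?thesis"
    then have "(1 - expneg (fst p)) + (1 - expneg (snd p)) \<le> \<eta> / 2"
      using near[of "fst p"] near[of "snd p"] by (simp add: not_le)
    then have "2 * ((1 - expneg (fst p)) + (1 - expneg (snd p))) / \<eta> \<le> 1" using \<eta> by (simp add: field_simps)
    then show False using that unfolding g_def by simp
  qed
  have "K \<in> sets borel" using K compact_imp_closed by (intro borel_closed) auto
  then have K_sets: "K \<in> sets (limit_measure c a r s)" using K unfolding sets by (simp add: sets_restrict_space_iff)
  have "emeasure (limit_measure c a r s) K = (\<integral>\<^sup>+ p. indicator K p \<partial>limit_measure c a r s)"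
    by (rule nn_integral_indicator[OF K_sets, symmetric])
  also have "\<dots> \<le> (\<integral>\<^sup>+ p. ennreal (g p) \<partial>limit_measure c a r s)"
    using g_K by (intro nn_integral_mono) (auto split: split_indicator simp flip: ennreal_1 intro!: ennreal_leI)
  also have "\<dots> < \<infinity>"
    by (rule yule_vague_limit(2)[OF pos \<epsilon>' g_cont _ supp]) (simp add: g_def)
  finally show "emeasure (limit_measure c a r s) K < \<infinity>" .
qed

lemma nn_integral_punctured_restrict:
  assumes [measurable]: "f \<in> borel_measurable borel" and "f (0, 0) = 0" and sets: "sets N = sets borel"
  shows "(\<integral>\<^sup>+ p. f p \<partial>restrict_space N punctured_quadrant) = (\<integral>\<^sup>+ p. f p \<partial>N)"
proof -
  have "punctured_quadrant \<inter> space N \<in> sets N"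
    using sets sets_eq_imp_space_eq[OF sets] by simp
  then have "(\<integral>\<^sup>+ p. f p \<partial>restrict_space N punctured_quadrant) = (\<integral>\<^sup>+ p. f p * indicator punctured_quadrant p \<partial>N)"
    by (simp add: nn_integral_restrict_space)
  also have "\<dots> = (\<integral>\<^sup>+ p. f p \<partial>N)"
    using assms(2) by (intro nn_integral_cong) (auto simp: punctured_quadrant_def split: split_indicator)
  finally show ?thesis .
qed

lemma nn_integral_scaled_law:
  assumes [measurable]: "g \<in> borel_measurable borel" and "g (0, 0) = 0"
    and X: "X \<in> measurable M (count_space UNIV)" and Y: "Y \<in> measurable M (count_space UNIV)"
  shows "(\<integral>\<^sup>+ p. g p \<partial>scaled_law M X Y t t' h)
    = ennreal h * (\<integral>\<^sup>+ \<omega>. g (scaled_lattice t t' 0 0 h (X \<omega>, Y \<omega>)) \<partial>M)"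
proof -
  have XY: "(\<lambda>\<omega>. (ennreal (h powr (- t) * real (X \<omega>)), ennreal (h powr (- t') * real (Y \<omega>)))) \<in> M \<rightarrow>\<^sub>M borel"
    using X Y unfolding borel_prod[symmetric] by measurable
  show ?thesis
    unfolding scaled_law_def using assms
    by (subst nn_integral_scale_measure)
       (auto simp: nn_integral_punctured_restrict nn_integral_distr[OF XY] scaled_lattice_def intro!: measurable_restrict_space1)
qed

lemma vague_convergenceI:
  assumes X: "X \<in> measurable M (count_space UNIV)" and Y: "Y \<in> measurable M (count_space UNIV)"
    and lim: "\<And>f \<epsilon>. continuous_on UNIV f \<Longrightarrow> (\<And>p. 0 \<le> f p) \<Longrightarrow> 0 < \<epsilon> \<Longrightarrow>
       (\<And>p. f p \<noteq> 0 \<Longrightarrow> ennreal \<epsilon> \<le> fst p \<or> ennreal \<epsilon> \<le> snd p) \<Longrightarrow>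
       ((\<lambda>h. ennreal h * (\<integral>\<^sup>+ \<omega>. ennreal (f (scaled_lattice t t' 0 0 h (X \<omega>, Y \<omega>))) \<partial>M))
         \<longlongrightarrow> (\<integral>\<^sup>+ p. ennreal (f p) \<partial>V)) at_top"
    and V: "space V = punctured_quadrant"
  shows "vague_convergence punctured_quadrant (scaled_law M X Y t t') V at_top"
  unfolding vague_convergence_def
proof (intro allI impI, elim conjE exE)
  fix f :: "ennreal \<times> ennreal \<Rightarrow> real" and K
  assume f: "continuous_on punctured_quadrant f" "\<forall>x\<in>punctured_quadrant. 0 \<le> f x"
    and K: "compact K" "K \<subseteq> punctured_quadrant" "\<forall>x\<in>punctured_quadrant - K. f x = 0"
  obtain g \<epsilon> where g: "continuous_on UNIV g" "\<And>p. 0 \<le> g p" "0 < \<epsilon>"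
    "\<And>p. g p \<noteq> 0 \<Longrightarrow> ennreal \<epsilon> \<le> fst p \<or> ennreal \<epsilon> \<le> snd p"
    "\<And>p. p \<in> punctured_quadrant \<Longrightarrow> g p = f p" "g (0, 0) = 0"
    using test_function_extension[OF f(1) _ K(1,2)] f(2) K(3) by metis
  have [measurable]: "g \<in> borel_measurable borel" by (rule borel_measurable_continuous_onI[OF g(1)])
  have "(\<integral>\<^sup>+ p. ennreal (f p) \<partial>V) = (\<integral>\<^sup>+ p. ennreal (g p) \<partial>V)"
    by (intro nn_integral_cong) (simp add: V g(5))
  moreover have "(\<integral>\<^sup>+ p. ennreal (f p) \<partial>scaled_law M X Y t t' h)
      = ennreal h * (\<integral>\<^sup>+ \<omega>. ennreal (g (scaled_lattice t t' 0 0 h (X \<omega>, Y \<omega>))) \<partial>M)" for h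
  proof -
    have "(\<integral>\<^sup>+ p. ennreal (f p) \<partial>scaled_law M X Y t t' h) = (\<integral>\<^sup>+ p. ennreal (g p) \<partial>scaled_law M X Y t t' h)"
      by (intro nn_integral_cong) (simp add: scaled_law_def space_scale_measure space_restrict_space g(5))
    also have "\<dots> = ennreal h * (\<integral>\<^sup>+ \<omega>. ennreal (g (scaled_lattice t t' 0 0 h (X \<omega>, Y \<omega>))) \<partial>M)"
      using g(6) by (intro nn_integral_scaled_law X Y) auto
    finally show ?thesis .
  qed
  ultimately show "((\<lambda>h. \<integral>\<^sup>+ p. ennreal (f p) \<partial>scaled_law M X Y t t' h) \<longlongrightarrow> (\<integral>\<^sup>+ p. ennreal (f p) \<partial>V)) at_top"
    using lim[OF g(1-4)] by simp
qed

lemma space_limit_measure: "space (limit_measure c a r s) = punctured_quadrant"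
  unfolding limit_measure_def by (simp add: space_restrict_space)

text \<open>
  At fixed \<open>h\<close> the integral of \<open>exp (- m x - n y)\<close> against the rescaled law is a value of the generating
  function in the unit square, so the law may be exchanged for the mixture \<open>yule_pmf\<close>.
\<close>

proposition vague_convergence_by_pgf:
  assumes pos: "0 < c" "0 < a" "0 < r" "0 < s"
    and M: "prob_space M" and X[measurable]: "X \<in> measurable M (count_space UNIV)" and Y[measurable]: "Y \<in> measurable M (count_space UNIV)"
    and pgf: "has_joint_pgf M X Y (\<lambda>x y. inverse c * (LBINT z:{1<..}. z powr (- (1 + 1 / c))
        * (x + (1 - x) * z) powr (- r) * (y + (1 - y) * z powr a) powr (- s)))"
  shows "vague_convergence punctured_quadrant (scaled_law M X Y c (a * c)) (limit_measure c a r s) at_top"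
proof (rule vague_convergenceI[OF X Y _ space_limit_measure])
  interpret prob_space M by fact
  fix f :: "ennreal \<times> ennreal \<Rightarrow> real" and \<epsilon>
  assume f: "continuous_on UNIV f" "\<And>p. 0 \<le> f p" "0 < \<epsilon>"
    "\<And>p. f p \<noteq> 0 \<Longrightarrow> ennreal \<epsilon> \<le> fst p \<or> ennreal \<epsilon> \<le> snd p"
  have "(\<integral>\<^sup>+ \<omega>. ennreal (f (scaled_lattice c (a * c) 0 0 h (X \<omega>, Y \<omega>))) \<partial>M)
    = (\<integral>\<^sup>+ p. ennreal (f (scaled_lattice c (a * c) 0 0 h p)) \<partial>yule_pmf c a r s)" for h
  proof -
    let ?S = "scaled_lattice c (a * c) 0 0 h"
    let ?P = "distr M borel (\<lambda>\<omega>. ?S (X \<omega>, Y \<omega>))" and ?Q = "distr (yule_pmf c a r s) borel ?S"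
    have S[measurable]: "(\<lambda>\<omega>. ?S (X \<omega>, Y \<omega>)) \<in> M \<rightarrow>\<^sub>M borel"
      unfolding scaled_lattice_def borel_prod[symmetric] by measurable
    have "(\<integral>\<^sup>+ p. ennreal (f p) \<partial>?P) = (\<integral>\<^sup>+ p. ennreal (f p) \<partial>?Q)"
    proof (rule nn_integral_eq_by_exp_monoms[OF _ _ _ _ _ f(1,2)])
      show "prob_space ?P" by (rule prob_space_distr[OF S])
      show "prob_space ?Q" by (rule measure_pmf.prob_space_distr) simp
      fix m n :: nat
      define x where "x = exp (- (real m * h powr (- c)))"
      define y where "y = exp (- (real n * h powr (- (a * c))))"
      have xy: "0 \<le> x" "x \<le> 1" "0 \<le> y" "y \<le> 1" by (auto simp: x_def y_def)
      have mono: "exp_monom m n (?S p) = x ^ fst p * y ^ snd p" for p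
        using exp_monom_scaled_lattice[of c "a * c" 0 0 h "fst p" "snd p" m n] by (simp add: x_def y_def)
      have [measurable]: "exp_monom m n \<in> borel_measurable borel"
        by (rule borel_measurable_continuous_onI[OF exp_polys_continuous[OF exp_polys.monom]])
      have "(\<integral>\<^sup>+ p. ennreal (exp_monom m n p) \<partial>?P) = (\<integral>\<^sup>+ \<omega>. ennreal (x ^ X \<omega> * y ^ Y \<omega>) \<partial>M)"
        by (subst nn_integral_distr) (simp_all add: mono)
      also have "\<dots> = ennreal (LINT \<omega>|M. x ^ X \<omega> * y ^ Y \<omega>)"
        using xy by (intro nn_integral_eq_integral integrable_const_bound[of _ 1])
          (auto simp: mult_le_one power_le_one)
      also have "\<dots> = (\<integral>\<^sup>+ p. ennreal (x ^ fst p * y ^ snd p) \<partial>yule_pmf c a r s)"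
        using pgf xy unfolding yule_pgf[OF pos xy] has_joint_pgf_def by simp
      also have "\<dots> = (\<integral>\<^sup>+ p. ennreal (exp_monom m n p) \<partial>?Q)"
        by (subst nn_integral_distr) (simp_all add: mono)
      finally show "(\<integral>\<^sup>+ p. ennreal (exp_monom m n p) \<partial>?P) = (\<integral>\<^sup>+ p. ennreal (exp_monom m n p) \<partial>?Q)" .
    qed simp_all
    moreover have [measurable]: "f \<in> borel_measurable borel" by (rule borel_measurable_continuous_onI[OF f(1)])
    ultimately show ?thesis by (simp add: nn_integral_distr)
  qed
  then show "((\<lambda>h. ennreal h * (\<integral>\<^sup>+ \<omega>. ennreal (f (scaled_lattice c (a * c) 0 0 h (X \<omega>, Y \<omega>))) \<partial>M))
         \<longlongrightarrow> (\<integral>\<^sup>+ p. ennreal (f p) \<partial>limit_measure c a r s)) at_top"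
    using yule_vague_limit(1)[OF pos f(3,1,2,4), where d = 0 and e = 0] by simp
qed

lemma nn_integral_add_measure:
  assumes sets: "sets \<mu> = sets \<nu>" and g: "g \<in> borel_measurable \<mu>"
  shows "(\<integral>\<^sup>+ x. g x \<partial>add_measure \<mu> \<nu>) = (\<integral>\<^sup>+ x. g x \<partial>\<mu>) + (\<integral>\<^sup>+ x. g x \<partial>\<nu>)"
proof -
  have sets_add: "sets (add_measure \<mu> \<nu>) = sets \<mu>"
    unfolding add_measure_def by (simp add: sets.sets_measure_of_eq)
  have emeasure_add: "emeasure (add_measure \<mu> \<nu>) A = emeasure \<mu> A + emeasure \<nu> A" if "A \<in> sets \<mu>" for A
  proof (rule emeasure_measure_of[OF add_measure_def])
    show "countably_additive (sets (add_measure \<mu> \<nu>)) (\<lambda>A. emeasure \<mu> A + emeasure \<nu> A)"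
      unfolding sets_add
    proof (rule countably_additiveI)
      fix A :: "nat \<Rightarrow> _" assume A: "range A \<subseteq> sets \<mu>" "disjoint_family A"
      then have "(\<Sum>i. emeasure \<mu> (A i)) = emeasure \<mu> (\<Union>i. A i)" "(\<Sum>i. emeasure \<nu> (A i)) = emeasure \<nu> (\<Union>i. A i)"
        using sets by (auto intro!: suminf_emeasure)
      then show "(\<Sum>i. emeasure \<mu> (A i) + emeasure \<nu> (A i)) = emeasure \<mu> (\<Union>i. A i) + emeasure \<nu> (\<Union>i. A i)"
        by (simp add: suminf_add[symmetric])
    qed
  qed (use that sets.space_closed in \<open>auto simp: positive_def sets_add\<close>)
  show ?thesis using g
  proof (induction rule: borel_measurable_induct)
    case (cong f g)
    have "space (add_measure \<mu> \<nu>) = space \<mu>" "space \<nu> = space \<mu>"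
      using sets_eq_imp_space_eq[OF sets_add] sets_eq_imp_space_eq[OF sets] by simp_all
    then have "integral\<^sup>N (add_measure \<mu> \<nu>) f = integral\<^sup>N (add_measure \<mu> \<nu>) g"
      "integral\<^sup>N \<mu> f = integral\<^sup>N \<mu> g" "integral\<^sup>N \<nu> f = integral\<^sup>N \<nu> g"
      using cong(3) by (auto intro!: nn_integral_cong)
    then show ?case using cong(4) by simp
  next
    case (set A)
    then show ?case using sets sets_add by (simp add: emeasure_add)
  next
    case (mult u c)
    then show ?case using sets sets_add
      by (simp add: nn_integral_cmult distrib_left cong: measurable_cong_sets)
  next
    case (add u v)
    then show ?case using sets sets_add
      by (simp add: nn_integral_add ac_simps cong: measurable_cong_sets)
  next
    case (seq U)
    have meas: "U i \<in> borel_measurable \<mu>" "U i \<in> borel_measurable \<nu>" "U i \<in> borel_measurable (add_measure \<mu> \<nu>)" for i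
      using seq(1) sets sets_add by (simp_all cong: measurable_cong_sets)
    have inc: "incseq (\<lambda>i. integral\<^sup>N N (U i))" for N
      using \<open>incseq U\<close> by (auto simp: incseq_def le_fun_def intro!: nn_integral_mono)
    have "(\<integral>\<^sup>+ x. (SUP i. U i) x \<partial>N) = (SUP i. integral\<^sup>N N (U i))" if "\<And>i. U i \<in> borel_measurable N" for N
    proof -
      have "(SUP i. U i) = (\<lambda>x. SUP i. U i x)" by (rule ext) (simp add: Sup_apply image_image)
      then show ?thesis using nn_integral_monotone_convergence_SUP[OF \<open>incseq U\<close> that] by simp
    qed
    then show ?case using meas seq.IH inc
      by (simp add: ennreal_SUP_add)
  qed
qed

lemma nn_integral_joint_pmf:
  assumes "prob_space Q" and I: "I \<in> measurable Q (count_space UNIV)" and J: "J \<in> measurable Q (count_space UNIV)"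
    and "has_joint_pmf Q I J p"
  shows "(\<integral>\<^sup>+ \<omega>. g (I \<omega>, J \<omega>) \<partial>Q) = (\<integral>\<^sup>+ q. ennreal (p (fst q) (snd q)) * g q \<partial>count_space UNIV)"
proof -
  interpret prob_space Q by fact
  have IJ: "(\<lambda>\<omega>. (I \<omega>, J \<omega>)) \<in> Q \<rightarrow>\<^sub>M count_space UNIV"
    using I J measurable_Pair[OF I J] by (simp add: pair_measure_countable)
  have "distr Q (count_space UNIV) (\<lambda>\<omega>. (I \<omega>, J \<omega>)) = density (count_space UNIV) (\<lambda>q. ennreal (p (fst q) (snd q)))"
  proof (rule measure_eqI_countable[where A = UNIV])
    fix q :: "nat \<times> nat"
    have "(\<lambda>\<omega>. (I \<omega>, J \<omega>)) -` {q} \<inter> space Q = {\<omega> \<in> space Q. I \<omega> = fst q \<and> J \<omega> = snd q}" by auto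
    then show "emeasure (distr Q (count_space UNIV) (\<lambda>\<omega>. (I \<omega>, J \<omega>))) {q}
       = emeasure (density (count_space UNIV) (\<lambda>q. ennreal (p (fst q) (snd q)))) {q}"
      using assms(4) IJ by (simp add: emeasure_distr emeasure_density emeasure_eq_measure has_joint_pmf_def)
  qed simp_all
  then have "(\<integral>\<^sup>+ q. g q \<partial>distr Q (count_space UNIV) (\<lambda>\<omega>. (I \<omega>, J \<omega>)))
     = (\<integral>\<^sup>+ q. g q \<partial>density (count_space UNIV) (\<lambda>q. ennreal (p (fst q) (snd q))))" by simp
  then show ?thesis using IJ by (simp add: nn_integral_distr nn_integral_density)
qed

text \<open>
  The two components carry an extra 1 in the first and in the second coordinate respectively.
\<close>

proposition vague_convergence_mixture:
  assumes pos: "0 < c" "0 < a" "0 < \<delta>" "0 < \<delta>'" and w: "0 \<le> u" "0 \<le> u'"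
    and Q: "prob_space Q" and I: "I \<in> measurable Q (count_space UNIV)" and J: "J \<in> measurable Q (count_space UNIV)"
    and pmf: "has_joint_pmf Q I J p"
    and p: "\<And>i j. p i j = u * pmf (map_pmf (\<lambda>q. (Suc (fst q), snd q)) (yule_pmf c a (\<delta> + 1) \<delta>')) (i, j)
        + u' * pmf (map_pmf (\<lambda>q. (fst q, Suc (snd q))) (yule_pmf c a \<delta> (\<delta>' + 1))) (i, j)"
  shows "vague_convergence punctured_quadrant (scaled_law Q I J c (a * c))
     (add_measure (scale_measure (ennreal u) (limit_measure c a (\<delta> + 1) \<delta>'))
        (scale_measure (ennreal u') (limit_measure c a \<delta> (\<delta>' + 1)))) at_top" (is "vague_convergence _ _ ?V _")
proof (rule vague_convergenceI[OF I J])
  let ?V1 = "limit_measure c a (\<delta> + 1) \<delta>'" and ?V2 = "limit_measure c a \<delta> (\<delta>' + 1)"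
  have sets: "sets ?V1 = sets (restrict_space borel punctured_quadrant)" "sets ?V2 = sets (restrict_space borel punctured_quadrant)"
    unfolding limit_measure_def by (simp_all cong: sets_restrict_space_cong)
  have "space ?V = space ?V1" unfolding add_measure_def
    by (simp add: space_measure_of_conv space_scale_measure)
  then show "space ?V = punctured_quadrant" by (simp add: space_limit_measure)
  fix f :: "ennreal \<times> ennreal \<Rightarrow> real" and \<epsilon>
  assume f: "continuous_on UNIV f" "\<And>p. 0 \<le> f p" "0 < \<epsilon>"
    "\<And>p. f p \<noteq> 0 \<Longrightarrow> ennreal \<epsilon> \<le> fst p \<or> ennreal \<epsilon> \<le> snd p"
  have f_meas: "(\<lambda>p. ennreal (f p)) \<in> borel_measurable borel"
    using borel_measurable_continuous_onI[OF f(1)] by simp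
  then have f_V: "(\<lambda>p. ennreal (f p)) \<in> borel_measurable ?V1" "(\<lambda>p. ennreal (f p)) \<in> borel_measurable ?V2"
    using measurable_restrict_space1[OF f_meas, of punctured_quadrant] sets by (simp_all cong: measurable_cong_sets)
  have V: "(\<integral>\<^sup>+ p. ennreal (f p) \<partial>?V) = ennreal u * (\<integral>\<^sup>+ p. ennreal (f p) \<partial>?V1) + ennreal u' * (\<integral>\<^sup>+ p. ennreal (f p) \<partial>?V2)"
    using f_V sets by (simp add: nn_integral_add_measure nn_integral_scale_measure)
  have law: "(\<integral>\<^sup>+ \<omega>. ennreal (f (scaled_lattice c (a * c) 0 0 h (I \<omega>, J \<omega>))) \<partial>Q)
    = ennreal u * (\<integral>\<^sup>+ q. ennreal (f (scaled_lattice c (a * c) 1 0 h q)) \<partial>yule_pmf c a (\<delta> + 1) \<delta>')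
     + ennreal u' * (\<integral>\<^sup>+ q. ennreal (f (scaled_lattice c (a * c) 0 1 h q)) \<partial>yule_pmf c a \<delta> (\<delta>' + 1))" for h
  proof -
    let ?m1 = "map_pmf (\<lambda>q. (Suc (fst q), snd q)) (yule_pmf c a (\<delta> + 1) \<delta>')"
    let ?m2 = "map_pmf (\<lambda>q. (fst q, Suc (snd q))) (yule_pmf c a \<delta> (\<delta>' + 1))"
    let ?g = "\<lambda>q. ennreal (f (scaled_lattice c (a * c) 0 0 h q))"
    have "(\<integral>\<^sup>+ \<omega>. ?g (I \<omega>, J \<omega>) \<partial>Q) = (\<integral>\<^sup>+ q. ennreal u * (ennreal (pmf ?m1 q) * ?g q) + ennreal u' * (ennreal (pmf ?m2 q) * ?g q) \<partial>count_space UNIV)"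
      unfolding nn_integral_joint_pmf[OF Q I J pmf, of ?g] using w
      by (intro nn_integral_cong) (simp add: p ennreal_mult distrib_right mult.assoc)
    also have "\<dots> = ennreal u * (\<integral>\<^sup>+ q. ?g q \<partial>?m1) + ennreal u' * (\<integral>\<^sup>+ q. ?g q \<partial>?m2)"
      by (simp add: nn_integral_add nn_integral_cmult nn_integral_measure_pmf del: nn_integral_map_pmf)
    also have "(\<integral>\<^sup>+ q. ?g q \<partial>?m1) = (\<integral>\<^sup>+ q. ennreal (f (scaled_lattice c (a * c) 1 0 h q)) \<partial>yule_pmf c a (\<delta> + 1) \<delta>')"
      by (simp add: scaled_lattice_def)
    also have "(\<integral>\<^sup>+ q. ?g q \<partial>?m2) = (\<integral>\<^sup>+ q. ennreal (f (scaled_lattice c (a * c) 0 1 h q)) \<partial>yule_pmf c a \<delta> (\<delta>' + 1))"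
      by (simp add: scaled_lattice_def)
    finally show ?thesis .
  qed
  have 1: "((\<lambda>h. ennreal h * (\<integral>\<^sup>+ p. ennreal (f (scaled_lattice c (a * c) 1 0 h p)) \<partial>yule_pmf c a (\<delta> + 1) \<delta>'))
      \<longlongrightarrow> (\<integral>\<^sup>+ p. ennreal (f p) \<partial>?V1)) at_top"
    using pos f by (intro yule_vague_limit(1)[of _ _ _ _ \<epsilon>]) auto
  have 2: "((\<lambda>h. ennreal h * (\<integral>\<^sup>+ p. ennreal (f (scaled_lattice c (a * c) 0 1 h p)) \<partial>yule_pmf c a \<delta> (\<delta>' + 1)))
      \<longlongrightarrow> (\<integral>\<^sup>+ p. ennreal (f p) \<partial>?V2)) at_top"
    using pos f by (intro yule_vague_limit(1)[of _ _ _ _ \<epsilon>]) auto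
  show "((\<lambda>h. ennreal h * (\<integral>\<^sup>+ \<omega>. ennreal (f (scaled_lattice c (a * c) 0 0 h (I \<omega>, J \<omega>))) \<partial>Q)) \<longlongrightarrow> (\<integral>\<^sup>+ p. ennreal (f p) \<partial>?V)) at_top"
    unfolding V law
    using tendsto_add[OF ennreal_tendsto_cmult[OF _ 1, of "ennreal u"] ennreal_tendsto_cmult[OF _ 2, of "ennreal u'"]]
    by (simp add: distrib_left mult.left_commute)
qed


section \<open>A recursion for the Pareto mixture\<close>

text \<open>
  Lets the recursions below hold for degree 0 without a separate case.
\<close>

definition prev :: "(nat \<Rightarrow> real) \<Rightarrow> nat \<Rightarrow> real" where
  "prev f i = (case i of 0 \<Rightarrow> 0 | Suc k \<Rightarrow> f k)"

lemma prev_simps[simp]: "prev f 0 = 0" "prev f (Suc k) = f k"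
  by (simp_all add: prev_def)

lemma negbin_mass_at_1: "negbin_mass r 1 i = of_bool (i = 0)"
  by (simp add: negbin_mass_def power_0_left)

text \<open>
  The Kolmogorov forward equation of a Yule process in the time variable \<open>ln z\<close>: state \<open>i\<close> is left at
  rate \<open>r + i\<close> and entered from \<open>i - 1\<close> at rate \<open>r + i - 1\<close>.
\<close>

lemma DERIV_negbin_mass:
  assumes z: "0 < z"
  shows "((\<lambda>z. negbin_mass r z i) has_real_derivative ((r + real i - 1) * prev (negbin_mass r z) i - (r + real i) * negbin_mass r z i) / z) (at z)"
proof (cases i)
  case 0
  show ?thesis using z unfolding negbin_mass_def 0
    by (auto intro!: derivative_eq_intros simp: powr_diff powr_minus field_simps)
next
  case (Suc k)
  define u where "u = 1 - 1 / z"
  define P where "P = pochhammer r k / fact k"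
  have P: "pochhammer r i / fact i * real i = P * (r + real k)"
    unfolding Suc P_def pochhammer_Suc by simp
  have "((\<lambda>z. negbin_mass r z i) has_real_derivative
      pochhammer r i / fact i * ((- r * z powr (- r - 1)) * u ^ i + z powr (- r) * (real i * u ^ k * (1 / z\<^sup>2)))) (at z)"
  proof -
    have "((\<lambda>z. 1 - 1 / z) has_real_derivative 1 / z\<^sup>2) (at z)"
      using z by (auto intro!: derivative_eq_intros simp: power2_eq_square)
    from DERIV_power[OF this, of i]
    have "((\<lambda>z. (1 - 1 / z) ^ i) has_real_derivative real i * u ^ k * (1 / z\<^sup>2)) (at z)"
      by (simp add: u_def Suc)
    moreover have "((\<lambda>z. z powr (- r)) has_real_derivative - r * z powr (- r - 1)) (at z)"
      using z by (auto intro!: derivative_eq_intros)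
    ultimately have "((\<lambda>z. z powr (- r) * (1 - 1 / z) ^ i) has_real_derivative
        (- r * z powr (- r - 1)) * (1 - 1 / z) ^ i + real i * u ^ k * (1 / z\<^sup>2) * z powr (- r)) (at z)"
      by (intro DERIV_mult)
    from DERIV_cmult[OF this, of "pochhammer r i / fact i"]
    show ?thesis unfolding negbin_mass_def u_def[symmetric] by (simp only: mult.assoc mult.commute[of _ "z powr (- r)"])
  qed
  moreover have "pochhammer r i / fact i * ((- r * z powr (- r - 1)) * u ^ i + z powr (- r) * (real i * u ^ k * (1 / z\<^sup>2)))
    = ((r + real i - 1) * prev (negbin_mass r z) i - (r + real i) * negbin_mass r z i) / z"
  proof -
    define A where "A = pochhammer r i / fact i"
    have A: "P * (r + real k) = A * real i" using P by (simp add: A_def)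
    have nbi: "negbin_mass r z i = A * z powr (- r) * u ^ k * u" by (simp add: negbin_mass_def A_def u_def Suc mult_ac)
    have nbk: "(r + real i - 1) * prev (negbin_mass r z) i = A * real i * z powr (- r) * u ^ k"
    proof -
      have "(r + real i - 1) * prev (negbin_mass r z) i = (P * (r + real k)) * z powr (- r) * u ^ k"
        by (simp add: negbin_mass_def P_def u_def Suc mult_ac)
      then show ?thesis unfolding A .
    qed
    have pw: "z powr (- r - 1) = z powr (- r) / z" using z by (simp add: powr_diff)
    have iz: "1 / z\<^sup>2 = (1 - u) / z" using z by (simp add: u_def power2_eq_square)
    have "A * ((- r * z powr (- r - 1)) * u ^ i + z powr (- r) * (real i * u ^ k * (1 / z\<^sup>2)))
      = A * ((- r * (z powr (- r) / z)) * (u ^ k * u) + z powr (- r) * (real i * u ^ k * ((1 - u) / z)))"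
      unfolding pw iz Suc by (simp add: mult_ac)
    also have "\<dots> = (A * real i * z powr (- r) * u ^ k - (r + real i) * (A * z powr (- r) * u ^ k * u)) / z"
      using z by (simp add: field_simps)
    finally show ?thesis unfolding A_def[symmetric] nbk nbi .
  qed
  ultimately show ?thesis by simp
qed

context
  fixes c a r s :: real
  assumes pos: "0 < c" "0 < a" "0 < r" "0 < s"
begin

text \<open>
  Integration by parts.  The Pareto density is minus the derivative of \<open>z\<^bsup>-1/c\<^esup>\<close>, so the derivative falls
  on the negative binomial masses and produces the forward equation; the boundary term at \<open>z = 1\<close>,
  where both variables are 0, is the indicator, and the one at infinity vanishes.
\<close>

lemma yule_pmf_recursion:
  fixes i j :: nat
  defines "q \<equiv> \<lambda>i j. pmf (yule_pmf c a r s) (i, j)"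
  shows "q i j = of_bool (i = 0 \<and> j = 0)
     + c * ((r + real i - 1) * prev (\<lambda>k. q k j) i - (r + real i) * q i j)
     + a * c * ((s + real j - 1) * prev (\<lambda>k. q i k) j - (s + real j) * q i j)"
proof -
  define T where "T i j z = pareto_density c z * (negbin_mass r z i * negbin_mass s (z powr a) j)" for i j z
  have q: "q i j = (LBINT z:{1<..}. T i j z)" for i j
    unfolding q_def T_def by (rule pmf_yule[OF pos])
  have T_int: "set_integrable lborel {1<..} (T i j)" for i j
    unfolding T_def by (rule set_integrable_yule[OF pos])
  have T_cont: "isCont (T i j) z" if "1 < z" for i j z
    using that unfolding T_def pareto_density_def negbin_mass_def by (intro continuous_intros) auto
  define Tp where "Tp i j z = prev (\<lambda>k. T k j z) i" for i j z
  define Tq where "Tq i j z = prev (\<lambda>k. T i k z) j" for i j z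
  have Tp: "set_integrable lborel {1<..} (Tp i j)" "1 < z \<Longrightarrow> isCont (Tp i j) z" "(LBINT z:{1<..}. Tp i j z) = prev (\<lambda>k. q k j) i" for i j z
    using T_int T_cont q by (cases i; simp add: Tp_def[abs_def] set_integrable_def set_lebesgue_integral_def)+
  have Tq: "set_integrable lborel {1<..} (Tq i j)" "1 < z \<Longrightarrow> isCont (Tq i j) z" "(LBINT z:{1<..}. Tq i j z) = prev (\<lambda>k. q i k) j" for i j z
    using T_int T_cont q by (cases j; simp add: Tq_def[abs_def] set_integrable_def set_lebesgue_integral_def)+
  \<comment> \<open>the antiderivative: vanishes at infinity, equals the indicator at 1\<close>
  define G where "G z = z powr (- 1 / c) * (negbin_mass r z i * negbin_mass s (z powr a) j)" for z
  define g where "g z = c * ((r + real i - 1) * Tp i j z - (r + real i) * T i j z)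
      + a * c * ((s + real j - 1) * Tq i j z - (s + real j) * T i j z) - T i j z" for z
  have G': "(G has_real_derivative g z) (at z)" if z: "0 < z" for z
  proof -
    let ?A = "(r + real i - 1) * prev (negbin_mass r z) i - (r + real i) * negbin_mass r z i"
    let ?B = "(s + real j - 1) * prev (negbin_mass s (z powr a)) j - (s + real j) * negbin_mass s (z powr a) j"
    have za: "0 < z powr a" using z by simp
    have "((\<lambda>z. negbin_mass s (z powr a) j) has_real_derivative ?B / (z powr a) * (a * z powr (a - 1))) (at z)"
      by (rule DERIV_chain2[where g = "\<lambda>z. z powr a" and f = "\<lambda>z. negbin_mass s z j" and x = z, OF DERIV_negbin_mass[OF za]])
        (use z in \<open>auto intro!: derivative_eq_intros\<close>)
    moreover have "?B / (z powr a) * (a * z powr (a - 1)) = a * ?B / z" using z by (simp add: powr_diff field_simps)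
    ultimately have B: "((\<lambda>z. negbin_mass s (z powr a) j) has_real_derivative a * ?B / z) (at z)" by simp
    have P: "((\<lambda>z. z powr (- 1 / c)) has_real_derivative (- 1 / c) * z powr (- 1 / c - 1)) (at z)"
      using z by (auto intro!: derivative_eq_intros)
    have pw: "z powr (- 1 / c - 1) = c * pareto_density c z" "z powr (- 1 / c) / z = c * pareto_density c z"
      using pos z by (simp_all add: pareto_density_def powr_diff powr_minus_divide powr_add)
    have "(G has_real_derivative (- 1 / c) * z powr (- 1 / c - 1) * (negbin_mass r z i * negbin_mass s (z powr a) j)
       + (?A / z * negbin_mass s (z powr a) j + a * ?B / z * negbin_mass r z i) * z powr (- 1 / c)) (at z)"
      unfolding G_def by (rule DERIV_mult[OF P DERIV_mult[OF DERIV_negbin_mass[OF z] B]])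
    also have "(- 1 / c) * z powr (- 1 / c - 1) * (negbin_mass r z i * negbin_mass s (z powr a) j)
       + (?A / z * negbin_mass s (z powr a) j + a * ?B / z * negbin_mass r z i) * z powr (- 1 / c)
      = (- 1 / c) * z powr (- 1 / c - 1) * (negbin_mass r z i * negbin_mass s (z powr a) j)
       + (?A * negbin_mass s (z powr a) j + a * ?B * negbin_mass r z i) * (z powr (- 1 / c) / z)"
    proof -
      have "(A / z * X + a * B / z * Y) * W = (A * X + a * B * Y) * (W / z)" for A B X Y W
        using z by (simp add: field_simps)
      then show ?thesis by simp
    qed
    also have "\<dots> = g z"
    proof -
      have tp: "Tp i j z = pareto_density c z * (prev (negbin_mass r z) i * negbin_mass s (z powr a) j)"
        by (cases i) (simp_all add: Tp_def T_def)
      have tq: "Tq i j z = pareto_density c z * (negbin_mass r z i * prev (negbin_mass s (z powr a)) j)"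
        by (cases j) (simp_all add: Tq_def T_def)
      show ?thesis unfolding pw g_def tp tq T_def using pos by (simp add: algebra_simps)
    qed
    finally show ?thesis .
  qed
  have g_int: "set_integrable lborel {1<..} g"
    unfolding g_def using T_int Tp(1) Tq(1)
    by (intro set_integral_add(1) set_integral_diff(1) set_integrable_mult_right)
  have "(LBINT z=ereal 1..\<infinity>. g z) = 0 - G 1"
  proof (rule interval_integral_FTC_integrable)
    show "(G has_vector_derivative g x) (at x)" if "ereal 1 < ereal x" for x
      using G'[of x] that by (simp add: has_real_derivative_iff_has_vector_derivative)
    show "isCont g x" if "ereal 1 < ereal x" for x
      unfolding g_def using that T_cont Tp(2) Tq(2) by (intro continuous_intros) auto
    have "einterval (ereal 1) \<infinity> = {1<..}" by (auto simp: einterval_def)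
    then show "set_integrable lborel (einterval (ereal 1) \<infinity>) g" using g_int by simp
    have "isCont G 1" using G'[of 1] DERIV_isCont by auto
    then have "(G \<longlongrightarrow> G 1) (at_right 1)" by (simp add: isCont_def filterlim_at_split)
    then show "((G \<circ> real_of_ereal) \<longlongrightarrow> G 1) (at_right (ereal 1))"
      unfolding ereal_tendsto_simps .
    have "(G \<longlongrightarrow> 0) at_top"
    proof (rule tendsto_sandwich)
      show "\<forall>\<^sub>F z in at_top. 0 \<le> G z" "\<forall>\<^sub>F z in at_top. G z \<le> z powr (- 1 / c)"
      proof -
        have "0 \<le> G z \<and> G z \<le> z powr (- 1 / c)" if "1 \<le> z" for z
        proof -
          have "1 \<le> z powr a" using that pos by (simp add: ge_one_powr_ge_zero)
          then have "negbin_mass r z i * negbin_mass s (z powr a) j \<le> 1 * 1"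
            using that pos by (intro mult_mono negbin_mass_le_1 negbin_mass_nonneg) auto
          moreover have "0 \<le> negbin_mass r z i * negbin_mass s (z powr a) j"
            using \<open>1 \<le> z powr a\<close> that pos by (intro mult_nonneg_nonneg negbin_mass_nonneg) auto
          ultimately show ?thesis by (auto simp: G_def intro!: mult_left_le)
        qed
        then show "\<forall>\<^sub>F z in at_top. 0 \<le> G z" "\<forall>\<^sub>F z in at_top. G z \<le> z powr (- 1 / c)"
          by (auto intro: eventually_mono[OF eventually_ge_at_top[of 1]])
      qed
      show "((\<lambda>z. z powr (- 1 / c)) \<longlongrightarrow> 0) at_top"
        using pos by (intro tendsto_neg_powr filterlim_ident) simp
    qed simp
    then show "((G \<circ> real_of_ereal) \<longlongrightarrow> 0) (at_left \<infinity>)"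
      unfolding ereal_tendsto_simps .
  qed simp
  also have "(LBINT z=ereal 1..\<infinity>. g z) = (LBINT z:{1<..}. g z)"
    by (rule interval_integral_to_infinity_eq)
  also have "(LBINT z:{1<..}. g z) = c * ((r + real i - 1) * prev (\<lambda>k. q k j) i - (r + real i) * q i j)
      + a * c * ((s + real j - 1) * prev (\<lambda>k. q i k) j - (s + real j) * q i j) - q i j"
    unfolding g_def using T_int Tp(1) Tq(1)
    by (simp add: set_integral_add set_integral_diff set_integrable_mult_right q Tp(3) Tq(3))
  also have "G 1 = of_bool (i = 0 \<and> j = 0)" by (simp add: G_def negbin_mass_at_1)
  finally show ?thesis by simp
qed

end


section \<open>The attachment chain\<close>

lemma new_node_fresh: "finite (verts G) \<Longrightarrow> new_node G \<notin> verts G"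
  unfolding new_node_def by (rule LeastI_ex) (rule ex_new_if_finite[OF infinite_UNIV_nat])

lemma fresh_arc: "finite (arcs G) \<Longrightarrow> (LEAST e. e \<notin> arcs G) \<notin> arcs (G :: pa_graph)"
  by (rule LeastI_ex) (rule ex_new_if_finite[OF infinite_UNIV_nat])

lemma verts_add_edge: "verts (add_edge v w G) = verts G \<union> {v, w}"
  by (simp add: add_edge_def Let_def)

lemma fin_digraph_add_edge:
  assumes "fin_digraph G"
  shows "fin_digraph (add_edge v w G)"
proof -
  interpret fin_digraph G by fact
  show ?thesis by unfold_locales (auto simp: add_edge_def Let_def)
qed

lemma card_arcs_add_edge:
  assumes "fin_digraph G"
  shows "card (arcs (add_edge v w G)) = Suc (card (arcs G))"
proof -
  interpret fin_digraph G by fact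
  show ?thesis using fresh_arc[OF finite_arcs] by (simp add: add_edge_def Let_def)
qed

lemma degree_add_edge:
  assumes "fin_digraph G"
  shows "in_degree (add_edge v w G) x = in_degree G x + of_bool (x = w)"
    and "out_degree (add_edge v w G) x = out_degree G x + of_bool (x = v)"
proof -
  interpret fin_digraph G by fact
  define e where "e = (LEAST e. e \<notin> arcs G)"
  have e: "e \<notin> arcs G" unfolding e_def by (rule fresh_arc[OF finite_arcs])
  have "in_arcs (add_edge v w G) x = (if x = w then insert e (in_arcs G x) else in_arcs G x)"
    using e by (auto simp: in_arcs_def add_edge_def Let_def e_def[symmetric])
  then show "in_degree (add_edge v w G) x = in_degree G x + of_bool (x = w)"
    using e by (simp add: in_degree_def finite_in_arcs)
  have "out_arcs (add_edge v w G) x = (if x = v then insert e (out_arcs G x) else out_arcs G x)"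
    using e by (auto simp: out_arcs_def add_edge_def Let_def e_def[symmetric])
  then show "out_degree (add_edge v w G) x = out_degree G x + of_bool (x = v)"
    using e by (simp add: out_degree_def finite_out_arcs)
qed

lemma degree_outside:
  assumes "fin_digraph G" "x \<notin> verts G"
  shows "in_degree G x = 0" "out_degree G x = 0"
proof -
  interpret fin_digraph G by fact
  have "in_arcs G x = {}" "out_arcs G x = {}" using assms(2) by (auto simp: in_arcs_def out_arcs_def)
  then show "in_degree G x = 0" "out_degree G x = 0" by (simp_all add: in_degree_def out_degree_def)
qed

lemma sum_degrees:
  assumes "fin_digraph G"
  shows "(\<Sum>x\<in>verts G. in_degree G x) = card (arcs G)" "(\<Sum>x\<in>verts G. out_degree G x) = card (arcs G)"
proof -
  interpret fin_digraph G by fact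
  have "(\<Sum>x\<in>verts G. \<Sum>e\<in>{e. e \<in> arcs G \<and> head G e = x}. (1 :: nat)) = (\<Sum>e\<in>arcs G. 1)"
    by (rule sum.group) auto
  then show "(\<Sum>x\<in>verts G. in_degree G x) = card (arcs G)" by (simp add: in_degree_def in_arcs_def)
  have "(\<Sum>x\<in>verts G. \<Sum>e\<in>{e. e \<in> arcs G \<and> tail G e = x}. (1 :: nat)) = (\<Sum>e\<in>arcs G. 1)"
    by (rule sum.group) auto
  then show "(\<Sum>x\<in>verts G. out_degree G x) = card (arcs G)" by (simp add: out_degree_def out_arcs_def)
qed

text \<open>
  The degrees add up to the number of edges, so each choice rule is a probability distribution.
\<close>

lemma sum_choice:
  assumes "fin_digraph G" "verts G \<noteq> {}" "0 < \<delta>"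
  shows "(\<Sum>x\<in>verts G. in_choice \<delta> G x) = 1" "(\<Sum>x\<in>verts G. out_choice \<delta> G x) = 1"
proof -
  interpret fin_digraph G by fact
  have pos: "0 < real (card (arcs G)) + \<delta> * real (card (verts G))"
    using assms by (simp add: add_nonneg_pos card_gt_0_iff)
  have "(\<Sum>x\<in>verts G. real (in_degree G x) + \<delta>) = real (card (arcs G)) + \<delta> * real (card (verts G))"
    "(\<Sum>x\<in>verts G. real (out_degree G x) + \<delta>) = real (card (arcs G)) + \<delta> * real (card (verts G))"
    using sum_degrees[OF assms(1)] by (simp_all add: sum.distrib flip: of_nat_sum)
  then show "(\<Sum>x\<in>verts G. in_choice \<delta> G x) = 1" "(\<Sum>x\<in>verts G. out_choice \<delta> G x) = 1"
    using pos by (simp_all add: in_choice_def out_choice_def flip: sum_divide_distrib)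
qed

lemma choice_nonneg: "0 < \<delta> \<Longrightarrow> 0 \<le> in_choice \<delta> G x" "0 < \<delta> \<Longrightarrow> 0 \<le> out_choice \<delta> G x"
  by (simp_all add: in_choice_def out_choice_def)

definition successors :: "pa_graph \<Rightarrow> pa_graph set" where
  "successors G = (\<lambda>(v, w). add_edge v w G) ` (insert (new_node G) (verts G) \<times> insert (new_node G) (verts G))"

text \<open>
  The conditional expectation of \<open>F\<close> after one step from \<open>G\<close>.  As a sum over choices of nodes it is easier
  to evaluate than a sum over successor graphs.
\<close>

definition pa_step :: "real \<Rightarrow> real \<Rightarrow> real \<Rightarrow> real \<Rightarrow> real \<Rightarrow> pa_graph \<Rightarrow> (pa_graph \<Rightarrow> real) \<Rightarrow> real" where
  "pa_step \<alpha> \<beta> \<gamma> \<delta>\<^sub>i\<^sub>n \<delta>\<^sub>o\<^sub>u\<^sub>t G F =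
     \<alpha> * (\<Sum>w\<in>verts G. in_choice \<delta>\<^sub>i\<^sub>n G w * F (add_edge (new_node G) w G))
   + \<beta> * (\<Sum>v\<in>verts G. \<Sum>w\<in>verts G. out_choice \<delta>\<^sub>o\<^sub>u\<^sub>t G v * in_choice \<delta>\<^sub>i\<^sub>n G w * F (add_edge v w G))
   + \<gamma> * (\<Sum>v\<in>verts G. out_choice \<delta>\<^sub>o\<^sub>u\<^sub>t G v * F (add_edge v (new_node G) G))"

lemma sum_transition:
  assumes "finite T" "successors G \<subseteq> T"
  shows "(\<Sum>G'\<in>T. pa_transition \<alpha> \<beta> \<gamma> \<delta>\<^sub>i\<^sub>n \<delta>\<^sub>o\<^sub>u\<^sub>t G G' * F G') = pa_step \<alpha> \<beta> \<gamma> \<delta>\<^sub>i\<^sub>n \<delta>\<^sub>o\<^sub>u\<^sub>t G F"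
proof -
  have delta: "(\<Sum>G'\<in>T. c * of_bool (G' = H) * F G') = c * F H" if "H \<in> T" for c H
    using assms(1) that by (simp add: of_bool_def if_distrib[of "\<lambda>u. c * u * F _"] cong: if_cong)
  have T: "add_edge v w G \<in> T" if "v \<in> insert (new_node G) (verts G)" "w \<in> insert (new_node G) (verts G)" for v w
    using that assms(2) by (auto simp: successors_def)
  have a: "(\<Sum>G'\<in>T. (\<Sum>w\<in>verts G. in_choice \<delta>\<^sub>i\<^sub>n G w * of_bool (G' = add_edge (new_node G) w G)) * F G')
      = (\<Sum>w\<in>verts G. in_choice \<delta>\<^sub>i\<^sub>n G w * F (add_edge (new_node G) w G))"
    unfolding sum_distrib_right by (subst sum.swap) (intro sum.cong refl delta T; simp)
  have g: "(\<Sum>G'\<in>T. (\<Sum>v\<in>verts G. out_choice \<delta>\<^sub>o\<^sub>u\<^sub>t G v * of_bool (G' = add_edge v (new_node G) G)) * F G')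
      = (\<Sum>v\<in>verts G. out_choice \<delta>\<^sub>o\<^sub>u\<^sub>t G v * F (add_edge v (new_node G) G))"
    unfolding sum_distrib_right by (subst sum.swap) (intro sum.cong refl delta T; simp)
  have b: "(\<Sum>G'\<in>T. (\<Sum>v\<in>verts G. \<Sum>w\<in>verts G. out_choice \<delta>\<^sub>o\<^sub>u\<^sub>t G v * in_choice \<delta>\<^sub>i\<^sub>n G w * of_bool (G' = add_edge v w G)) * F G')
      = (\<Sum>v\<in>verts G. \<Sum>w\<in>verts G. out_choice \<delta>\<^sub>o\<^sub>u\<^sub>t G v * in_choice \<delta>\<^sub>i\<^sub>n G w * F (add_edge v w G))"
    unfolding sum_distrib_right
    by (subst sum.swap, intro sum.cong refl, subst sum.swap) (intro sum.cong refl delta T; simp)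
  show ?thesis
    unfolding pa_transition_def pa_step_def a[symmetric] b[symmetric] g[symmetric]
    by (simp only: distrib_right sum.distrib mult.assoc sum_distrib_left[symmetric])
qed

text \<open>
  The process is specified by the probabilities of its finite paths; the Markov property, in the form of
  \<open>expectation_step\<close>, has to be derived from them.
\<close>

locale pa_chain = prob_space M for M :: "'w measure" +
  fixes \<alpha> \<beta> \<gamma> \<delta>\<^sub>i\<^sub>n \<delta>\<^sub>o\<^sub>u\<^sub>t :: real and n\<^sub>0 :: nat and G\<^sub>0 :: pa_graph and \<G> :: "nat \<Rightarrow> 'w \<Rightarrow> pa_graph"
  assumes rates: "0 \<le> \<alpha>" "0 \<le> \<beta>" "0 \<le> \<gamma>" "\<alpha> + \<beta> + \<gamma> = 1"
    and \<delta>_pos: "0 < \<delta>\<^sub>i\<^sub>n" "0 < \<delta>\<^sub>o\<^sub>u\<^sub>t"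
    and pref: "pref_attachment \<alpha> \<beta> \<gamma> \<delta>\<^sub>i\<^sub>n \<delta>\<^sub>o\<^sub>u\<^sub>t n\<^sub>0 G\<^sub>0 M \<G>"
begin

abbreviation step where "step \<equiv> pa_step \<alpha> \<beta> \<gamma> \<delta>\<^sub>i\<^sub>n \<delta>\<^sub>o\<^sub>u\<^sub>t"
abbreviation trans where "trans \<equiv> pa_transition \<alpha> \<beta> \<gamma> \<delta>\<^sub>i\<^sub>n \<delta>\<^sub>o\<^sub>u\<^sub>t"

lemma pred_graph: "Measurable.pred M (\<lambda>\<omega>. P (\<G> n \<omega>))"
proof -
  have "\<G> n \<in> measurable M (count_space UNIV)" using pref by (simp add: pref_attachment_def)
  then show ?thesis by (rule measurable_compose) simp
qed

lemma borel_graph: "(\<lambda>\<omega>. F (\<G> n \<omega>) :: real) \<in> borel_measurable M"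
proof -
  have "\<G> n \<in> measurable M (count_space UNIV)" using pref by (simp add: pref_attachment_def)
  then show ?thesis by (rule measurable_compose) simp
qed

definition admissible :: "nat \<Rightarrow> pa_graph \<Rightarrow> bool" where
  "admissible n G \<longleftrightarrow> fin_digraph G \<and> verts G \<noteq> {} \<and> card (arcs G) = n"

text \<open>
  The labels of new nodes and arcs are functions of the graph, so the chain visits only finitely many
  graphs at each time, although the type of graphs is uncountable.  All expectations are finite sums.
\<close>

primrec states :: "nat \<Rightarrow> pa_graph set" where
  "states 0 = {G\<^sub>0}"
| "states (Suc k) = (\<Union>G\<in>states k. successors G)"

lemma states_admissible: "G \<in> states k \<Longrightarrow> admissible (n\<^sub>0 + k) G"
proof (induction k arbitrary: G)
  case 0
  then show ?case using pref by (simp add: admissible_def pref_attachment_def)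
next
  case (Suc k)
  then obtain H v w where H: "H \<in> states k" and G: "G = add_edge v w H" by (auto simp: successors_def)
  show ?case using Suc.IH[OF H] unfolding G admissible_def
    by (simp add: fin_digraph_add_edge card_arcs_add_edge verts_add_edge)
qed

lemma finite_successors: "admissible n G \<Longrightarrow> finite (successors G)"
proof -
  assume "admissible n G"
  then interpret fin_digraph G by (simp add: admissible_def)
  show ?thesis by (simp add: successors_def)
qed

lemma finite_states: "finite (states k)"
  by (induction k) (auto intro!: finite_UN_I finite_successors states_admissible)

lemma step_const:
  assumes "admissible n G"
  shows "step G (\<lambda>_. c) = c"
proof -
  have 1: "(\<Sum>x\<in>verts G. in_choice \<delta>\<^sub>i\<^sub>n G x) = 1" "(\<Sum>x\<in>verts G. out_choice \<delta>\<^sub>o\<^sub>u\<^sub>t G x) = 1"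
    using assms \<delta>_pos by (auto simp: admissible_def sum_choice)
  have "(\<Sum>v\<in>verts G. \<Sum>w\<in>verts G. out_choice \<delta>\<^sub>o\<^sub>u\<^sub>t G v * in_choice \<delta>\<^sub>i\<^sub>n G w) = 1"
    by (simp add: 1 flip: sum_distrib_left)
  then have "step G (\<lambda>_. c) = \<alpha> * c + \<beta> * c + \<gamma> * c"
    unfolding pa_step_def by (simp add: 1 flip: sum_distrib_right)
  then show ?thesis using rates(4) by (simp flip: distrib_right)
qed

lemma path_event: "Measurable.pred M (\<lambda>\<omega>. \<forall>i\<in>{n\<^sub>0..m}. \<G> i \<omega> = g i)"
  using pred_graph by (intro pred_intros_finite) auto

text \<open>
  Events at time \<open>n\<^sub>0 + k\<close> are decomposed according to the finitely many possible pasts.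
\<close>

lemma path_split:
  assumes A: "AE \<omega> in M. \<forall>i\<in>{n\<^sub>0..n\<^sub>0 + k}. \<G> i \<omega> \<in> states (i - n\<^sub>0)"
    and R: "Measurable.pred M R"
  shows "\<P>(\<omega> in M. \<G> (n\<^sub>0 + k) \<omega> = x \<and> R \<omega>)
    = (\<Sum>\<pi>\<in>{\<pi> \<in> (\<Pi>\<^sub>E i\<in>{n\<^sub>0..n\<^sub>0 + k}. states (i - n\<^sub>0)). \<pi> (n\<^sub>0 + k) = x}.
        \<P>(\<omega> in M. (\<forall>i\<in>{n\<^sub>0..n\<^sub>0 + k}. \<G> i \<omega> = \<pi> i) \<and> R \<omega>))"
proof (rule prob_sum)
  note [measurable] = R pred_graph path_event
  show "finite {\<pi> \<in> (\<Pi>\<^sub>E i\<in>{n\<^sub>0..n\<^sub>0 + k}. states (i - n\<^sub>0)). \<pi> (n\<^sub>0 + k) = x}"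
    using finite_states by (auto intro!: finite_subset[OF _ finite_PiE[of "{n\<^sub>0..n\<^sub>0 + k}" "\<lambda>i. states (i - n\<^sub>0)"]])
  show "{\<omega> \<in> space M. \<G> (n\<^sub>0 + k) \<omega> = x \<and> R \<omega>} \<in> events"
    using pred_graph[of "\<lambda>G. G = x"] R by measurable
  show "{\<omega> \<in> space M. (\<forall>i\<in>{n\<^sub>0..n\<^sub>0 + k}. \<G> i \<omega> = \<pi> i) \<and> R \<omega>} \<in> events" for \<pi>
    using path_event[of "n\<^sub>0 + k" \<pi>] R by measurable
  show "AE \<omega> in M. (\<forall>\<pi>\<in>{\<pi> \<in> (\<Pi>\<^sub>E i\<in>{n\<^sub>0..n\<^sub>0 + k}. states (i - n\<^sub>0)). \<pi> (n\<^sub>0 + k) = x}.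
        (\<forall>i\<in>{n\<^sub>0..n\<^sub>0 + k}. \<G> i \<omega> = \<pi> i) \<and> R \<omega> \<longrightarrow> \<G> (n\<^sub>0 + k) \<omega> = x \<and> R \<omega>) \<and>
     (\<G> (n\<^sub>0 + k) \<omega> = x \<and> R \<omega> \<longrightarrow> (\<exists>!\<pi>\<in>{\<pi> \<in> (\<Pi>\<^sub>E i\<in>{n\<^sub>0..n\<^sub>0 + k}. states (i - n\<^sub>0)). \<pi> (n\<^sub>0 + k) = x}.
        (\<forall>i\<in>{n\<^sub>0..n\<^sub>0 + k}. \<G> i \<omega> = \<pi> i) \<and> R \<omega>))"
    using A
  proof eventually_elim
    case (elim \<omega>)
    show ?case
    proof (intro conjI ballI impI)
      assume R: "\<G> (n\<^sub>0 + k) \<omega> = x \<and> R \<omega>"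
      let ?\<pi> = "restrict (\<lambda>i. \<G> i \<omega>) {n\<^sub>0..n\<^sub>0 + k}"
      show "\<exists>!\<pi>\<in>{\<pi> \<in> (\<Pi>\<^sub>E i\<in>{n\<^sub>0..n\<^sub>0 + k}. states (i - n\<^sub>0)). \<pi> (n\<^sub>0 + k) = x}.
        (\<forall>i\<in>{n\<^sub>0..n\<^sub>0 + k}. \<G> i \<omega> = \<pi> i) \<and> R \<omega>"
      proof (rule ex1I[of _ ?\<pi>])
        show "?\<pi> \<in> {\<pi> \<in> (\<Pi>\<^sub>E i\<in>{n\<^sub>0..n\<^sub>0 + k}. states (i - n\<^sub>0)). \<pi> (n\<^sub>0 + k) = x} \<and>
          (\<forall>i\<in>{n\<^sub>0..n\<^sub>0 + k}. \<G> i \<omega> = ?\<pi> i) \<and> R \<omega>"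
          using elim R by auto
      next
        fix \<pi> assume "\<pi> \<in> {\<pi> \<in> (\<Pi>\<^sub>E i\<in>{n\<^sub>0..n\<^sub>0 + k}. states (i - n\<^sub>0)). \<pi> (n\<^sub>0 + k) = x} \<and>
          (\<forall>i\<in>{n\<^sub>0..n\<^sub>0 + k}. \<G> i \<omega> = \<pi> i) \<and> R \<omega>"
        then have "\<pi> \<in> extensional {n\<^sub>0..n\<^sub>0 + k}" "\<forall>i\<in>{n\<^sub>0..n\<^sub>0 + k}. \<G> i \<omega> = \<pi> i"
          by (auto simp: PiE_def)
        then show "\<pi> = ?\<pi>" by (intro extensionalityI[of _ "{n\<^sub>0..n\<^sub>0 + k}"]) auto
      qed
    qed auto
  qed
qed

text \<open>
  The specification conditions on the whole past; summing over all pasts that end in \<open>x\<close> leaves the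
  condition on the present.
\<close>

lemma one_step_transition:
  assumes A: "AE \<omega> in M. \<forall>i\<in>{n\<^sub>0..n\<^sub>0 + k}. \<G> i \<omega> \<in> states (i - n\<^sub>0)"
  shows "\<P>(\<omega> in M. \<G> (n\<^sub>0 + k) \<omega> = x \<and> \<G> (Suc (n\<^sub>0 + k)) \<omega> = y) = \<P>(\<omega> in M. \<G> (n\<^sub>0 + k) \<omega> = x) * trans x y"
proof -
  let ?\<Pi> = "{\<pi> \<in> (\<Pi>\<^sub>E i\<in>{n\<^sub>0..n\<^sub>0 + k}. states (i - n\<^sub>0)). \<pi> (n\<^sub>0 + k) = x}"
  have chain: "\<P>(\<omega> in M. \<forall>i\<in>{n\<^sub>0..Suc n}. \<G> i \<omega> = g i) = \<P>(\<omega> in M. \<forall>i\<in>{n\<^sub>0..n}. \<G> i \<omega> = g i) * trans (g n) (g (Suc n))"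
    if "n\<^sub>0 \<le> n" for n g
    using pref that by (simp add: pref_attachment_def)
  have "\<P>(\<omega> in M. \<G> (n\<^sub>0 + k) \<omega> = x \<and> \<G> (Suc (n\<^sub>0 + k)) \<omega> = y)
    = (\<Sum>\<pi>\<in>?\<Pi>. \<P>(\<omega> in M. (\<forall>i\<in>{n\<^sub>0..n\<^sub>0 + k}. \<G> i \<omega> = \<pi> i) \<and> \<G> (Suc (n\<^sub>0 + k)) \<omega> = y))"
    by (rule path_split[OF A pred_graph])
  also have "\<dots> = (\<Sum>\<pi>\<in>?\<Pi>. \<P>(\<omega> in M. \<forall>i\<in>{n\<^sub>0..n\<^sub>0 + k}. \<G> i \<omega> = \<pi> i) * trans x y)"
  proof (intro sum.cong refl)
    fix \<pi> assume \<pi>: "\<pi> \<in> ?\<Pi>"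
    define g where "g = \<pi>(Suc (n\<^sub>0 + k) := y)"
    have "(\<forall>i\<in>{n\<^sub>0..Suc (n\<^sub>0 + k)}. \<G> i \<omega> = g i) \<longleftrightarrow>
        (\<forall>i\<in>{n\<^sub>0..n\<^sub>0 + k}. \<G> i \<omega> = \<pi> i) \<and> \<G> (Suc (n\<^sub>0 + k)) \<omega> = y" for \<omega>
      by (auto simp: g_def atLeastAtMostSuc_conv)
    moreover have "(\<forall>i\<in>{n\<^sub>0..n\<^sub>0 + k}. \<G> i \<omega> = g i) \<longleftrightarrow> (\<forall>i\<in>{n\<^sub>0..n\<^sub>0 + k}. \<G> i \<omega> = \<pi> i)" for \<omega>
      by (auto simp: g_def)
    moreover have "g (n\<^sub>0 + k) = x" "g (Suc (n\<^sub>0 + k)) = y" using \<pi> by (auto simp: g_def)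
    ultimately show "\<P>(\<omega> in M. (\<forall>i\<in>{n\<^sub>0..n\<^sub>0 + k}. \<G> i \<omega> = \<pi> i) \<and> \<G> (Suc (n\<^sub>0 + k)) \<omega> = y)
       = \<P>(\<omega> in M. \<forall>i\<in>{n\<^sub>0..n\<^sub>0 + k}. \<G> i \<omega> = \<pi> i) * trans x y"
      using chain[of "n\<^sub>0 + k" g] by simp
  qed
  also have "\<dots> = \<P>(\<omega> in M. \<G> (n\<^sub>0 + k) \<omega> = x) * trans x y"
    using path_split[OF A, of "\<lambda>_. True" x] by (simp add: sum_distrib_right)
  finally show ?thesis .
qed

lemma sum_prob_states:
  assumes "AE \<omega> in M. \<G> n \<omega> \<in> S" "finite S"
  shows "(\<Sum>x\<in>S. \<P>(\<omega> in M. \<G> n \<omega> = x)) = 1"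
proof -
  have "\<P>(\<omega> in M. True) = (\<Sum>x\<in>S. \<P>(\<omega> in M. \<G> n \<omega> = x))"
    using assms pred_graph[of "\<lambda>G. G = _"] by (intro prob_sum) (auto elim!: eventually_mono)
  then show ?thesis by (simp add: prob_space)
qed

text \<open>
  The chain stays in the finite sets \<open>states\<close> because the transition probabilities to successors already
  add up to 1.  The induction uses the one-step rule at time \<open>n\<^sub>0 + k\<close>, which rests on the claim
  up to that time.
\<close>

lemma states_AE: "AE \<omega> in M. \<forall>i\<in>{n\<^sub>0..n\<^sub>0 + k}. \<G> i \<omega> \<in> states (i - n\<^sub>0)"
proof (induction k)
  case 0
  have "AE \<omega> in M. \<G> n\<^sub>0 \<omega> = G\<^sub>0" using pref by (simp add: pref_attachment_def)
  then show ?case by eventually_elim simp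
next
  case (Suc k)
  let ?n = "n\<^sub>0 + k"
  let ?S = "Sigma (states k) successors"
  have fin: "finite ?S" using finite_states finite_successors[OF states_admissible] by (intro finite_SigmaI) auto
  have now: "AE \<omega> in M. \<G> ?n \<omega> \<in> states k" using Suc by eventually_elim (auto dest: bspec[of _ _ ?n])
  have ev: "Measurable.pred M (\<lambda>\<omega>. \<G> ?n \<omega> = a \<and> \<G> (Suc ?n) \<omega> = b)" for a b
    using pred_graph[of "\<lambda>G. G = a" ?n] pred_graph[of "\<lambda>G. G = b" "Suc ?n"] by (rule pred_intros_logic)
  have ev': "Measurable.pred M (\<lambda>\<omega>. \<exists>p\<in>?S. \<G> ?n \<omega> = fst p \<and> \<G> (Suc ?n) \<omega> = snd p)"
    using fin ev by (intro pred_intros_finite) auto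
  have "\<P>(\<omega> in M. \<exists>p\<in>?S. \<G> ?n \<omega> = fst p \<and> \<G> (Suc ?n) \<omega> = snd p)
    = (\<Sum>p\<in>?S. \<P>(\<omega> in M. \<G> ?n \<omega> = fst p \<and> \<G> (Suc ?n) \<omega> = snd p))"
    using fin ev ev' by (intro prob_sum) auto
  also have "\<dots> = (\<Sum>x\<in>states k. \<Sum>y\<in>successors x. \<P>(\<omega> in M. \<G> ?n \<omega> = x) * trans x y)"
    unfolding one_step_transition[OF Suc] using finite_states finite_successors[OF states_admissible]
    by (subst sum.Sigma) (auto simp: split_beta)
  also have "\<dots> = (\<Sum>x\<in>states k. \<P>(\<omega> in M. \<G> ?n \<omega> = x))"
  proof (intro sum.cong refl)
    fix x assume "x \<in> states k"
    then have g: "admissible ?n x" by (rule states_admissible)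
    have "(\<Sum>y\<in>successors x. trans x y * 1) = step x (\<lambda>_. 1)"
      by (rule sum_transition[OF finite_successors[OF g]]) simp
    then show "(\<Sum>y\<in>successors x. \<P>(\<omega> in M. \<G> ?n \<omega> = x) * trans x y) = \<P>(\<omega> in M. \<G> ?n \<omega> = x)"
      by (simp add: step_const[OF g] flip: sum_distrib_left)
  qed
  also have "\<dots> = 1" using now finite_states by (rule sum_prob_states)
  finally have "AE \<omega> in M. \<exists>p\<in>?S. \<G> ?n \<omega> = fst p \<and> \<G> (Suc ?n) \<omega> = snd p"
    using ev' by (subst (asm) prob_Collect_eq_1) auto
  then show ?case using Suc
  proof eventually_elim
    case (elim \<omega>)
    then have "\<G> (Suc ?n) \<omega> \<in> states (Suc k)" by auto
    then show ?case using elim(2) by (auto simp: le_Suc_eq simp del: states.simps)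
  qed
qed

lemma AE_admissible: "n\<^sub>0 \<le> n \<Longrightarrow> AE \<omega> in M. admissible n (\<G> n \<omega>)"
  using states_AE[of "n - n\<^sub>0"] states_admissible[of _ "n - n\<^sub>0"] by (auto elim!: eventually_mono)

lemma expectation_finite:
  assumes "AE \<omega> in M. \<G> n \<omega> \<in> S" "finite S"
  shows "expectation (\<lambda>\<omega>. F (\<G> n \<omega>)) = (\<Sum>x\<in>S. \<P>(\<omega> in M. \<G> n \<omega> = x) * F x)"
proof -
  have ev: "{\<omega> \<in> space M. \<G> n \<omega> = x} \<in> events" for x using pred_graph[of "\<lambda>G. G = x" n] by simp
  have "expectation (\<lambda>\<omega>. F (\<G> n \<omega>)) = expectation (\<lambda>\<omega>. \<Sum>x\<in>S. indicator {\<omega> \<in> space M. \<G> n \<omega> = x} \<omega> * F x)"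
  proof (rule integral_cong_AE)
    show "AE \<omega> in M. F (\<G> n \<omega>) = (\<Sum>x\<in>S. indicator {\<omega> \<in> space M. \<G> n \<omega> = x} \<omega> * F x)"
      using assms(1) AE_space
    proof eventually_elim
      case (elim \<omega>)
      have "(\<Sum>x\<in>S. indicator {\<omega> \<in> space M. \<G> n \<omega> = x} \<omega> * F x) = (\<Sum>x\<in>S. if \<G> n \<omega> = x then F x else 0)"
        using elim by (intro sum.cong) auto
      then show ?case using elim assms(2) by simp
    qed
  qed (use ev borel_graph in auto)
  also have "\<dots> = (\<Sum>x\<in>S. \<P>(\<omega> in M. \<G> n \<omega> = x) * F x)"
    using ev by (subst Bochner_Integration.integral_sum) (auto simp: emeasure_eq_measure)
  finally show ?thesis .
qed

lemma integrable_graph: "n\<^sub>0 \<le> n \<Longrightarrow> integrable M (\<lambda>\<omega>. F (\<G> n \<omega>) :: real)"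
proof -
  assume n: "n\<^sub>0 \<le> n"
  have AE: "AE \<omega> in M. \<G> n \<omega> \<in> states (n - n\<^sub>0)" using states_AE[of "n - n\<^sub>0"] n by (auto elim!: eventually_mono)
  show ?thesis
    using AE finite_states borel_graph by (intro integrable_const_bound[of _ "\<Sum>x\<in>states (n - n\<^sub>0). \<bar>F x\<bar>"])
      (auto elim!: eventually_mono intro!: member_le_sum[of _ _ "\<lambda>x. \<bar>F x\<bar>"])
qed

proposition expectation_step:
  assumes n: "n\<^sub>0 \<le> n"
  shows "expectation (\<lambda>\<omega>. F (\<G> (Suc n) \<omega>)) = expectation (\<lambda>\<omega>. step (\<G> n \<omega>) F)"
proof -
  define k where "k = n - n\<^sub>0"
  have nk: "n = n\<^sub>0 + k" using n by (simp add: k_def)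
  have now: "AE \<omega> in M. \<G> n \<omega> \<in> states k" using states_AE[of k] by eventually_elim (auto simp: nk dest: bspec[of _ _ "n\<^sub>0 + k"])
  have "AE \<omega> in M. \<G> (Suc n) \<omega> \<in> states (Suc k)" using states_AE[of "Suc k"]
    by eventually_elim (auto simp: nk dest!: bspec[of _ _ "Suc (n\<^sub>0 + k)"])
  then have "expectation (\<lambda>\<omega>. F (\<G> (Suc n) \<omega>)) = (\<Sum>y\<in>states (Suc k). \<P>(\<omega> in M. \<G> (Suc n) \<omega> = y) * F y)"
    using finite_states by (rule expectation_finite)
  also have "\<dots> = (\<Sum>y\<in>states (Suc k). \<Sum>x\<in>states k. \<P>(\<omega> in M. \<G> n \<omega> = x) * (trans x y * F y))"
  proof (intro sum.cong refl)
    fix y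
    have ev: "Measurable.pred M (\<lambda>\<omega>. \<G> n \<omega> = a \<and> \<G> (Suc n) \<omega> = b)" for a b
      using pred_graph[of "\<lambda>G. G = a" n] pred_graph[of "\<lambda>G. G = b" "Suc n"] by (rule pred_intros_logic)
    have "\<P>(\<omega> in M. \<G> (Suc n) \<omega> = y) = (\<Sum>x\<in>states k. \<P>(\<omega> in M. \<G> n \<omega> = x \<and> \<G> (Suc n) \<omega> = y))"
      using now finite_states pred_graph[of "\<lambda>G. G = y"] ev by (intro prob_sum) (auto elim!: eventually_mono)
    then show "\<P>(\<omega> in M. \<G> (Suc n) \<omega> = y) * F y = (\<Sum>x\<in>states k. \<P>(\<omega> in M. \<G> n \<omega> = x) * (trans x y * F y))"
      unfolding nk one_step_transition[OF states_AE] by (simp add: sum_distrib_right mult.assoc)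
  qed
  also have "\<dots> = (\<Sum>x\<in>states k. \<P>(\<omega> in M. \<G> n \<omega> = x) * step x F)"
  proof (subst sum.swap, intro sum.cong refl)
    fix x assume x: "x \<in> states k"
    have "(\<Sum>y\<in>states (Suc k). trans x y * F y) = step x F"
      using x by (intro sum_transition finite_states) auto
    then show "(\<Sum>y\<in>states (Suc k). \<P>(\<omega> in M. \<G> n \<omega> = x) * (trans x y * F y)) = \<P>(\<omega> in M. \<G> n \<omega> = x) * step x F"
      by (simp flip: sum_distrib_left)
  qed
  also have "\<dots> = expectation (\<lambda>\<omega>. step (\<G> n \<omega>) F)"
    using now finite_states by (rule expectation_finite[symmetric])
  finally show ?thesis .
qed

end


section \<open>Node counts and degree counts along the chain\<close>

context pa_chain
begin

abbreviation (input) nodes where "nodes n \<omega> \<equiv> real (card (verts (\<G> n \<omega>)))"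

lemma admissibleD:
  assumes "admissible n G"
  shows "fin_digraph G" "finite (verts G)" "finite (arcs G)" "verts G \<noteq> {}" "card (arcs G) = n"
    "(\<Sum>x\<in>verts G. in_choice \<delta>\<^sub>i\<^sub>n G x) = 1" "(\<Sum>x\<in>verts G. out_choice \<delta>\<^sub>o\<^sub>u\<^sub>t G x) = 1"
    "new_node G \<notin> verts G" "0 < card (verts G)"
proof -
  show fd: "fin_digraph G" and ne: "verts G \<noteq> {}" and "card (arcs G) = n" using assms by (auto simp: admissible_def)
  interpret fin_digraph G by fact
  show "finite (verts G)" "finite (arcs G)" by simp_all
  show "(\<Sum>x\<in>verts G. in_choice \<delta>\<^sub>i\<^sub>n G x) = 1" "(\<Sum>x\<in>verts G. out_choice \<delta>\<^sub>o\<^sub>u\<^sub>t G x) = 1"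
    using sum_choice[OF fd ne] \<delta>_pos by auto
  show "new_node G \<notin> verts G" by (rule new_node_fresh) simp
  show "0 < card (verts G)" using ne by (simp add: card_gt_0_iff)
qed

text \<open>
  The effect of an edge \<open>v \<rightarrow> w\<close> on a statistic of the graph is a gain \<open>g v\<close> of its tail plus a gain \<open>f w\<close>
  of its head, up to a correction \<open>r v\<close> for loops.
\<close>

lemma step_by_cases:
  assumes "admissible n G"
    and A: "\<And>w. w \<in> verts G \<Longrightarrow> F (add_edge (new_node G) w G) = a + f w"
    and B: "\<And>v w. v \<in> verts G \<Longrightarrow> w \<in> verts G \<Longrightarrow> F (add_edge v w G) = b + f w + g v + of_bool (v = w) * r v"
    and C: "\<And>v. v \<in> verts G \<Longrightarrow> F (add_edge v (new_node G) G) = c + g v"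
  shows "step G F = \<alpha> * a + \<beta> * b + \<gamma> * c + (\<alpha> + \<beta>) * (\<Sum>w\<in>verts G. in_choice \<delta>\<^sub>i\<^sub>n G w * f w)
     + (\<beta> + \<gamma>) * (\<Sum>v\<in>verts G. out_choice \<delta>\<^sub>o\<^sub>u\<^sub>t G v * g v)
     + \<beta> * (\<Sum>v\<in>verts G. out_choice \<delta>\<^sub>o\<^sub>u\<^sub>t G v * (in_choice \<delta>\<^sub>i\<^sub>n G v * r v))"
proof -
  note G = admissibleD[OF assms(1)]
  let ?V = "verts G" and ?i = "in_choice \<delta>\<^sub>i\<^sub>n G" and ?o = "out_choice \<delta>\<^sub>o\<^sub>u\<^sub>t G"
  have 1: "(\<Sum>w\<in>?V. ?i w * F (add_edge (new_node G) w G)) = a + (\<Sum>w\<in>?V. ?i w * f w)"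
  proof -
    have "(\<Sum>w\<in>?V. ?i w * F (add_edge (new_node G) w G)) = (\<Sum>w\<in>?V. ?i w * a + ?i w * f w)"
      using A by (intro sum.cong) (auto simp: distrib_left)
    then show ?thesis by (simp add: sum.distrib G(6) flip: sum_distrib_right)
  qed
  have 3: "(\<Sum>v\<in>?V. ?o v * F (add_edge v (new_node G) G)) = c + (\<Sum>v\<in>?V. ?o v * g v)"
  proof -
    have "(\<Sum>v\<in>?V. ?o v * F (add_edge v (new_node G) G)) = (\<Sum>v\<in>?V. ?o v * c + ?o v * g v)"
      using C by (intro sum.cong) (auto simp: distrib_left)
    then show ?thesis by (simp add: sum.distrib G(7) flip: sum_distrib_right)
  qed
  have inner: "(\<Sum>w\<in>?V. ?o v * ?i w * F (add_edge v w G))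
     = ?o v * b + ?o v * (\<Sum>w\<in>?V. ?i w * f w) + ?o v * g v + ?o v * (?i v * r v)" if v: "v \<in> ?V" for v
  proof -
    have "(\<Sum>w\<in>?V. ?o v * ?i w * F (add_edge v w G))
      = (\<Sum>w\<in>?V. ?i w * (?o v * b) + ?o v * (?i w * f w) + ?i w * (?o v * g v) + (if v = w then ?o v * (?i w * r v) else 0))"
      using B[OF v] by (intro sum.cong) (auto simp: algebra_simps)
    then show ?thesis using v G(2)
      by (simp add: sum.distrib G(6) flip: sum_distrib_right sum_distrib_left)
  qed
  have 2: "(\<Sum>v\<in>?V. \<Sum>w\<in>?V. ?o v * ?i w * F (add_edge v w G))
     = b + (\<Sum>w\<in>?V. ?i w * f w) + (\<Sum>v\<in>?V. ?o v * g v) + (\<Sum>v\<in>?V. ?o v * (?i v * r v))"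
    by (simp add: inner sum.distrib G(7) flip: sum_distrib_right)
  show ?thesis unfolding pa_step_def 1 2 3 by (simp add: algebra_simps)
qed

lemma step_nodes:
  assumes "admissible n G"
  shows "step G (\<lambda>H. \<phi> (real (card (verts H)))) = (\<alpha> + \<gamma>) * \<phi> (real (card (verts G)) + 1) + \<beta> * \<phi> (real (card (verts G)))"
proof -
  note G = admissibleD[OF assms]
  have "step G (\<lambda>H. \<phi> (real (card (verts H)))) =
    \<alpha> * \<phi> (real (card (verts G)) + 1) + \<beta> * \<phi> (real (card (verts G))) + \<gamma> * \<phi> (real (card (verts G)) + 1)
      + (\<alpha> + \<beta>) * (\<Sum>w\<in>verts G. in_choice \<delta>\<^sub>i\<^sub>n G w * 0)
      + (\<beta> + \<gamma>) * (\<Sum>v\<in>verts G. out_choice \<delta>\<^sub>o\<^sub>u\<^sub>t G v * 0)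
      + \<beta> * (\<Sum>v\<in>verts G. out_choice \<delta>\<^sub>o\<^sub>u\<^sub>t G v * (in_choice \<delta>\<^sub>i\<^sub>n G v * 0))"
    using G by (intro step_by_cases[OF assms]) (auto simp: verts_add_edge insert_absorb add.commute)
  then show ?thesis by (simp add: algebra_simps)
qed

text \<open>
  Each step adds a node with probability \<open>\<alpha> + \<gamma>\<close>, whatever the graph, so the centred count gains the
  variance of one Bernoulli variable per step.
\<close>

lemma node_count_variance:
  "expectation (\<lambda>\<omega>. (nodes (n\<^sub>0 + k) \<omega> - real (card (verts G\<^sub>0)) - real k * (\<alpha> + \<gamma>))\<^sup>2) = real k * ((\<alpha> + \<gamma>) * \<beta>)"
proof (induction k)
  case 0
  have "AE \<omega> in M. \<G> n\<^sub>0 \<omega> = G\<^sub>0" using pref by (simp add: pref_attachment_def)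
  then have "expectation (\<lambda>\<omega>. (nodes (n\<^sub>0 + 0) \<omega> - real (card (verts G\<^sub>0)) - real 0 * (\<alpha> + \<gamma>))\<^sup>2) = expectation (\<lambda>_. 0)"
    using borel_graph by (intro integral_cong_AE) (auto elim!: eventually_mono)
  then show ?case by simp
next
  case (Suc k)
  let ?n = "n\<^sub>0 + k" and ?N0 = "real (card (verts G\<^sub>0))" and ?\<kappa> = "\<alpha> + \<gamma>"
  define \<phi> where "\<phi> x = (x - ?N0 - real (Suc k) * ?\<kappa>)\<^sup>2" for x
  have \<beta>: "\<beta> = 1 - ?\<kappa>" using rates(4) by simp
  have st: "step G (\<lambda>H. \<phi> (real (card (verts H)))) = (real (card (verts G)) - ?N0 - real k * ?\<kappa>)\<^sup>2 + ?\<kappa> * \<beta>" if "admissible ?n G" for G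
  proof -
    have "?\<kappa> * \<phi> (x + 1) + \<beta> * \<phi> x = (x - ?N0 - real k * ?\<kappa>)\<^sup>2 + ?\<kappa> * \<beta>" for x
      unfolding \<phi>_def \<beta> by (simp add: power2_eq_square algebra_simps)
    then show ?thesis using step_nodes[OF that, of \<phi>] by simp
  qed
  have "expectation (\<lambda>\<omega>. \<phi> (nodes (Suc ?n) \<omega>)) = expectation (\<lambda>\<omega>. step (\<G> ?n \<omega>) (\<lambda>H. \<phi> (real (card (verts H)))))"
    by (rule expectation_step) simp
  also have "\<dots> = expectation (\<lambda>\<omega>. (nodes ?n \<omega> - ?N0 - real k * ?\<kappa>)\<^sup>2 + ?\<kappa> * \<beta>)"
    using AE_admissible[of ?n] st borel_graph by (intro integral_cong_AE) (auto elim!: eventually_mono)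
  also have "\<dots> = expectation (\<lambda>\<omega>. (nodes ?n \<omega> - ?N0 - real k * ?\<kappa>)\<^sup>2) + ?\<kappa> * \<beta>"
    using integrable_graph[of ?n "\<lambda>G. (real (card (verts G)) - ?N0 - real k * ?\<kappa>)\<^sup>2"]
    by (subst Bochner_Integration.integral_add) (auto simp: prob_space)
  also have "\<dots> = real (Suc k) * (?\<kappa> * \<beta>)" unfolding Suc.IH by (simp add: algebra_simps)
  finally show ?case by (simp add: \<phi>_def)
qed

text \<open>
  The standard deviation of the node count is at most of order \<open>sqrt n\<close>.
\<close>

lemma node_fraction_L1:
  "(\<lambda>n. expectation (\<lambda>\<omega>. \<bar>nodes n \<omega> / real n - (\<alpha> + \<gamma>)\<bar>)) \<longlonglongrightarrow> 0"
proof -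
  let ?\<kappa> = "\<alpha> + \<gamma>"
  define C where "C = \<bar>real (card (verts G\<^sub>0)) - real n\<^sub>0 * ?\<kappa>\<bar>"
  have bound: "expectation (\<lambda>\<omega>. \<bar>nodes n \<omega> / real n - ?\<kappa>\<bar>) \<le> (sqrt (real n) + C) / real n"
    if n: "n\<^sub>0 \<le> n" "0 < n" for n
  proof -
    define k where "k = n - n\<^sub>0"
    have nk: "n = n\<^sub>0 + k" using n by (simp add: k_def)
    define D where "D G = real (card (verts G)) - real (card (verts G\<^sub>0)) - real k * ?\<kappa>" for G :: pa_graph
    define s where "s = sqrt (real n)"
    have s: "0 < s" "s * s = real n" using n by (auto simp: s_def)
    have pt: "\<bar>nodes n \<omega> / real n - ?\<kappa>\<bar> \<le> ((D (\<G> n \<omega>))\<^sup>2 / s + s) / 2 / real n + C / real n" for \<omega>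
    proof -
      have "nodes n \<omega> / real n - ?\<kappa> = (D (\<G> n \<omega>) + (real (card (verts G\<^sub>0)) - real n\<^sub>0 * ?\<kappa>)) / real n"
      proof -
        have "D (\<G> n \<omega>) + (real (card (verts G\<^sub>0)) - real n\<^sub>0 * ?\<kappa>) = nodes n \<omega> - real n * ?\<kappa>"
          by (simp add: D_def nk algebra_simps)
        then show ?thesis using n by (simp add: diff_divide_distrib)
      qed
      then have "\<bar>nodes n \<omega> / real n - ?\<kappa>\<bar> \<le> (\<bar>D (\<G> n \<omega>)\<bar> + C) / real n"
        by (simp add: C_def abs_divide divide_right_mono abs_triangle_ineq)
      moreover have "\<bar>D (\<G> n \<omega>)\<bar> \<le> ((D (\<G> n \<omega>))\<^sup>2 / s + s) / 2"
      proof -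
        \<comment> \<open>arithmetic-geometric mean in place of the Cauchy-Schwarz inequality\<close>
        have "0 \<le> (\<bar>D (\<G> n \<omega>)\<bar> - s)\<^sup>2" by simp
        then show ?thesis using s by (simp add: power2_diff field_simps power2_eq_square)
      qed
      then have "(\<bar>D (\<G> n \<omega>)\<bar> + C) / real n \<le> (((D (\<G> n \<omega>))\<^sup>2 / s + s) / 2 + C) / real n"
        by (intro divide_right_mono) auto
      ultimately show ?thesis by (simp add: add_divide_distrib)
    qed
    have int: "integrable M (\<lambda>\<omega>. (D (\<G> n \<omega>))\<^sup>2)" using integrable_graph[OF n(1), of "\<lambda>G. (D G)\<^sup>2"] .
    have "expectation (\<lambda>\<omega>. \<bar>nodes n \<omega> / real n - ?\<kappa>\<bar>) \<le> expectation (\<lambda>\<omega>. ((D (\<G> n \<omega>))\<^sup>2 / s + s) / 2 / real n + C / real n)"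
      using pt int integrable_graph[OF n(1), of "\<lambda>G. \<bar>real (card (verts G)) / real n - ?\<kappa>\<bar>"]
      by (intro integral_mono) auto
    also have "\<dots> = (expectation (\<lambda>\<omega>. (D (\<G> n \<omega>))\<^sup>2) / s + s) / 2 / real n + C / real n"
      using int by (simp add: prob_space)
    also have "expectation (\<lambda>\<omega>. (D (\<G> n \<omega>))\<^sup>2) = real k * (?\<kappa> * \<beta>)"
      using node_count_variance[of k] by (simp add: D_def nk)
    also have "(real k * (?\<kappa> * \<beta>) / s + s) / 2 / real n + C / real n \<le> (sqrt (real n) + C) / real n"
    proof -
      have "?\<kappa> * \<beta> \<le> 1 * 1" using rates by (intro mult_mono) auto
      then have "real k * (?\<kappa> * \<beta>) \<le> real k * 1" by (intro mult_left_mono) auto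
      also have "\<dots> \<le> s * s" unfolding s nk by simp
      finally have "real k * (?\<kappa> * \<beta>) / s \<le> s" using s by (simp add: field_simps)
      then have "(real k * (?\<kappa> * \<beta>) / s + s) / 2 / real n \<le> s / real n" by (intro divide_right_mono) auto
      then show ?thesis by (simp add: s_def add_divide_distrib)
    qed
    finally show ?thesis .
  qed
  have bound_lim: "(\<lambda>n. (sqrt (real n) + C) / real n) \<longlonglongrightarrow> 0"
  proof -
    have "(\<lambda>n. inverse (sqrt (real n)) + C * inverse (real n)) \<longlonglongrightarrow> 0 + C * 0"
      by (intro tendsto_intros lim_inverse_n tendsto_inverse_0_at_top
          filterlim_compose[OF sqrt_at_top] filterlim_real_sequentially)
    moreover have "\<forall>\<^sub>F n in sequentially. inverse (sqrt (real n)) + C * inverse (real n) = (sqrt (real n) + C) / real n"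
      using eventually_gt_at_top[of 0]
      by eventually_elim (simp add: add_divide_distrib inverse_eq_divide real_divide_square_eq sqrt_divide_self_eq)
    ultimately show ?thesis by (simp add: tendsto_cong)
  qed
  show ?thesis
  proof (rule tendsto_sandwich[OF _ _ tendsto_const bound_lim])
    show "\<forall>\<^sub>F n in sequentially. expectation (\<lambda>\<omega>. \<bar>nodes n \<omega> / real n - ?\<kappa>\<bar>) \<le> (sqrt (real n) + C) / real n"
      using eventually_ge_at_top[of n\<^sub>0] eventually_gt_at_top[of 0] by eventually_elim (rule bound)
  qed (auto intro!: always_eventually)
qed

definition has_degrees :: "nat \<Rightarrow> nat \<Rightarrow> nat \<Rightarrow> nat \<Rightarrow> real" where
  "has_degrees i j d e = of_bool (d = i \<and> e = j)"

lemma degree_count_sum: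
  "finite (verts G) \<Longrightarrow> real (degree_count G i j) = (\<Sum>x\<in>verts G. has_degrees i j (in_degree G x) (out_degree G x))"
  unfolding degree_count_def has_degrees_def
  by (simp add: of_bool_def sum.If_cases Int_def conj_commute flip: sum.inter_filter)

definition in_gain where "in_gain i j G x = has_degrees i j (Suc (in_degree G x)) (out_degree G x) - has_degrees i j (in_degree G x) (out_degree G x)"
definition out_gain where "out_gain i j G x = has_degrees i j (in_degree G x) (Suc (out_degree G x)) - has_degrees i j (in_degree G x) (out_degree G x)"
text \<open>
  A loop raises both degrees of one node at once; this is what that effect differs by from the sum of
  the two separate gains.
\<close>

definition loop_defect where "loop_defect i j G x = has_degrees i j (Suc (in_degree G x)) (Suc (out_degree G x))
   - has_degrees i j (in_degree G x) (out_degree G x) - in_gain i j G x - out_gain i j G x"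

lemma degree_count_add_edge:
  assumes "admissible n G"
  shows "w \<in> verts G \<Longrightarrow> real (degree_count (add_edge (new_node G) w G) i j) = (real (degree_count G i j) + has_degrees i j 0 1) + in_gain i j G w"
    and "v \<in> verts G \<Longrightarrow> real (degree_count (add_edge v (new_node G) G) i j) = (real (degree_count G i j) + has_degrees i j 1 0) + out_gain i j G v"
    and "v \<in> verts G \<Longrightarrow> w \<in> verts G \<Longrightarrow> real (degree_count (add_edge v w G) i j)
      = real (degree_count G i j) + in_gain i j G w + out_gain i j G v + of_bool (v = w) * loop_defect i j G v"
proof -
  note G = admissibleD[OF assms]
  let ?\<chi> = "has_degrees i j"
  let ?d = "in_degree G" and ?e = "out_degree G"
  have old: "(\<Sum>x\<in>verts G. ?\<chi> (?d x + of_bool (x = w)) (?e x + of_bool (x = v)))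
     = real (degree_count G i j) + (if w \<in> verts G then in_gain i j G w else 0) + (if v \<in> verts G then out_gain i j G v else 0)
        + (if v \<in> verts G then of_bool (v = w) * loop_defect i j G v else 0)" for v w
  proof -
    have "(\<Sum>x\<in>verts G. ?\<chi> (?d x + of_bool (x = w)) (?e x + of_bool (x = v)))
      = (\<Sum>x\<in>verts G. ?\<chi> (?d x) (?e x) + (if x = w then in_gain i j G x else 0) + (if x = v then out_gain i j G x else 0)
          + (if x = v then of_bool (x = w) * loop_defect i j G x else 0))"
      by (intro sum.cong refl) (auto simp: in_gain_def out_gain_def loop_defect_def)
    then show ?thesis using G(2) by (simp add: sum.distrib degree_count_sum)
  qed
  have new: "real (degree_count (add_edge v w G) i j) = (\<Sum>x\<in>verts G \<union> {v, w}. ?\<chi> (?d x + of_bool (x = w)) (?e x + of_bool (x = v)))" for v w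
    using G(2) by (simp add: degree_count_sum verts_add_edge degree_add_edge[OF G(1)])
  note out = degree_outside[OF G(1,8)]
  show "real (degree_count (add_edge (new_node G) w G) i j) = (real (degree_count G i j) + has_degrees i j 0 1) + in_gain i j G w"
    if "w \<in> verts G"
  proof -
    have "verts G \<union> {new_node G, w} = insert (new_node G) (verts G)" "w \<noteq> new_node G" using that G(8) by auto
    then show ?thesis unfolding new using that G(2,8) old[of w "new_node G"] out by simp
  qed
  show "real (degree_count (add_edge v (new_node G) G) i j) = (real (degree_count G i j) + has_degrees i j 1 0) + out_gain i j G v"
    if "v \<in> verts G"
  proof -
    have "verts G \<union> {v, new_node G} = insert (new_node G) (verts G)" "v \<noteq> new_node G" using that G(8) by auto
    then show ?thesis unfolding new using that G(2,8) old[of "new_node G" v] out by simp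
  qed
  show "real (degree_count (add_edge v w G) i j)
      = real (degree_count G i j) + in_gain i j G w + out_gain i j G v + of_bool (v = w) * loop_defect i j G v"
    if "v \<in> verts G" "w \<in> verts G"
  proof -
    have "verts G \<union> {v, w} = verts G" using that by auto
    then show ?thesis unfolding new using that old[of w v] by simp
  qed
qed

abbreviation (input) flow :: "real \<Rightarrow> (nat \<Rightarrow> real) \<Rightarrow> nat \<Rightarrow> real" where
  "flow \<delta> f i \<equiv> (real i - 1 + \<delta>) * prev f i - (real i + \<delta>) * f i"

abbreviation (input) count where "count i j n \<omega> \<equiv> real (degree_count (\<G> n \<omega>) i j)"

text \<open>
  The preference weight of a node is a function of its in-degree, so weighted counts over a degree class
  are multiples of the class size: nodes enter class \<open>i\<close> from \<open>i - 1\<close> and leave it for \<open>i + 1\<close>.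
\<close>

lemma sum_in_gain:
  assumes "admissible n G"
  shows "(\<Sum>w\<in>verts G. in_choice \<delta>\<^sub>i\<^sub>n G w * in_gain i j G w)
    = ((real i - 1 + \<delta>\<^sub>i\<^sub>n) * prev (\<lambda>k. real (degree_count G k j)) i - (real i + \<delta>\<^sub>i\<^sub>n) * real (degree_count G i j))
       / (real n + \<delta>\<^sub>i\<^sub>n * real (card (verts G)))"
proof -
  note G = admissibleD[OF assms]
  have "(\<Sum>w\<in>verts G. (real (in_degree G w) + \<delta>\<^sub>i\<^sub>n) * in_gain i j G w)
    = (\<Sum>w\<in>verts G. (real i - 1 + \<delta>\<^sub>i\<^sub>n) * prev (\<lambda>k. has_degrees k j (in_degree G w) (out_degree G w)) i
         - (real i + \<delta>\<^sub>i\<^sub>n) * has_degrees i j (in_degree G w) (out_degree G w))"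
    by (intro sum.cong refl, cases i) (auto simp: in_gain_def has_degrees_def)
  also have "\<dots> = (real i - 1 + \<delta>\<^sub>i\<^sub>n) * prev (\<lambda>k. real (degree_count G k j)) i - (real i + \<delta>\<^sub>i\<^sub>n) * real (degree_count G i j)"
    by (cases i) (simp_all add: sum_subtractf sum_negf degree_count_sum[OF G(2)] sum_distrib_left)
  finally show ?thesis
    unfolding in_choice_def G(5) times_divide_eq_left by (simp flip: sum_divide_distrib)
qed

lemma sum_out_gain:
  assumes "admissible n G"
  shows "(\<Sum>w\<in>verts G. out_choice \<delta>\<^sub>o\<^sub>u\<^sub>t G w * out_gain i j G w)
    = ((real j - 1 + \<delta>\<^sub>o\<^sub>u\<^sub>t) * prev (\<lambda>k. real (degree_count G i k)) j - (real j + \<delta>\<^sub>o\<^sub>u\<^sub>t) * real (degree_count G i j))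
       / (real n + \<delta>\<^sub>o\<^sub>u\<^sub>t * real (card (verts G)))"
proof -
  note G = admissibleD[OF assms]
  have "(\<Sum>w\<in>verts G. (real (out_degree G w) + \<delta>\<^sub>o\<^sub>u\<^sub>t) * out_gain i j G w)
    = (\<Sum>w\<in>verts G. (real j - 1 + \<delta>\<^sub>o\<^sub>u\<^sub>t) * prev (\<lambda>k. has_degrees i k (in_degree G w) (out_degree G w)) j
         - (real j + \<delta>\<^sub>o\<^sub>u\<^sub>t) * has_degrees i j (in_degree G w) (out_degree G w))"
    by (intro sum.cong refl, cases j) (auto simp: out_gain_def has_degrees_def)
  also have "\<dots> = (real j - 1 + \<delta>\<^sub>o\<^sub>u\<^sub>t) * prev (\<lambda>k. real (degree_count G i k)) j - (real j + \<delta>\<^sub>o\<^sub>u\<^sub>t) * real (degree_count G i j)"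
    by (cases j) (simp_all add: sum_subtractf sum_negf degree_count_sum[OF G(2)] sum_distrib_left)
  finally show ?thesis
    unfolding out_choice_def G(5) times_divide_eq_left by (simp flip: sum_divide_distrib)
qed

text \<open>
  A loop at a node of very high degree need not be improbable, but it does not concern the
  nodes with degrees \<open>(i, j)\<close>: the correction vanishes unless the in-degree is at most \<open>i\<close>, and then the
  preference of the node is of order \<open>1 / n\<close>.
\<close>

lemma loop_correction_small:
  assumes "admissible n G" "0 < n"
  shows "\<bar>\<Sum>v\<in>verts G. out_choice \<delta>\<^sub>o\<^sub>u\<^sub>t G v * (in_choice \<delta>\<^sub>i\<^sub>n G v * loop_defect i j G v)\<bar> \<le> 4 * (real i + \<delta>\<^sub>i\<^sub>n) / real n"
proof -
  note G = admissibleD[OF assms(1)]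
  have one: "\<bar>in_choice \<delta>\<^sub>i\<^sub>n G v * loop_defect i j G v\<bar> \<le> 4 * (real i + \<delta>\<^sub>i\<^sub>n) / real n" for v
  proof (cases "loop_defect i j G v = 0")
    case False
    have "in_degree G v \<le> i"
    proof (rule ccontr)
      assume "\<not> in_degree G v \<le> i"
      then have "loop_defect i j G v = 0" by (auto simp: loop_defect_def in_gain_def out_gain_def has_degrees_def)
      then show False using False by simp
    qed
    then have "in_choice \<delta>\<^sub>i\<^sub>n G v \<le> (real i + \<delta>\<^sub>i\<^sub>n) / real n"
      unfolding in_choice_def G(5) using \<delta>_pos assms(2) by (intro frac_le) auto
    moreover have "\<bar>loop_defect i j G v\<bar> \<le> 4"
      by (auto simp: loop_defect_def in_gain_def out_gain_def has_degrees_def)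
    ultimately have "\<bar>in_choice \<delta>\<^sub>i\<^sub>n G v\<bar> * \<bar>loop_defect i j G v\<bar> \<le> (real i + \<delta>\<^sub>i\<^sub>n) / real n * 4"
      using \<delta>_pos by (intro mult_mono) (auto simp: choice_nonneg)
    then show ?thesis by (simp add: abs_mult mult.commute)
  qed (use \<delta>_pos in auto)
  have "\<bar>\<Sum>v\<in>verts G. out_choice \<delta>\<^sub>o\<^sub>u\<^sub>t G v * (in_choice \<delta>\<^sub>i\<^sub>n G v * loop_defect i j G v)\<bar>
    \<le> (\<Sum>v\<in>verts G. \<bar>out_choice \<delta>\<^sub>o\<^sub>u\<^sub>t G v * (in_choice \<delta>\<^sub>i\<^sub>n G v * loop_defect i j G v)\<bar>)" by (rule sum_abs)
  also have "\<dots> \<le> (\<Sum>v\<in>verts G. out_choice \<delta>\<^sub>o\<^sub>u\<^sub>t G v * (4 * (real i + \<delta>\<^sub>i\<^sub>n) / real n))"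
    using one \<delta>_pos by (intro sum_mono) (simp only: abs_mult[of "out_choice _ _ _"] abs_of_nonneg[OF choice_nonneg(2)] mult_left_mono choice_nonneg)
  also have "\<dots> = 4 * (real i + \<delta>\<^sub>i\<^sub>n) / real n"
    unfolding sum_distrib_right[symmetric] G(7) by simp
  finally show ?thesis .
qed

end


section \<open>The recursion for the limiting degree distribution\<close>

text \<open>
  Telescoping the increments bounds \<open>a n\<close> from below by a line of slope \<open>K\<close>.
\<close>

lemma slope_lower_bound:
  fixes a :: "nat \<Rightarrow> real"
  assumes inc: "\<forall>\<^sub>F n in sequentially. K \<le> a (Suc n) - a n" and lim: "(\<lambda>n. a n / real n) \<longlonglongrightarrow> x"
  shows "K \<le> x"
proof -
  obtain m where m: "\<And>n. m \<le> n \<Longrightarrow> K \<le> a (Suc n) - a n" using inc by (auto simp: eventually_sequentially)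
  have low: "a m + (real n - real m) * K \<le> a n" if "m \<le> n" for n
    using that
  proof (induction n rule: dec_induct)
    case (step n)
    then show ?case using m[of n] by (simp add: algebra_simps)
  qed simp
  have "(\<lambda>n. (a m - real m * K) * inverse (real n) + K) \<longlonglongrightarrow> (a m - real m * K) * 0 + K"
    by (intro tendsto_intros lim_inverse_n)
  moreover have "\<forall>\<^sub>F n in sequentially. (a m - real m * K) * inverse (real n) + K \<le> a n / real n"
    using eventually_ge_at_top[of m] eventually_gt_at_top[of 0]
  proof eventually_elim
    case (elim n)
    have "(a m - real m * K) * inverse (real n) + K = (a m + (real n - real m) * K) / real n"
      using elim by (simp add: field_simps)
    also have "\<dots> \<le> a n / real n" using low[OF elim(1)] by (intro divide_right_mono) auto
    finally show ?case .
  qed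
  ultimately show ?thesis using lim by (intro tendsto_le[OF _ lim]) auto
qed

text \<open>
  The form of Cesaro's theorem used here: that the averages converge is already known, only their limit
  is to be identified.
\<close>

lemma increments_limit_eq_slope:
  fixes a :: "nat \<Rightarrow> real"
  assumes inc: "(\<lambda>n. a (Suc n) - a n) \<longlonglongrightarrow> L" and lim: "(\<lambda>n. a n / real n) \<longlonglongrightarrow> x"
  shows "L = x"
proof (rule antisym)
  show "L \<le> x"
  proof (rule dense_ge)
    fix y :: real assume y: "x < y"
    show "L \<le> y"
    proof (rule ccontr)
      assume "\<not> L \<le> y"
      then have "\<forall>\<^sub>F n in sequentially. y < a (Suc n) - a n" using order_tendstoD(1)[OF inc] by simp
      then have "y \<le> x" by (intro slope_lower_bound[OF _ lim]) (auto elim: eventually_mono)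
      then show False using y by simp
    qed
  qed
  show "x \<le> L"
  proof (rule dense_le)
    fix y :: real assume y: "y < x"
    show "y \<le> L"
    proof (rule ccontr)
      assume "\<not> y \<le> L"
      then have "\<forall>\<^sub>F n in sequentially. a (Suc n) - a n < y" using order_tendstoD(2)[OF inc] by simp
      then have "\<forall>\<^sub>F n in sequentially. - y \<le> - a (Suc n) - - a n" by (auto elim: eventually_mono)
      moreover have "(\<lambda>n. - a n / real n) \<longlonglongrightarrow> - x" using tendsto_minus[OF lim] by simp
      ultimately have "- y \<le> - x" by (rule slope_lower_bound)
      then show False using y by simp
    qed
  qed
qed

context pa_chain
begin

lemma limit_from_L1:
  fixes Z :: "nat \<Rightarrow> 'w \<Rightarrow> real" and e :: "nat \<Rightarrow> real"
  assumes int: "\<And>n. n\<^sub>0 \<le> n \<Longrightarrow> integrable M (Z n)"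
    and bound: "\<forall>\<^sub>F n in sequentially. expectation (\<lambda>\<omega>. \<bar>Z n \<omega> - z\<bar>) \<le> e n" and e: "e \<longlonglongrightarrow> 0"
  shows "(\<lambda>n. expectation (Z n)) \<longlonglongrightarrow> z"
proof -
  have "\<forall>\<^sub>F n in sequentially. norm (expectation (Z n) - z) \<le> e n"
    using bound eventually_ge_at_top[of n\<^sub>0]
  proof eventually_elim
    case (elim n)
    have "expectation (Z n) - z = expectation (\<lambda>\<omega>. Z n \<omega> - z)"
      using int[OF elim(2)] by (simp add: prob_space)
    then have "\<bar>expectation (Z n) - z\<bar> \<le> expectation (\<lambda>\<omega>. \<bar>Z n \<omega> - z\<bar>)"
      by (simp only: integral_abs_bound)
    then show ?case using elim(1) by simp
  qed
  then have "(\<lambda>n. expectation (Z n) - z) \<longlonglongrightarrow> 0" using e by (rule Lim_null_comparison)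
  then show ?thesis by (simp add: LIM_zero_iff)
qed

context
  fixes p :: "nat \<Rightarrow> nat \<Rightarrow> real"
  assumes lim: "limiting_degree_distribution M \<G> p"
begin

abbreviation (input) fraction where "fraction i j n \<omega> \<equiv> count i j n \<omega> / real (card (verts (\<G> n \<omega>)))"

lemma degree_count_le: "admissible n G \<Longrightarrow> degree_count G i j \<le> card (verts G)"
  unfolding degree_count_def by (intro card_mono) (auto dest: admissibleD)

text \<open>
  Bounded convergence; fractions of nodes lie between 0 and 1.
\<close>

lemma fraction_L1: "(\<lambda>n. expectation (\<lambda>\<omega>. \<bar>fraction i j n \<omega> - p i j\<bar>)) \<longlonglongrightarrow> 0"
proof -
  have "(\<lambda>n. expectation (\<lambda>\<omega>. \<bar>fraction i j (n + n\<^sub>0) \<omega> - p i j\<bar>)) \<longlonglongrightarrow> expectation (\<lambda>_. 0)"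
  proof (rule integral_dominated_convergence[where w = "\<lambda>_. 1 + \<bar>p i j\<bar>"])
    show "AE \<omega> in M. (\<lambda>n. \<bar>fraction i j (n + n\<^sub>0) \<omega> - p i j\<bar>) \<longlonglongrightarrow> 0"
    proof -
      have "AE \<omega> in M. (\<lambda>n. fraction i j n \<omega>) \<longlonglongrightarrow> p i j" using lim by (simp add: limiting_degree_distribution_def)
      then show ?thesis
      proof eventually_elim
        case (elim \<omega>)
        then have "(\<lambda>n. fraction i j n \<omega> - p i j) \<longlonglongrightarrow> 0" by (simp add: LIM_zero)
        then have "(\<lambda>n. \<bar>fraction i j n \<omega> - p i j\<bar>) \<longlonglongrightarrow> 0" by (rule tendsto_rabs_zero)
        then show ?case by (rule LIMSEQ_ignore_initial_segment)
      qed
    qed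
    show "AE \<omega> in M. norm \<bar>fraction i j (n + n\<^sub>0) \<omega> - p i j\<bar> \<le> 1 + \<bar>p i j\<bar>" for n
      using AE_admissible[of "n + n\<^sub>0", simplified]
    proof eventually_elim
      case (elim \<omega>)
      define R where "R = fraction i j (n + n\<^sub>0) \<omega>"
      have "R \<le> 1" "0 \<le> R"
        using degree_count_le[OF elim, of i j] admissibleD(9)[OF elim] by (auto simp: R_def divide_le_eq_1)
      then have "\<bar>R - p i j\<bar> \<le> 1 + \<bar>p i j\<bar>" by linarith
      then show ?case by (simp add: R_def)
    qed
    show "(\<lambda>\<omega>. \<bar>fraction i j (n + n\<^sub>0) \<omega> - p i j\<bar>) \<in> borel_measurable M" for n
      using borel_graph[of "\<lambda>G. \<bar>real (degree_count G i j) / real (card (verts G)) - p i j\<bar>" "n + n\<^sub>0"] .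
  qed auto
  then show ?thesis by (simp add: LIMSEQ_offset[where k = n\<^sub>0])
qed

text \<open>
  A product in which one factor, the fraction, is bounded by 1 and both factors converge in mean.
\<close>

lemma weighted_fraction_limit:
  fixes \<phi> :: "real \<Rightarrow> real"
  assumes lip: "\<And>x. 0 \<le> x \<Longrightarrow> \<bar>\<phi> x - \<phi> (\<alpha> + \<gamma>)\<bar> \<le> \<bar>x - (\<alpha> + \<gamma>)\<bar>"
  shows "(\<lambda>n. expectation (\<lambda>\<omega>. fraction i j n \<omega> * \<phi> (nodes n \<omega> / real n))) \<longlonglongrightarrow> p i j * \<phi> (\<alpha> + \<gamma>)"
proof (rule limit_from_L1)
  let ?\<kappa> = "\<alpha> + \<gamma>"
  let ?e = "\<lambda>n. \<bar>\<phi> ?\<kappa>\<bar> * expectation (\<lambda>\<omega>. \<bar>fraction i j n \<omega> - p i j\<bar>) + expectation (\<lambda>\<omega>. \<bar>nodes n \<omega> / real n - ?\<kappa>\<bar>)"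
  show "integrable M (\<lambda>\<omega>. fraction i j n \<omega> * \<phi> (nodes n \<omega> / real n))" if "n\<^sub>0 \<le> n" for n
    using integrable_graph[OF that, of "\<lambda>G. real (degree_count G i j) / real (card (verts G)) * \<phi> (real (card (verts G)) / real n)"] .
  show "\<forall>\<^sub>F n in sequentially. expectation (\<lambda>\<omega>. \<bar>fraction i j n \<omega> * \<phi> (nodes n \<omega> / real n) - p i j * \<phi> ?\<kappa>\<bar>) \<le> ?e n"
    using eventually_ge_at_top[of n\<^sub>0]
  proof eventually_elim
    case (elim n)
    note int = integrable_graph[OF elim, of "\<lambda>G. \<bar>real (degree_count G i j) / real (card (verts G)) - p i j\<bar>"]
      integrable_graph[OF elim, of "\<lambda>G. \<bar>real (card (verts G)) / real n - ?\<kappa>\<bar>"]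
      integrable_graph[OF elim, of "\<lambda>G. \<bar>real (degree_count G i j) / real (card (verts G)) * \<phi> (real (card (verts G)) / real n) - p i j * \<phi> ?\<kappa>\<bar>"]
    have "expectation (\<lambda>\<omega>. \<bar>fraction i j n \<omega> * \<phi> (nodes n \<omega> / real n) - p i j * \<phi> ?\<kappa>\<bar>)
      \<le> expectation (\<lambda>\<omega>. \<bar>\<phi> ?\<kappa>\<bar> * \<bar>fraction i j n \<omega> - p i j\<bar> + \<bar>nodes n \<omega> / real n - ?\<kappa>\<bar>)"
    proof (rule integral_mono_AE)
      show "AE \<omega> in M. \<bar>fraction i j n \<omega> * \<phi> (nodes n \<omega> / real n) - p i j * \<phi> ?\<kappa>\<bar>
        \<le> \<bar>\<phi> ?\<kappa>\<bar> * \<bar>fraction i j n \<omega> - p i j\<bar> + \<bar>nodes n \<omega> / real n - ?\<kappa>\<bar>"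
        using AE_admissible[OF elim]
      proof eventually_elim
        case (elim \<omega>)
        define R where "R = fraction i j n \<omega>"
        define \<rho> where "\<rho> = nodes n \<omega> / real n"
        have R: "0 \<le> R" "R \<le> 1" unfolding R_def
          using degree_count_le[OF elim, of i j] admissibleD(9)[OF elim] by (auto simp: divide_le_eq_1)
        have "\<bar>R * \<phi> \<rho> - p i j * \<phi> ?\<kappa>\<bar> = \<bar>\<phi> ?\<kappa> * (R - p i j) + R * (\<phi> \<rho> - \<phi> ?\<kappa>)\<bar>"
          by (simp add: algebra_simps)
        also have "\<dots> \<le> \<bar>\<phi> ?\<kappa>\<bar> * \<bar>R - p i j\<bar> + R * \<bar>\<phi> \<rho> - \<phi> ?\<kappa>\<bar>"
          using R by (intro order_trans[OF abs_triangle_ineq]) (simp add: abs_mult)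
        also have "R * \<bar>\<phi> \<rho> - \<phi> ?\<kappa>\<bar> \<le> 1 * \<bar>\<rho> - ?\<kappa>\<bar>"
          using R by (intro mult_mono lip) (auto simp: \<rho>_def)
        finally show ?case by (simp add: R_def \<rho>_def)
      qed
    qed (use int in auto)
    also have "\<dots> = ?e n" using int by (simp del: abs_divide)
    finally show ?case .
  qed
  have "?e \<longlonglongrightarrow> \<bar>\<phi> ?\<kappa>\<bar> * 0 + 0"
    by (intro tendsto_intros fraction_L1 node_fraction_L1)
  then show "?e \<longlonglongrightarrow> 0" by simp
qed

lemma count_per_edge_limit:
  "(\<lambda>n. expectation (\<lambda>\<omega>. count i j n \<omega>) / real n) \<longlonglongrightarrow> p i j * (\<alpha> + \<gamma>)"
proof (rule Lim_transform_eventually[OF weighted_fraction_limit[where \<phi> = "\<lambda>x. x"]])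
  show "\<forall>\<^sub>F n in sequentially. expectation (\<lambda>\<omega>. fraction i j n \<omega> * (nodes n \<omega> / real n))
      = expectation (\<lambda>\<omega>. count i j n \<omega>) / real n"
    using eventually_ge_at_top[of n\<^sub>0]
  proof eventually_elim
    case (elim n)
    have "expectation (\<lambda>\<omega>. fraction i j n \<omega> * (nodes n \<omega> / real n)) = expectation (\<lambda>\<omega>. count i j n \<omega> / real n)"
    proof (rule integral_cong_AE)
      show "AE \<omega> in M. fraction i j n \<omega> * (nodes n \<omega> / real n) = count i j n \<omega> / real n"
        using AE_admissible[OF elim] by eventually_elim (simp add: admissibleD(9))
    qed (rule borel_graph)+
    then show ?case by simp
  qed
qed simp

text \<open>
  The quotient is the fraction times \<open>\<rho> / (1 + \<delta> \<rho>)\<close> with \<open>\<rho> = N / n\<close>, which is a Lipschitz function on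
  \<open>[0, \<infinity>)\<close> with constant 1.
\<close>

lemma count_over_weight_limit:
  assumes \<delta>: "0 < \<delta>"
  shows "(\<lambda>n. expectation (\<lambda>\<omega>. count i j n \<omega> / (real n + \<delta> * nodes n \<omega>)))
     \<longlonglongrightarrow> p i j * ((\<alpha> + \<gamma>) / (1 + \<delta> * (\<alpha> + \<gamma>)))"
proof (rule Lim_transform_eventually[OF weighted_fraction_limit[where \<phi> = "\<lambda>x. x / (1 + \<delta> * x)"]])
  fix x :: real assume x: "0 \<le> x"
  define y where "y = \<alpha> + \<gamma>"
  have pos: "1 \<le> 1 + \<delta> * x" "1 \<le> 1 + \<delta> * y" using x \<delta> rates by (auto simp: y_def)
  have "x / (1 + \<delta> * x) - y / (1 + \<delta> * y) = (x - y) / ((1 + \<delta> * x) * (1 + \<delta> * y))"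
    using pos by (simp add: divide_simps) (simp add: algebra_simps)
  then have "\<bar>x / (1 + \<delta> * x) - y / (1 + \<delta> * y)\<bar> = \<bar>x - y\<bar> / ((1 + \<delta> * x) * (1 + \<delta> * y))" using pos by (simp add: abs_mult)
  also have "\<dots> \<le> \<bar>x - y\<bar> / 1"
    using pos mult_mono[of 1 "1 + \<delta> * x" 1 "1 + \<delta> * y"] by (intro divide_left_mono) auto
  finally show "\<bar>x / (1 + \<delta> * x) - (\<alpha> + \<gamma>) / (1 + \<delta> * (\<alpha> + \<gamma>))\<bar> \<le> \<bar>x - (\<alpha> + \<gamma>)\<bar>" by (simp add: y_def)
next
  show "\<forall>\<^sub>F n in sequentially. expectation (\<lambda>\<omega>. fraction i j n \<omega> * (nodes n \<omega> / real n / (1 + \<delta> * (nodes n \<omega> / real n))))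
      = expectation (\<lambda>\<omega>. count i j n \<omega> / (real n + \<delta> * nodes n \<omega>))"
    using eventually_ge_at_top[of n\<^sub>0] eventually_gt_at_top[of 0]
  proof eventually_elim
    case (elim n)
    have eq: "fraction i j n \<omega> * (nodes n \<omega> / real n / (1 + \<delta> * (nodes n \<omega> / real n)))
        = count i j n \<omega> / (real n + \<delta> * nodes n \<omega>)" if "admissible n (\<G> n \<omega>)" for \<omega>
    proof -
      have "1 + \<delta> * (nodes n \<omega> / real n) = (real n + \<delta> * nodes n \<omega>) / real n" using elim by (simp add: add_divide_distrib)
      then show ?thesis using elim admissibleD(9)[OF that] by simp
    qed
    show ?case
    proof (rule integral_cong_AE)
      show "AE \<omega> in M. fraction i j n \<omega> * (nodes n \<omega> / real n / (1 + \<delta> * (nodes n \<omega> / real n)))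
        = count i j n \<omega> / (real n + \<delta> * nodes n \<omega>)"
        using AE_admissible[OF elim(1)] by (rule eventually_mono) (rule eq)
    qed (rule borel_graph)+
  qed
qed

text \<open>
  Every term of the one-step expectation is a constant, a linear combination of quotients whose means
  converge, or the vanishing loop correction.
\<close>

lemma expected_increment_limit:
  "(\<lambda>n. expectation (\<lambda>\<omega>. real (degree_count (\<G> (Suc n) \<omega>) i j)) - expectation (\<lambda>\<omega>. count i j n \<omega>))
    \<longlonglongrightarrow> \<alpha> * has_degrees i j 0 1 + \<gamma> * has_degrees i j 1 0
      + (\<alpha> + \<beta>) * ((flow \<delta>\<^sub>i\<^sub>n (\<lambda>k. p k j) i) * ((\<alpha> + \<gamma>) / (1 + \<delta>\<^sub>i\<^sub>n * (\<alpha> + \<gamma>))))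
      + (\<beta> + \<gamma>) * ((flow \<delta>\<^sub>o\<^sub>u\<^sub>t (\<lambda>k. p i k) j) * ((\<alpha> + \<gamma>) / (1 + \<delta>\<^sub>o\<^sub>u\<^sub>t * (\<alpha> + \<gamma>))))"
    (is "_ \<longlonglongrightarrow> ?L")
proof -
  define W where "W \<delta> i j n = expectation (\<lambda>\<omega>. count i j n \<omega> / (real n + \<delta> * nodes n \<omega>))" for \<delta> i j n
  define Lo where "Lo G = (\<Sum>v\<in>verts G. out_choice \<delta>\<^sub>o\<^sub>u\<^sub>t G v * (in_choice \<delta>\<^sub>i\<^sub>n G v * loop_defect i j G v))" for G
  define E where "E n = expectation (\<lambda>\<omega>. Lo (\<G> n \<omega>))" for n
  define T where "T \<delta> i j n G = real (degree_count G i j) / (real n + \<delta> * real (card (verts G)))" for \<delta> i j n and G :: pa_graph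
  define In where "In n G = (real i - 1 + \<delta>\<^sub>i\<^sub>n) * prev (\<lambda>k. T \<delta>\<^sub>i\<^sub>n k j n G) i - (real i + \<delta>\<^sub>i\<^sub>n) * T \<delta>\<^sub>i\<^sub>n i j n G" for n G
  define Out where "Out n G = (real j - 1 + \<delta>\<^sub>o\<^sub>u\<^sub>t) * prev (\<lambda>k. T \<delta>\<^sub>o\<^sub>u\<^sub>t i k n G) j - (real j + \<delta>\<^sub>o\<^sub>u\<^sub>t) * T \<delta>\<^sub>o\<^sub>u\<^sub>t i j n G" for n G
  have st: "step G (\<lambda>H. real (degree_count H i j)) = real (degree_count G i j) + \<alpha> * has_degrees i j 0 1 + \<gamma> * has_degrees i j 1 0
      + (\<alpha> + \<beta>) * In n G + (\<beta> + \<gamma>) * Out n G + \<beta> * Lo G" if G: "admissible n G" for n G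
  proof -
    have in_eq: "(\<Sum>w\<in>verts G. in_choice \<delta>\<^sub>i\<^sub>n G w * in_gain i j G w) = In n G"
      unfolding sum_in_gain[OF G] In_def T_def by (cases i) (simp_all add: diff_divide_distrib)
    have out_eq: "(\<Sum>w\<in>verts G. out_choice \<delta>\<^sub>o\<^sub>u\<^sub>t G w * out_gain i j G w) = Out n G"
      unfolding sum_out_gain[OF G] Out_def T_def by (cases j) (simp_all add: diff_divide_distrib)
    have "step G (\<lambda>H. real (degree_count H i j)) = \<alpha> * (real (degree_count G i j) + has_degrees i j 0 1)
      + \<beta> * real (degree_count G i j) + \<gamma> * (real (degree_count G i j) + has_degrees i j 1 0)
      + (\<alpha> + \<beta>) * In n G + (\<beta> + \<gamma>) * Out n G + \<beta> * Lo G"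
      unfolding in_eq[symmetric] out_eq[symmetric] Lo_def
      by (rule step_by_cases[OF G]) (auto simp: degree_count_add_edge[OF G])
    also have "\<dots> = (\<alpha> + \<beta> + \<gamma>) * real (degree_count G i j) + \<alpha> * has_degrees i j 0 1 + \<gamma> * has_degrees i j 1 0
      + (\<alpha> + \<beta>) * In n G + (\<beta> + \<gamma>) * Out n G + \<beta> * Lo G" by (simp add: algebra_simps)
    finally show ?thesis unfolding rates(4) by simp
  qed
  have E_lim: "E \<longlonglongrightarrow> 0"
  proof (rule Lim_null_comparison)
    show "\<forall>\<^sub>F n in sequentially. norm (E n) \<le> 4 * (real i + \<delta>\<^sub>i\<^sub>n) * inverse (real n)"
      using eventually_ge_at_top[of n\<^sub>0] eventually_gt_at_top[of 0]
    proof eventually_elim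
      case (elim n)
      have "\<bar>E n\<bar> \<le> expectation (\<lambda>\<omega>. \<bar>Lo (\<G> n \<omega>)\<bar>)" unfolding E_def by (rule integral_abs_bound)
      also have "\<dots> \<le> expectation (\<lambda>_. 4 * (real i + \<delta>\<^sub>i\<^sub>n) / real n)"
        using integrable_graph[OF elim(1), of "\<lambda>G. \<bar>Lo G\<bar>"] AE_admissible[OF elim(1)] loop_correction_small[OF _ elim(2)]
        by (intro integral_mono_AE) (auto simp: Lo_def elim!: eventually_mono)
      finally show ?case by (simp add: prob_space divide_inverse)
    qed
    have "(\<lambda>n. 4 * (real i + \<delta>\<^sub>i\<^sub>n) * inverse (real n)) \<longlonglongrightarrow> 4 * (real i + \<delta>\<^sub>i\<^sub>n) * 0"
      by (intro tendsto_intros lim_inverse_n)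
    then show "(\<lambda>n. 4 * (real i + \<delta>\<^sub>i\<^sub>n) * inverse (real n)) \<longlonglongrightarrow> 0" by simp
  qed
  have eq: "\<forall>\<^sub>F n in sequentially. \<alpha> * has_degrees i j 0 1 + \<gamma> * has_degrees i j 1 0
      + (\<alpha> + \<beta>) * (flow \<delta>\<^sub>i\<^sub>n (\<lambda>k. W \<delta>\<^sub>i\<^sub>n k j n) i)
      + (\<beta> + \<gamma>) * (flow \<delta>\<^sub>o\<^sub>u\<^sub>t (\<lambda>k. W \<delta>\<^sub>o\<^sub>u\<^sub>t i k n) j)
      + \<beta> * E n
     = expectation (\<lambda>\<omega>. real (degree_count (\<G> (Suc n) \<omega>) i j)) - expectation (\<lambda>\<omega>. count i j n \<omega>)"
    using eventually_ge_at_top[of n\<^sub>0]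
  proof eventually_elim
    case (elim n)
    note int = integrable_graph[OF elim]
    have W: "W \<delta> i j n = expectation (\<lambda>\<omega>. T \<delta> i j n (\<G> n \<omega>))" for \<delta> i j by (simp add: W_def T_def)
    have I: "expectation (\<lambda>\<omega>. In n (\<G> n \<omega>)) = flow \<delta>\<^sub>i\<^sub>n (\<lambda>k. W \<delta>\<^sub>i\<^sub>n k j n) i"
      unfolding In_def W using int[of "T \<delta>\<^sub>i\<^sub>n i j n"] int[of "T \<delta>\<^sub>i\<^sub>n (i - 1) j n"] by (cases i) simp_all
    have O: "expectation (\<lambda>\<omega>. Out n (\<G> n \<omega>)) = flow \<delta>\<^sub>o\<^sub>u\<^sub>t (\<lambda>k. W \<delta>\<^sub>o\<^sub>u\<^sub>t i k n) j"
      unfolding Out_def W using int[of "T \<delta>\<^sub>o\<^sub>u\<^sub>t i j n"] int[of "T \<delta>\<^sub>o\<^sub>u\<^sub>t i (j - 1) n"] by (cases j) simp_all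
    have "expectation (\<lambda>\<omega>. real (degree_count (\<G> (Suc n) \<omega>) i j)) = expectation (\<lambda>\<omega>. step (\<G> n \<omega>) (\<lambda>H. real (degree_count H i j)))"
      by (rule expectation_step[OF elim])
    also have "\<dots> = expectation (\<lambda>\<omega>. count i j n \<omega> + \<alpha> * has_degrees i j 0 1 + \<gamma> * has_degrees i j 1 0
      + (\<alpha> + \<beta>) * In n (\<G> n \<omega>) + (\<beta> + \<gamma>) * Out n (\<G> n \<omega>) + \<beta> * Lo (\<G> n \<omega>))"
      using AE_admissible[OF elim] st borel_graph by (intro integral_cong_AE) (auto elim!: eventually_mono)
    also have "\<dots> = expectation (\<lambda>\<omega>. count i j n \<omega>) + \<alpha> * has_degrees i j 0 1 + \<gamma> * has_degrees i j 1 0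
      + (\<alpha> + \<beta>) * expectation (\<lambda>\<omega>. In n (\<G> n \<omega>)) + (\<beta> + \<gamma>) * expectation (\<lambda>\<omega>. Out n (\<G> n \<omega>)) + \<beta> * E n"
      unfolding E_def using int[of "\<lambda>G. real (degree_count G i j)"] int[of "In n"] int[of "Out n"] int[of Lo]
      by (simp add: prob_space)
    finally show ?case unfolding I O by simp
  qed
  have W_lim: "W \<delta> i j \<longlonglongrightarrow> p i j * ((\<alpha> + \<gamma>) / (1 + \<delta> * (\<alpha> + \<gamma>)))" if "0 < \<delta>" for \<delta> i j
    using count_over_weight_limit[OF that] by (simp add: W_def[abs_def])
  have pI: "(\<lambda>n. prev (\<lambda>k. W \<delta>\<^sub>i\<^sub>n k j n) i) \<longlonglongrightarrow> prev (\<lambda>k. p k j) i * ((\<alpha> + \<gamma>) / (1 + \<delta>\<^sub>i\<^sub>n * (\<alpha> + \<gamma>)))"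
    using W_lim[OF \<delta>_pos(1), of "i - 1" j] by (cases i) simp_all
  have pO: "(\<lambda>n. prev (\<lambda>k. W \<delta>\<^sub>o\<^sub>u\<^sub>t i k n) j) \<longlonglongrightarrow> prev (\<lambda>k. p i k) j * ((\<alpha> + \<gamma>) / (1 + \<delta>\<^sub>o\<^sub>u\<^sub>t * (\<alpha> + \<gamma>)))"
    using W_lim[OF \<delta>_pos(2), of i "j - 1"] by (cases j) simp_all
  have "(\<lambda>n. \<alpha> * has_degrees i j 0 1 + \<gamma> * has_degrees i j 1 0
      + (\<alpha> + \<beta>) * (flow \<delta>\<^sub>i\<^sub>n (\<lambda>k. W \<delta>\<^sub>i\<^sub>n k j n) i)
      + (\<beta> + \<gamma>) * (flow \<delta>\<^sub>o\<^sub>u\<^sub>t (\<lambda>k. W \<delta>\<^sub>o\<^sub>u\<^sub>t i k n) j)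
      + \<beta> * E n) \<longlonglongrightarrow> \<alpha> * has_degrees i j 0 1 + \<gamma> * has_degrees i j 1 0
      + (\<alpha> + \<beta>) * ((real i - 1 + \<delta>\<^sub>i\<^sub>n) * (prev (\<lambda>k. p k j) i * ((\<alpha> + \<gamma>) / (1 + \<delta>\<^sub>i\<^sub>n * (\<alpha> + \<gamma>)))) - (real i + \<delta>\<^sub>i\<^sub>n) * (p i j * ((\<alpha> + \<gamma>) / (1 + \<delta>\<^sub>i\<^sub>n * (\<alpha> + \<gamma>)))))
      + (\<beta> + \<gamma>) * ((real j - 1 + \<delta>\<^sub>o\<^sub>u\<^sub>t) * (prev (\<lambda>k. p i k) j * ((\<alpha> + \<gamma>) / (1 + \<delta>\<^sub>o\<^sub>u\<^sub>t * (\<alpha> + \<gamma>)))) - (real j + \<delta>\<^sub>o\<^sub>u\<^sub>t) * (p i j * ((\<alpha> + \<gamma>) / (1 + \<delta>\<^sub>o\<^sub>u\<^sub>t * (\<alpha> + \<gamma>)))))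
      + \<beta> * 0"
    by (intro tendsto_intros pI pO E_lim W_lim \<delta>_pos)
  also have "\<alpha> * has_degrees i j 0 1 + \<gamma> * has_degrees i j 1 0
      + (\<alpha> + \<beta>) * ((real i - 1 + \<delta>\<^sub>i\<^sub>n) * (prev (\<lambda>k. p k j) i * ((\<alpha> + \<gamma>) / (1 + \<delta>\<^sub>i\<^sub>n * (\<alpha> + \<gamma>)))) - (real i + \<delta>\<^sub>i\<^sub>n) * (p i j * ((\<alpha> + \<gamma>) / (1 + \<delta>\<^sub>i\<^sub>n * (\<alpha> + \<gamma>)))))
      + (\<beta> + \<gamma>) * ((real j - 1 + \<delta>\<^sub>o\<^sub>u\<^sub>t) * (prev (\<lambda>k. p i k) j * ((\<alpha> + \<gamma>) / (1 + \<delta>\<^sub>o\<^sub>u\<^sub>t * (\<alpha> + \<gamma>)))) - (real j + \<delta>\<^sub>o\<^sub>u\<^sub>t) * (p i j * ((\<alpha> + \<gamma>) / (1 + \<delta>\<^sub>o\<^sub>u\<^sub>t * (\<alpha> + \<gamma>)))))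
      + \<beta> * 0 = ?L" by (simp only: left_diff_distrib mult.assoc mult_zero_right add_0_right)
  finally show ?thesis by (rule Lim_transform_eventually[OF _ eq])
qed

text \<open>
  The expected count grows with asymptotic slope \<open>p i j (\<alpha> + \<gamma>)\<close>, and its increments converge to an
  expression that is linear in \<open>p\<close>; equate the two and divide by \<open>\<alpha> + \<gamma>\<close>.
\<close>

proposition degree_recursion:
  assumes "\<beta> < 1"
  shows "p i j = \<alpha> / (\<alpha> + \<gamma>) * has_degrees i j 0 1 + \<gamma> / (\<alpha> + \<gamma>) * has_degrees i j 1 0
      + (\<alpha> + \<beta>) / (1 + \<delta>\<^sub>i\<^sub>n * (\<alpha> + \<gamma>)) * (flow \<delta>\<^sub>i\<^sub>n (\<lambda>k. p k j) i)
      + (\<beta> + \<gamma>) / (1 + \<delta>\<^sub>o\<^sub>u\<^sub>t * (\<alpha> + \<gamma>)) * (flow \<delta>\<^sub>o\<^sub>u\<^sub>t (\<lambda>k. p i k) j)"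
proof -
  define \<kappa> where "\<kappa> = \<alpha> + \<gamma>"
  have \<kappa>: "0 < \<kappa>" using assms rates by (simp add: \<kappa>_def)
  define A where "A = flow \<delta>\<^sub>i\<^sub>n (\<lambda>k. p k j) i"
  define B where "B = flow \<delta>\<^sub>o\<^sub>u\<^sub>t (\<lambda>k. p i k) j"
  have "\<alpha> * has_degrees i j 0 1 + \<gamma> * has_degrees i j 1 0 + (\<alpha> + \<beta>) * (A * (\<kappa> / (1 + \<delta>\<^sub>i\<^sub>n * \<kappa>)))
      + (\<beta> + \<gamma>) * (B * (\<kappa> / (1 + \<delta>\<^sub>o\<^sub>u\<^sub>t * \<kappa>))) = p i j * \<kappa>"
    unfolding A_def B_def \<kappa>_def
    by (rule increments_limit_eq_slope[OF expected_increment_limit count_per_edge_limit])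
  then have "p i j = (\<alpha> * has_degrees i j 0 1 + \<gamma> * has_degrees i j 1 0 + (\<alpha> + \<beta>) * (A * (\<kappa> / (1 + \<delta>\<^sub>i\<^sub>n * \<kappa>)))
      + (\<beta> + \<gamma>) * (B * (\<kappa> / (1 + \<delta>\<^sub>o\<^sub>u\<^sub>t * \<kappa>)))) / \<kappa>" using \<kappa> by simp
  also have "\<dots> = \<alpha> / \<kappa> * has_degrees i j 0 1 + \<gamma> / \<kappa> * has_degrees i j 1 0
      + (\<alpha> + \<beta>) / (1 + \<delta>\<^sub>i\<^sub>n * \<kappa>) * A + (\<beta> + \<gamma>) / (1 + \<delta>\<^sub>o\<^sub>u\<^sub>t * \<kappa>) * B"
  proof -
    have "(x + y + u * (A * (\<kappa> / d)) + v * (B * (\<kappa> / d'))) / \<kappa> = x / \<kappa> + y / \<kappa> + u / d * A + v / d' * B" for x y u v d d' :: real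
      using \<kappa> by (simp add: add_divide_distrib)
    then show ?thesis by simp
  qed
  finally show ?thesis unfolding A_def B_def \<kappa>_def .
qed

end

end


section \<open>Limiting degrees and the theorem\<close>

lemma pmf_shift:
  "pmf (map_pmf (\<lambda>q. (Suc (fst q), snd q)) Y) (i, j) = prev (\<lambda>k. pmf Y (k, j)) i"
  "pmf (map_pmf (\<lambda>q. (fst q, Suc (snd q))) Y) (i, j) = prev (\<lambda>k. pmf Y (i, k)) j"
proof -
  have inj: "inj (\<lambda>q :: nat \<times> nat. (Suc (fst q), snd q))" "inj (\<lambda>q :: nat \<times> nat. (fst q, Suc (snd q)))"
    by (auto simp: inj_def)
  show "pmf (map_pmf (\<lambda>q. (Suc (fst q), snd q)) Y) (i, j) = prev (\<lambda>k. pmf Y (k, j)) i"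
  proof (cases i)
    case (Suc k)
    then show ?thesis using pmf_map_inj'[OF inj(1), of Y "(k, j)"] by simp
  qed (auto intro!: pmf_map_outside)
  show "pmf (map_pmf (\<lambda>q. (fst q, Suc (snd q))) Y) (i, j) = prev (\<lambda>k. pmf Y (i, k)) j"
  proof (cases j)
    case (Suc k)
    then show ?thesis using pmf_map_inj'[OF inj(2), of Y "(i, k)"] by simp
  qed (auto intro!: pmf_map_outside)
qed

text \<open>
  Both sides solve the recursion: shifting the first coordinate turns the rate \<open>r + i - 1\<close> with
  \<open>r = \<delta>\<^sub>i\<^sub>n + 1\<close> into the attachment rate \<open>\<delta>\<^sub>i\<^sub>n + i - 1\<close>, and similarly for the second.  The difference
  solves the homogeneous recursion, which determines the value at \<open>(i, j)\<close> from those at \<open>(i - 1, j)\<close>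
  and \<open>(i, j - 1)\<close> because the coefficient of the value itself is positive; hence it vanishes.
\<close>

lemma (in pa_chain) limiting_degrees_are_yule_mixture:
  assumes lim: "limiting_degree_distribution M \<G> p" and "\<alpha> < 1" "\<beta> < 1" "\<gamma> < 1"
    and c: "c = (\<alpha> + \<beta>) / (1 + \<delta>\<^sub>i\<^sub>n * (\<alpha> + \<gamma>))" and ac: "a * c = (\<beta> + \<gamma>) / (1 + \<delta>\<^sub>o\<^sub>u\<^sub>t * (\<alpha> + \<gamma>))"
    and pos: "0 < c" "0 < a"
  shows "p i j = \<gamma> / (\<alpha> + \<gamma>) * pmf (map_pmf (\<lambda>q. (Suc (fst q), snd q)) (yule_pmf c a (\<delta>\<^sub>i\<^sub>n + 1) \<delta>\<^sub>o\<^sub>u\<^sub>t)) (i, j)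
        + \<alpha> / (\<alpha> + \<gamma>) * pmf (map_pmf (\<lambda>q. (fst q, Suc (snd q))) (yule_pmf c a \<delta>\<^sub>i\<^sub>n (\<delta>\<^sub>o\<^sub>u\<^sub>t + 1))) (i, j)"
proof -
  define y where "y i j = pmf (yule_pmf c a (\<delta>\<^sub>i\<^sub>n + 1) \<delta>\<^sub>o\<^sub>u\<^sub>t) (i, j)" for i j
  define y' where "y' i j = pmf (yule_pmf c a \<delta>\<^sub>i\<^sub>n (\<delta>\<^sub>o\<^sub>u\<^sub>t + 1)) (i, j)" for i j
  define m where "m i j = prev (\<lambda>k. y k j) i" for i j
  define m' where "m' i j = prev (\<lambda>k. y' i k) j" for i j
  define d where "d = a * c"
  have d: "0 < d" using pos by (simp add: d_def)
  have y: "y i j = of_bool (i = 0 \<and> j = 0) + c * ((\<delta>\<^sub>i\<^sub>n + real i) * prev (\<lambda>k. y k j) i - (\<delta>\<^sub>i\<^sub>n + 1 + real i) * y i j)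
      + d * ((\<delta>\<^sub>o\<^sub>u\<^sub>t + real j - 1) * prev (\<lambda>k. y i k) j - (\<delta>\<^sub>o\<^sub>u\<^sub>t + real j) * y i j)" for i j
    using yule_pmf_recursion[OF pos, of "\<delta>\<^sub>i\<^sub>n + 1" \<delta>\<^sub>o\<^sub>u\<^sub>t i j] \<delta>_pos unfolding y_def d_def by simp
  have y': "y' i j = of_bool (i = 0 \<and> j = 0) + c * ((\<delta>\<^sub>i\<^sub>n + real i - 1) * prev (\<lambda>k. y' k j) i - (\<delta>\<^sub>i\<^sub>n + real i) * y' i j)
      + d * ((\<delta>\<^sub>o\<^sub>u\<^sub>t + real j) * prev (\<lambda>k. y' i k) j - (\<delta>\<^sub>o\<^sub>u\<^sub>t + 1 + real j) * y' i j)" for i j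
    using yule_pmf_recursion[OF pos, of \<delta>\<^sub>i\<^sub>n "\<delta>\<^sub>o\<^sub>u\<^sub>t + 1" i j] \<delta>_pos unfolding y'_def d_def by simp
  have m: "m i j = has_degrees i j 1 0 + c * (flow \<delta>\<^sub>i\<^sub>n (\<lambda>k. m k j) i)
      + d * (flow \<delta>\<^sub>o\<^sub>u\<^sub>t (\<lambda>k. m i k) j)" for i j
  proof (cases i)
    case 0
    then show ?thesis by (cases j) (simp_all add: m_def has_degrees_def)
  next
    case (Suc k)
    have "prev (\<lambda>l. m (Suc k) l) j = prev (\<lambda>l. y k l) j" by (cases j) (simp_all add: m_def)
    moreover have "prev (\<lambda>l. m l j) (Suc k) = prev (\<lambda>l. y l j) k" by (simp add: m_def)
    moreover have "m (Suc k) j = y k j" by (simp add: m_def)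
    moreover have "has_degrees (Suc k) j 1 0 = of_bool (k = 0 \<and> j = 0)" by (auto simp: has_degrees_def)
    ultimately show ?thesis using y[of k j] unfolding Suc by (simp add: algebra_simps)
  qed
  have m': "m' i j = has_degrees i j 0 1 + c * (flow \<delta>\<^sub>i\<^sub>n (\<lambda>k. m' k j) i)
      + d * (flow \<delta>\<^sub>o\<^sub>u\<^sub>t (\<lambda>k. m' i k) j)" for i j
  proof (cases j)
    case 0
    then show ?thesis by (cases i) (simp_all add: m'_def has_degrees_def)
  next
    case (Suc k)
    have "prev (\<lambda>l. m' l (Suc k)) i = prev (\<lambda>l. y' l k) i" by (cases i) (simp_all add: m'_def)
    moreover have "prev (\<lambda>l. m' i l) (Suc k) = prev (\<lambda>l. y' i l) k" by (simp add: m'_def)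
    moreover have "m' i (Suc k) = y' i k" by (simp add: m'_def)
    moreover have "has_degrees i (Suc k) 0 1 = of_bool (i = 0 \<and> k = 0)" by (auto simp: has_degrees_def)
    ultimately show ?thesis using y'[of i k] unfolding Suc by (simp add: algebra_simps)
  qed
  define u where "u = \<gamma> / (\<alpha> + \<gamma>)"
  define u' where "u' = \<alpha> / (\<alpha> + \<gamma>)"
  define e where "e i j = p i j - (u * m i j + u' * m' i j)" for i j
  have p: "p i j = u' * has_degrees i j 0 1 + u * has_degrees i j 1 0
      + c * (flow \<delta>\<^sub>i\<^sub>n (\<lambda>k. p k j) i)
      + d * (flow \<delta>\<^sub>o\<^sub>u\<^sub>t (\<lambda>k. p i k) j)" for i j
    using degree_recursion[OF lim \<open>\<beta> < 1\<close>, of i j] unfolding u_def u'_def d_def ac unfolding c .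
  have e_rec: "e i j = c * (flow \<delta>\<^sub>i\<^sub>n (\<lambda>k. e k j) i)
      + d * (flow \<delta>\<^sub>o\<^sub>u\<^sub>t (\<lambda>k. e i k) j)" for i j
  proof -
    have lin1: "prev (\<lambda>k. e k j) i = prev (\<lambda>k. p k j) i - (u * prev (\<lambda>k. m k j) i + u' * prev (\<lambda>k. m' k j) i)"
      by (cases i) (simp_all add: e_def)
    have lin2: "prev (\<lambda>k. e i k) j = prev (\<lambda>k. p i k) j - (u * prev (\<lambda>k. m i k) j + u' * prev (\<lambda>k. m' i k) j)"
      by (cases j) (simp_all add: e_def)
    have "e i j = (u' * has_degrees i j 0 1 + u * has_degrees i j 1 0
      + c * (flow \<delta>\<^sub>i\<^sub>n (\<lambda>k. p k j) i)
      + d * (flow \<delta>\<^sub>o\<^sub>u\<^sub>t (\<lambda>k. p i k) j))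
      - (u * (has_degrees i j 1 0 + c * (flow \<delta>\<^sub>i\<^sub>n (\<lambda>k. m k j) i)
      + d * (flow \<delta>\<^sub>o\<^sub>u\<^sub>t (\<lambda>k. m i k) j))
      + u' * (has_degrees i j 0 1 + c * (flow \<delta>\<^sub>i\<^sub>n (\<lambda>k. m' k j) i)
      + d * (flow \<delta>\<^sub>o\<^sub>u\<^sub>t (\<lambda>k. m' i k) j)))"
      unfolding e_def using p[of i j] m[of i j] m'[of i j] by presburger
    also have "\<dots> = c * (flow \<delta>\<^sub>i\<^sub>n (\<lambda>k. e k j) i)
      + d * (flow \<delta>\<^sub>o\<^sub>u\<^sub>t (\<lambda>k. e i k) j)"
      unfolding lin1 lin2 e_def[of i j] by algebra
    finally show ?thesis .
  qed
  have "e i j = 0" for i j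
  proof (induction "i + j" arbitrary: i j rule: less_induct)
    case less
    have "prev (\<lambda>k. e k j) i = 0" using less[of "i - 1" j] by (cases i) auto
    moreover have "prev (\<lambda>k. e i k) j = 0" using less[of i "j - 1"] by (cases j) auto
    ultimately have "e i j * (1 + c * (real i + \<delta>\<^sub>i\<^sub>n) + d * (real j + \<delta>\<^sub>o\<^sub>u\<^sub>t)) = 0"
      using e_rec[of i j] by (simp add: algebra_simps)
    moreover have "0 < 1 + c * (real i + \<delta>\<^sub>i\<^sub>n) + d * (real j + \<delta>\<^sub>o\<^sub>u\<^sub>t)"
      using pos d \<delta>_pos by (intro add_pos_nonneg) auto
    ultimately show ?case by (metis mult_eq_0_iff less_irrefl)
  qed
  then show ?thesis by (simp add: pmf_shift e_def m_def m'_def y_def y'_def u_def u'_def)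
qed

lemma density1_eq: "density1 c a \<delta> \<delta>' = limit_density c a (\<delta> + 1) \<delta>'"
  by (intro ext) (simp add: density1_def limit_density_def algebra_simps)

lemma density2_eq: "density2 c a \<delta> \<delta>' = limit_density c a \<delta> (\<delta>' + 1)"
  by (intro ext) (simp add: density2_def limit_density_def algebra_simps)

theorem theorem3:
  fixes \<alpha> \<beta> \<gamma> \<delta>\<^sub>i\<^sub>n \<delta>\<^sub>o\<^sub>u\<^sub>t \<alpha>\<^sub>i\<^sub>n \<alpha>\<^sub>o\<^sub>u\<^sub>t c\<^sub>1 c\<^sub>2 a :: real
    and M\<^sub>1 :: "'a measure" and X\<^sub>1 Y\<^sub>1 :: "'a \<Rightarrow> nat"
    and M\<^sub>2 :: "'b measure" and X\<^sub>2 Y\<^sub>2 :: "'b \<Rightarrow> nat"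
  assumes "\<alpha> \<ge> 0" "\<beta> \<ge> 0" "\<gamma> \<ge> 0" "\<alpha> + \<beta> + \<gamma> = 1"
    and "\<alpha> < 1" "\<beta> < 1" "\<gamma> < 1"
    and "\<delta>\<^sub>i\<^sub>n > 0" "\<delta>\<^sub>o\<^sub>u\<^sub>t > 0"
    and "\<alpha>\<^sub>i\<^sub>n = 1 + (1 + \<delta>\<^sub>i\<^sub>n * (\<alpha> + \<gamma>)) / (\<alpha> + \<beta>)"
    and "\<alpha>\<^sub>o\<^sub>u\<^sub>t = 1 + (1 + \<delta>\<^sub>o\<^sub>u\<^sub>t * (\<alpha> + \<gamma>)) / (\<gamma> + \<beta>)"
    and "c\<^sub>1 = 1 / (\<alpha>\<^sub>i\<^sub>n - 1)" "c\<^sub>2 = 1 / (\<alpha>\<^sub>o\<^sub>u\<^sub>t - 1)" "a = c\<^sub>2 / c\<^sub>1"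
    and "prob_space M\<^sub>1"
    and "X\<^sub>1 \<in> measurable M\<^sub>1 (count_space UNIV)" "Y\<^sub>1 \<in> measurable M\<^sub>1 (count_space UNIV)"
    and "has_joint_pgf M\<^sub>1 X\<^sub>1 Y\<^sub>1 (phi1 c\<^sub>1 a \<delta>\<^sub>i\<^sub>n \<delta>\<^sub>o\<^sub>u\<^sub>t)"
    and "prob_space M\<^sub>2"
    and "X\<^sub>2 \<in> measurable M\<^sub>2 (count_space UNIV)" "Y\<^sub>2 \<in> measurable M\<^sub>2 (count_space UNIV)"
    and "has_joint_pgf M\<^sub>2 X\<^sub>2 Y\<^sub>2 (phi2 c\<^sub>1 a \<delta>\<^sub>i\<^sub>n \<delta>\<^sub>o\<^sub>u\<^sub>t)"
  shows "\<exists>V\<^sub>1 V\<^sub>2.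
      radon_measure_on punctured_quadrant V\<^sub>1 \<and>
      radon_measure_on punctured_quadrant V\<^sub>2 \<and>
      vague_convergence punctured_quadrant
        (scaled_law M\<^sub>1 X\<^sub>1 Y\<^sub>1 (1 / (\<alpha>\<^sub>i\<^sub>n - 1)) (1 / (\<alpha>\<^sub>o\<^sub>u\<^sub>t - 1))) V\<^sub>1 at_top \<and>
      vague_convergence punctured_quadrant
        (scaled_law M\<^sub>2 X\<^sub>2 Y\<^sub>2 (1 / (\<alpha>\<^sub>i\<^sub>n - 1)) (1 / (\<alpha>\<^sub>o\<^sub>u\<^sub>t - 1))) V\<^sub>2 at_top \<and>
      has_quadrant_density V\<^sub>1 (density1 c\<^sub>1 a \<delta>\<^sub>i\<^sub>n \<delta>\<^sub>o\<^sub>u\<^sub>t) \<and>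
      has_quadrant_density V\<^sub>2 (density2 c\<^sub>1 a \<delta>\<^sub>i\<^sub>n \<delta>\<^sub>o\<^sub>u\<^sub>t) \<and>
      (\<forall>n\<^sub>0 G\<^sub>0 (M :: 'c measure) \<G> p (Q :: 'd measure) I J.
         pref_attachment \<alpha> \<beta> \<gamma> \<delta>\<^sub>i\<^sub>n \<delta>\<^sub>o\<^sub>u\<^sub>t n\<^sub>0 G\<^sub>0 M \<G> \<and>
         limiting_degree_distribution M \<G> p \<and>
         prob_space Q \<and>
         I \<in> measurable Q (count_space UNIV) \<and> J \<in> measurable Q (count_space UNIV) \<and>
         has_joint_pmf Q I J p \<longrightarrow>
         vague_convergence punctured_quadrant
           (scaled_law Q I J (1 / (\<alpha>\<^sub>i\<^sub>n - 1)) (1 / (\<alpha>\<^sub>o\<^sub>u\<^sub>t - 1)))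
           (add_measure (scale_measure (ennreal (\<gamma> / (\<alpha> + \<gamma>))) V\<^sub>1)
                        (scale_measure (ennreal (\<alpha> / (\<alpha> + \<gamma>))) V\<^sub>2)) at_top)"
proof -
  have c\<^sub>1: "c\<^sub>1 = (\<alpha> + \<beta>) / (1 + \<delta>\<^sub>i\<^sub>n * (\<alpha> + \<gamma>))" "1 / (\<alpha>\<^sub>i\<^sub>n - 1) = c\<^sub>1"
    using assms(10,12) by simp_all
  have c\<^sub>2: "c\<^sub>2 = (\<beta> + \<gamma>) / (1 + \<delta>\<^sub>o\<^sub>u\<^sub>t * (\<alpha> + \<gamma>))" "1 / (\<alpha>\<^sub>o\<^sub>u\<^sub>t - 1) = c\<^sub>2"
    using assms(11,13) by (simp_all add: add.commute)
  have "0 < \<alpha> + \<beta>" "0 < \<beta> + \<gamma>" using assms(4-7) by linarith+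
  then have c\<^sub>1_pos: "0 < c\<^sub>1" and c\<^sub>2_pos: "0 < c\<^sub>2"
    unfolding c\<^sub>1(1) c\<^sub>2(1) using assms(1-3,8,9) by (auto intro!: divide_pos_pos add_pos_nonneg)
  have a_pos: "0 < a" and a_c\<^sub>1: "c\<^sub>2 = a * c\<^sub>1" using assms(14) c\<^sub>1_pos c\<^sub>2_pos by simp_all
  let ?V\<^sub>1 = "limit_measure c\<^sub>1 a (\<delta>\<^sub>i\<^sub>n + 1) \<delta>\<^sub>o\<^sub>u\<^sub>t" and ?V\<^sub>2 = "limit_measure c\<^sub>1 a \<delta>\<^sub>i\<^sub>n (\<delta>\<^sub>o\<^sub>u\<^sub>t + 1)"
  have \<delta>: "0 < \<delta>\<^sub>i\<^sub>n + 1" "0 < \<delta>\<^sub>o\<^sub>u\<^sub>t + 1" using assms(8,9) by auto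
  have radon: "radon_measure_on punctured_quadrant ?V\<^sub>1" "radon_measure_on punctured_quadrant ?V\<^sub>2"
    using c\<^sub>1_pos a_pos \<delta> assms(8,9) by (auto intro: radon_limit_measure)
  have vague1: "vague_convergence punctured_quadrant (scaled_law M\<^sub>1 X\<^sub>1 Y\<^sub>1 c\<^sub>1 (a * c\<^sub>1)) ?V\<^sub>1 at_top"
    using assms(18) unfolding phi1_def
    by (intro vague_convergence_by_pgf c\<^sub>1_pos a_pos \<delta> assms(9,15-17))
  have vague2: "vague_convergence punctured_quadrant (scaled_law M\<^sub>2 X\<^sub>2 Y\<^sub>2 c\<^sub>1 (a * c\<^sub>1)) ?V\<^sub>2 at_top"
    using assms(22) unfolding phi2_def
    by (intro vague_convergence_by_pgf c\<^sub>1_pos a_pos \<delta> assms(8,19-21))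
  have degrees: "vague_convergence punctured_quadrant (scaled_law Q I J c\<^sub>1 (a * c\<^sub>1))
      (add_measure (scale_measure (ennreal (\<gamma> / (\<alpha> + \<gamma>))) ?V\<^sub>1) (scale_measure (ennreal (\<alpha> / (\<alpha> + \<gamma>))) ?V\<^sub>2)) at_top"
    if "pref_attachment \<alpha> \<beta> \<gamma> \<delta>\<^sub>i\<^sub>n \<delta>\<^sub>o\<^sub>u\<^sub>t n\<^sub>0 G\<^sub>0 M \<G>" "limiting_degree_distribution M \<G> p" "prob_space Q"
      "I \<in> measurable Q (count_space UNIV)" "J \<in> measurable Q (count_space UNIV)" "has_joint_pmf Q I J p"
    for n\<^sub>0 G\<^sub>0 \<G> p I J and M :: "'c measure" and Q :: "'d measure"
  proof -
    have "prob_space M" using that(1) by (simp add: pref_attachment_def)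
    then interpret pa_chain M \<alpha> \<beta> \<gamma> \<delta>\<^sub>i\<^sub>n \<delta>\<^sub>o\<^sub>u\<^sub>t n\<^sub>0 G\<^sub>0 \<G>
      using assms(1-4,8,9) that(1) by (intro pa_chain.intro pa_chain_axioms.intro)
    show ?thesis
      using assms(1,3)
      by (intro vague_convergence_mixture[OF c\<^sub>1_pos a_pos assms(8,9) _ _ that(3-6)]
          limiting_degrees_are_yule_mixture[OF that(2) assms(5-7) c\<^sub>1(1) _ c\<^sub>1_pos a_pos])
        (auto simp: a_c\<^sub>1[symmetric] c\<^sub>2(1))
  qed
  show ?thesis
    unfolding c\<^sub>1(2) c\<^sub>2(2) a_c\<^sub>1 density1_eq density2_eq
    using radon vague1 vague2 degrees has_quadrant_density_limit_measure
    by (intro exI[of _ ?V\<^sub>1] exI[of _ ?V\<^sub>2]) blast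
qed

end
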